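(* Let $\mathcal{A}$ be an essentially small additive category and $S$ a set of morphisms of $\mathcal{A}$. Let $B\subset \operatorname{Obj}K^b(\mathcal{A})$ be the set of cones of elements of $S$ and let $D$ be the extension-closure of $B$ in $K^b(\mathcal{A})$. Then the elements of $D$ are exactly those complexes that are isomorphic (in $K^b(\mathcal{A})$) to cones of morphisms given by lower triangular matrices with elements of $S$ on the diagonal, i.e. to complexes of the form $$\bigoplus_{j=1}^{n} S^{-1}_{j} \xrightarrow{\begin{pmatrix} s_{1} & 0 &\dots &0 \\ f_{12}& s_{2} &\dots &0 \\ \dots &\dots &\dots &\dots\\ f_{1n} & f_{2n} & \dots &s_{n} \end{pmatrix}} \bigoplus_{j=1}^{n} S^{0}_{j}$$ (with the second term in degree $0$) for some $n\ge 0$, $s_j:S_j^{-1}\to S_j^0$ in $S$ for $1\le j\le n$, and $f_{kl}\in\mathcal{A}(S_k^{-1},S_l^0)$ for all $1\le k<l\le n$.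
   Context: $K^b(\mathcal{A})$ is the homotopy category of bounded complexes over $\mathcal{A}$. The cone of a morphism $s:X\to Y$ of $\mathcal{A}$ is the complex $X\xrightarrow{s}Y$ with $Y$ in degree $0$. A class $E$ of objects of a triangulated category is extension-closed if it contains $0$ and, for any distinguished triangle $X\to Y\to Z$ with $X,Z\in E$, one has $Y\in E$; the extension-closure of $B$ is the smallest extension-closed class containing $B$. *)

theory Defs
  imports "HOL-Algebra.Group"
begin

section \<open>Additive categories\<close>

text \<open>
  Hom-sets of different pairs of objects are not assumed to be disjoint, so composition and
  addition take the objects as arguments. For \<open>f : X \<rightarrow> Y\<close> and \<open>g : Y \<rightarrow> Z\<close> the composite
  \<open>g \<circ> f\<close> is \<open>Comp C X Y Z g f\<close>. Objects and morphisms are elements of HOL types, so every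
  such category is small.
\<close>

record ('o, 'm) precat =
  Ob :: "'o set"
  Hom :: "'o \<Rightarrow> 'o \<Rightarrow> 'm set"
  Ident :: "'o \<Rightarrow> 'm"
  Comp :: "'o \<Rightarrow> 'o \<Rightarrow> 'o \<Rightarrow> 'm \<Rightarrow> 'm \<Rightarrow> 'm"
  Zero :: "'o \<Rightarrow> 'o \<Rightarrow> 'm"
  Add :: "'o \<Rightarrow> 'o \<Rightarrow> 'm \<Rightarrow> 'm \<Rightarrow> 'm"

definition hom_group :: "('o, 'm, 'x) precat_scheme \<Rightarrow> 'o \<Rightarrow> 'o \<Rightarrow> 'm monoid" where
  "hom_group C X Y = \<lparr>carrier = Hom C X Y, mult = Add C X Y, one = Zero C X Y\<rparr>"

abbreviation Neg :: "('o, 'm, 'x) precat_scheme \<Rightarrow> 'o \<Rightarrow> 'o \<Rightarrow> 'm \<Rightarrow> 'm" where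
  "Neg C X Y f \<equiv> inv\<^bsub>hom_group C X Y\<^esub> f"

definition is_zero_object :: "('o, 'm, 'x) precat_scheme \<Rightarrow> 'o \<Rightarrow> bool" where
  "is_zero_object C Z \<longleftrightarrow> Z \<in> Ob C \<and>
     (\<forall>T \<in> Ob C. (\<exists>!f. f \<in> Hom C Z T) \<and> (\<exists>!f. f \<in> Hom C T Z))"

definition is_product ::
  "('o, 'm, 'x) precat_scheme \<Rightarrow> 'i set \<Rightarrow> ('i \<Rightarrow> 'o) \<Rightarrow> 'o \<Rightarrow> ('i \<Rightarrow> 'm) \<Rightarrow> bool" where
  "is_product C I X P \<pi> \<longleftrightarrow> P \<in> Ob C \<and> (\<forall>i\<in>I. X i \<in> Ob C \<and> \<pi> i \<in> Hom C P (X i)) \<and>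
     (\<forall>T \<in> Ob C. \<forall>f. (\<forall>i\<in>I. f i \<in> Hom C T (X i)) \<longrightarrow>
        (\<exists>!h. h \<in> Hom C T P \<and> (\<forall>i\<in>I. Comp C T P (X i) (\<pi> i) h = f i)))"

definition is_coproduct ::
  "('o, 'm, 'x) precat_scheme \<Rightarrow> 'i set \<Rightarrow> ('i \<Rightarrow> 'o) \<Rightarrow> 'o \<Rightarrow> ('i \<Rightarrow> 'm) \<Rightarrow> bool" where
  "is_coproduct C I X P \<iota> \<longleftrightarrow> P \<in> Ob C \<and> (\<forall>i\<in>I. X i \<in> Ob C \<and> \<iota> i \<in> Hom C (X i) P) \<and>
     (\<forall>T \<in> Ob C. \<forall>f. (\<forall>i\<in>I. f i \<in> Hom C (X i) T) \<longrightarrow>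
        (\<exists>!h. h \<in> Hom C P T \<and> (\<forall>i\<in>I. Comp C (X i) P T h (\<iota> i) = f i)))"

definition is_direct_sum ::
  "('o, 'm, 'x) precat_scheme \<Rightarrow> 'i set \<Rightarrow> ('i \<Rightarrow> 'o) \<Rightarrow> 'o \<Rightarrow> ('i \<Rightarrow> 'm) \<Rightarrow> ('i \<Rightarrow> 'm) \<Rightarrow> bool" where
  "is_direct_sum C I X P \<iota> \<pi> \<longleftrightarrow> is_coproduct C I X P \<iota> \<and> is_product C I X P \<pi> \<and>
     (\<forall>i\<in>I. \<forall>j\<in>I. Comp C (X i) P (X j) (\<pi> j) (\<iota> i) =
        (if i = j then Ident C (X i) else Zero C (X i) (X j)))"

text \<open>\<open>m k l\<close> is the component from the \<open>k\<close>-th summand of the source to the \<open>l\<close>-th summand of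
  the target, i.e. the entry in column \<open>k\<close> and row \<open>l\<close>.\<close>

definition given_by_matrix ::
  "('o, 'm, 'x) precat_scheme \<Rightarrow> 'i set \<Rightarrow> ('i \<Rightarrow> 'o) \<Rightarrow> 'o \<Rightarrow> ('i \<Rightarrow> 'm) \<Rightarrow>
   'j set \<Rightarrow> ('j \<Rightarrow> 'o) \<Rightarrow> 'o \<Rightarrow> ('j \<Rightarrow> 'm) \<Rightarrow> ('i \<Rightarrow> 'j \<Rightarrow> 'm) \<Rightarrow> 'm \<Rightarrow> bool" where
  "given_by_matrix C I X P \<iota> J Y Q \<pi> m u \<longleftrightarrow> u \<in> Hom C P Q \<and>
     (\<forall>k\<in>I. \<forall>l\<in>J. Comp C (X k) P (Y l) (Comp C P Q (Y l) (\<pi> l) u) (\<iota> k) = m k l)"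

locale category =
  fixes C :: "('o, 'm, 'x) precat_scheme"
  assumes Ident_in: "X \<in> Ob C \<Longrightarrow> Ident C X \<in> Hom C X X"
    and Comp_in: "\<lbrakk>X \<in> Ob C; Y \<in> Ob C; Z \<in> Ob C; f \<in> Hom C X Y; g \<in> Hom C Y Z\<rbrakk>
      \<Longrightarrow> Comp C X Y Z g f \<in> Hom C X Z"
    and Comp_Ident: "\<lbrakk>X \<in> Ob C; Y \<in> Ob C; f \<in> Hom C X Y\<rbrakk> \<Longrightarrow> Comp C X X Y f (Ident C X) = f"
    and Ident_Comp: "\<lbrakk>X \<in> Ob C; Y \<in> Ob C; f \<in> Hom C X Y\<rbrakk> \<Longrightarrow> Comp C X Y Y (Ident C Y) f = f"
    and Comp_assoc: "\<lbrakk>W \<in> Ob C; X \<in> Ob C; Y \<in> Ob C; Z \<in> Ob C;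
        f \<in> Hom C W X; g \<in> Hom C X Y; h \<in> Hom C Y Z\<rbrakk>
      \<Longrightarrow> Comp C W Y Z h (Comp C W X Y g f) = Comp C W X Z (Comp C X Y Z h g) f"

locale preadditive_category = category C for C :: "('o, 'm, 'x) precat_scheme" +
  assumes hom_comm_group: "\<lbrakk>X \<in> Ob C; Y \<in> Ob C\<rbrakk> \<Longrightarrow> comm_group (hom_group C X Y)"
    and Comp_Add_left: "\<lbrakk>X \<in> Ob C; Y \<in> Ob C; Z \<in> Ob C;
        f \<in> Hom C X Y; g \<in> Hom C Y Z; g' \<in> Hom C Y Z\<rbrakk>
      \<Longrightarrow> Comp C X Y Z (Add C Y Z g g') f = Add C X Z (Comp C X Y Z g f) (Comp C X Y Z g' f)"
    and Comp_Add_right: "\<lbrakk>X \<in> Ob C; Y \<in> Ob C; Z \<in> Ob C;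
        f \<in> Hom C X Y; f' \<in> Hom C X Y; g \<in> Hom C Y Z\<rbrakk>
      \<Longrightarrow> Comp C X Y Z g (Add C X Y f f') = Add C X Z (Comp C X Y Z g f) (Comp C X Y Z g f')"

text \<open>The case \<open>n = 0\<close> of the axiom provides a zero object.\<close>

locale additive_category = preadditive_category C for C :: "('o, 'm, 'x) precat_scheme" +
  assumes direct_sums: "(\<And>j. j < n \<Longrightarrow> X j \<in> Ob C)
      \<Longrightarrow> \<exists>P \<iota> \<pi>. is_direct_sum C {..<n::nat} X P \<iota> \<pi>"

definition arrows :: "('o, 'm, 'x) precat_scheme \<Rightarrow> ('o \<times> 'o \<times> 'm) set" where
  "arrows C = {(X, Y, f). X \<in> Ob C \<and> Y \<in> Ob C \<and> f \<in> Hom C X Y}"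

definition is_iso :: "('o, 'm, 'x) precat_scheme \<Rightarrow> 'o \<Rightarrow> 'o \<Rightarrow> 'm \<Rightarrow> bool" where
  "is_iso C X Y f \<longleftrightarrow> f \<in> Hom C X Y \<and>
     (\<exists>g \<in> Hom C Y X. Comp C X Y X g f = Ident C X \<and> Comp C Y X Y f g = Ident C Y)"

definition isomorphic :: "('o, 'm, 'x) precat_scheme \<Rightarrow> 'o \<Rightarrow> 'o \<Rightarrow> bool" where
  "isomorphic C X Y \<longleftrightarrow> X \<in> Ob C \<and> Y \<in> Ob C \<and> (\<exists>f. is_iso C X Y f)"


section \<open>Distinguished triangles and extension-closure\<close>

text \<open>The tuple \<open>(X, Y, Z, u, v, w)\<close> stands for the triangle
  \<open>X \<rightarrow>\<^sub>u Y \<rightarrow>\<^sub>v Z \<rightarrow>\<^sub>w X[1]\<close>. The record carries the data of a triangulated category; the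
  axioms are not needed in order to define extension-closed classes.\<close>

type_synonym ('o, 'm) triangle = "'o \<times> 'o \<times> 'o \<times> 'm \<times> 'm \<times> 'm"

record ('o, 'm) tricat = "('o, 'm) precat" +
  Shift :: "'o \<Rightarrow> 'o"
  ShiftMor :: "'o \<Rightarrow> 'o \<Rightarrow> 'm \<Rightarrow> 'm"
  Distinguished :: "('o, 'm) triangle set"

definition extension_closed :: "('o, 'm, 'x) tricat_scheme \<Rightarrow> 'o set \<Rightarrow> bool" where
  "extension_closed T E \<longleftrightarrow> E \<subseteq> Ob T \<and> (\<forall>Z. is_zero_object T Z \<longrightarrow> Z \<in> E) \<and>
     (\<forall>X Y Z u v w. (X, Y, Z, u, v, w) \<in> Distinguished T \<and> X \<in> E \<and> Z \<in> E \<longrightarrow> Y \<in> E)"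

definition extension_closure :: "('o, 'm, 'x) tricat_scheme \<Rightarrow> 'o set \<Rightarrow> 'o set" where
  "extension_closure T B = \<Inter> {E. extension_closed T E \<and> B \<subseteq> E}"


section \<open>The homotopy category of bounded complexes\<close>

text \<open>Cohomological indexing: \<open>diff X n : X\<^sup>n \<rightarrow> X\<^sup>n\<^sup>+\<^sup>1\<close>.\<close>

record ('o, 'm) cpx =
  obj :: "int \<Rightarrow> 'o"
  diff :: "int \<Rightarrow> 'm"

definition bounded_complexes :: "('o, 'm, 'x) precat_scheme \<Rightarrow> ('o, 'm) cpx set" where
  "bounded_complexes A = {X.
     (\<forall>n. obj X n \<in> Ob A \<and> diff X n \<in> Hom A (obj X n) (obj X (n+1))) \<and>
     (\<forall>n. Comp A (obj X n) (obj X (n+1)) (obj X (n+2)) (diff X (n+1)) (diff X n)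
            = Zero A (obj X n) (obj X (n+2))) \<and>
     (\<exists>N. \<forall>n. \<bar>n\<bar> > N \<longrightarrow> is_zero_object A (obj X n))}"

definition chain_maps ::
  "('o, 'm, 'x) precat_scheme \<Rightarrow> ('o, 'm) cpx \<Rightarrow> ('o, 'm) cpx \<Rightarrow> (int \<Rightarrow> 'm) set" where
  "chain_maps A X Y = {f. \<forall>n. f n \<in> Hom A (obj X n) (obj Y n) \<and>
     Comp A (obj X n) (obj Y n) (obj Y (n+1)) (diff Y n) (f n) =
     Comp A (obj X n) (obj X (n+1)) (obj Y (n+1)) (f (n+1)) (diff X n)}"

definition homotopy_rel ::
  "('o, 'm, 'x) precat_scheme \<Rightarrow> ('o, 'm) cpx \<Rightarrow> ('o, 'm) cpx \<Rightarrow> (int \<Rightarrow> 'm) rel" where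
  "homotopy_rel A X Y = {(f, g). f \<in> chain_maps A X Y \<and> g \<in> chain_maps A X Y \<and>
     (\<exists>h. (\<forall>n. h n \<in> Hom A (obj X n) (obj Y (n-1))) \<and>
        (\<forall>n. g n = Add A (obj X n) (obj Y n) (f n)
           (Add A (obj X n) (obj Y n)
              (Comp A (obj X n) (obj Y (n-1)) (obj Y n) (diff Y (n-1)) (h n))
              (Comp A (obj X n) (obj X (n+1)) (obj Y n) (h (n+1)) (diff X n)))))}"

definition htpy_class ::
  "('o, 'm, 'x) precat_scheme \<Rightarrow> ('o, 'm) cpx \<Rightarrow> ('o, 'm) cpx \<Rightarrow> (int \<Rightarrow> 'm) \<Rightarrow> (int \<Rightarrow> 'm) set" where
  "htpy_class A X Y f = homotopy_rel A X Y `` {f}"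

definition homotopy_category ::
  "('o, 'm, 'x) precat_scheme \<Rightarrow> (('o, 'm) cpx, (int \<Rightarrow> 'm) set) precat" where
  "homotopy_category A = \<lparr>
     Ob = bounded_complexes A,
     Hom = (\<lambda>X Y. chain_maps A X Y // homotopy_rel A X Y),
     Ident = (\<lambda>X. htpy_class A X X (\<lambda>n. Ident A (obj X n))),
     Comp = (\<lambda>X Y Z G F. \<Union>g\<in>G. \<Union>f\<in>F.
       htpy_class A X Z (\<lambda>n. Comp A (obj X n) (obj Y n) (obj Z n) (g n) (f n))),
     Zero = (\<lambda>X Y. htpy_class A X Y (\<lambda>n. Zero A (obj X n) (obj Y n))),
     Add = (\<lambda>X Y F G. \<Union>f\<in>F. \<Union>g\<in>G.
       htpy_class A X Y (\<lambda>n. Add A (obj X n) (obj Y n) (f n) (g n)))\<rparr>"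

definition shift_cpx :: "('o, 'm, 'x) precat_scheme \<Rightarrow> ('o, 'm) cpx \<Rightarrow> ('o, 'm) cpx" where
  "shift_cpx A X = \<lparr>obj = (\<lambda>n. obj X (n+1)),
     diff = (\<lambda>n. Neg A (obj X (n+1)) (obj X (n+2)) (diff X (n+1)))\<rparr>"

definition shift_mor ::
  "('o, 'm, 'x) precat_scheme \<Rightarrow> ('o, 'm) cpx \<Rightarrow> ('o, 'm) cpx \<Rightarrow> (int \<Rightarrow> 'm) set \<Rightarrow> (int \<Rightarrow> 'm) set" where
  "shift_mor A X Y F = (\<Union>f\<in>F. htpy_class A (shift_cpx A X) (shift_cpx A Y) (\<lambda>n. f (n+1)))"

text \<open>\<open>K\<close> is a mapping cone of \<open>f : X \<rightarrow> Y\<close>, with \<open>K\<^sup>n = X\<^sup>n\<^sup>+\<^sup>1 \<oplus> Y\<^sup>n\<close> (summands \<open>0\<close> and \<open>1\<close>), whose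
  differential has the components \<open>-d\<^sub>X\<close>, \<open>f\<close> and \<open>d\<^sub>Y\<close>. Direct sums are determined only up to
  isomorphism, hence a predicate.\<close>

definition mapping_cone ::
  "('o, 'm, 'x) precat_scheme \<Rightarrow> ('o, 'm) cpx \<Rightarrow> ('o, 'm) cpx \<Rightarrow> (int \<Rightarrow> 'm) \<Rightarrow>
   ('o, 'm) cpx \<Rightarrow> (int \<Rightarrow> nat \<Rightarrow> 'm) \<Rightarrow> (int \<Rightarrow> nat \<Rightarrow> 'm) \<Rightarrow> bool" where
  "mapping_cone A X Y f K \<iota> \<pi> \<longleftrightarrow>
     (let part = (\<lambda>n j. if j = 0 then obj X (n+1) else obj Y n) in
      \<forall>n. is_direct_sum A {0,1} (part n) (obj K n) (\<iota> n) (\<pi> n) \<and>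
          given_by_matrix A {0,1} (part n) (obj K n) (\<iota> n)
            {0,1} (part (n+1)) (obj K (n+1)) (\<pi> (n+1))
            (\<lambda>k l. if k = 0 \<and> l = 0 then Neg A (obj X (n+1)) (obj X (n+2)) (diff X (n+1))
                   else if k = 0 \<and> l = 1 then f (n+1)
                   else if k = 1 \<and> l = 0 then Zero A (obj Y n) (obj X (n+2))
                   else diff Y n)
            (diff K n))"

definition standard_triangles ::
  "('o, 'm, 'x) precat_scheme \<Rightarrow> (('o, 'm) cpx, (int \<Rightarrow> 'm) set) triangle set" where
  "standard_triangles A =
     {(X, Y, K, htpy_class A X Y f, htpy_class A Y K (\<lambda>n. \<iota> n 1),
       htpy_class A K (shift_cpx A X) (\<lambda>n. \<pi> n 0)) | X Y f K \<iota> \<pi>.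
       X \<in> bounded_complexes A \<and> Y \<in> bounded_complexes A \<and> f \<in> chain_maps A X Y \<and>
       mapping_cone A X Y f K \<iota> \<pi>}"

definition Kb_triangles ::
  "('o, 'm, 'x) precat_scheme \<Rightarrow> (('o, 'm) cpx, (int \<Rightarrow> 'm) set) triangle set" where
  "Kb_triangles A = (let H = homotopy_category A; sh = shift_cpx A in
     {(X, Y, Z, u, v, w).
       X \<in> Ob H \<and> Y \<in> Ob H \<and> Z \<in> Ob H \<and>
       u \<in> Hom H X Y \<and> v \<in> Hom H Y Z \<and> w \<in> Hom H Z (sh X) \<and>
       (\<exists>X' Y' Z' u' v' w' a b c. (X', Y', Z', u', v', w') \<in> standard_triangles A \<and>
          is_iso H X X' a \<and> is_iso H Y Y' b \<and> is_iso H Z Z' c \<and>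
          Comp H X X' Y' u' a = Comp H X Y Y' b u \<and>
          Comp H Y Y' Z' v' b = Comp H Y Z Z' c v \<and>
          Comp H Z Z' (sh X') w' c = Comp H Z (sh X) (sh X') (shift_mor A X X' a) w)})"

definition Kb ::
  "('o, 'm, 'x) precat_scheme \<Rightarrow> (('o, 'm) cpx, (int \<Rightarrow> 'm) set) tricat" where
  "Kb A = precat.extend (homotopy_category A)
     (tricat.fields (shift_cpx A) (shift_mor A) (Kb_triangles A))"

text \<open>The two-term complex \<open>X \<rightarrow>\<^sub>s Y\<close> with \<open>Y\<close> in degree \<open>0\<close>, padded by a fixed zero object.\<close>

definition zero_ob :: "('o, 'm, 'x) precat_scheme \<Rightarrow> 'o" where
  "zero_ob A = (SOME Z. is_zero_object A Z)"

definition cone :: "('o, 'm, 'x) precat_scheme \<Rightarrow> 'o \<Rightarrow> 'o \<Rightarrow> 'm \<Rightarrow> ('o, 'm) cpx" where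
  "cone A X Y s = (let ob = (\<lambda>n. if n = -1 then X else if n = 0 then Y else zero_ob A) in
     \<lparr>obj = ob, diff = (\<lambda>n. if n = -1 then s else Zero A (ob n) (ob (n+1)))\<rparr>)"

end

theory Submission
  imports Defs "HOL-Library.Function_Algebras"
begin

text \<open>
  A degreewise split extension of \<open>Z\<close> by \<open>X\<close> is determined by a degree 1 morphism \<open>w : Z \<rightarrow> X\<close> with
  \<open>d w + w d = 0\<close>, and up to homotopy equivalence it depends only on the homotopy types of \<open>X\<close> and \<open>Z\<close>
  and on the homotopy class of \<open>w\<close>. By rotation, the middle term of a distinguished triangle is
  homotopy equivalent to such an extension, and every such extension is the middle term of a
  distinguished triangle. If \<open>X\<close> and \<open>Z\<close> are complexes \<open>P \<rightarrow> Q\<close> in degrees \<open>-1\<close> and \<open>0\<close>, then \<open>w\<close> is a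
  single morphism \<open>P\<^sub>Z \<rightarrow> Q\<^sub>X\<close>, which becomes the block below the diagonal; conversely a triangular
  matrix is an extension of the matrix without its last row and column by its last diagonal entry.

  All identities between morphisms are checked in a ring. To obtain an honest type of class \<open>ring\<close>
  although types cannot depend on the category, we let \<open>elt\<close> consist of the functions that
  choose an element of every hom-group of every preadditive category on the given types; this is
  an abelian group, and each morphism of each category acts on it additively and faithfully.
\<close>

section \<open>Embedding a preadditive category into a ring\<close>

text \<open>A ring element does not know its source and target, so typing is tracked separately:
  membership in \<open>emb_hom X Y\<close> supplies it, and the identity of \<open>X\<close> becomes
  an idempotent \<open>e X\<close> that acts as a unit only on operators starting or ending at
  \<open>X\<close>. Passing to whole families \<open>graded k F\<close> removes the degrees as well:
  a complex becomes an operator with \<open>D X * D X = 0\<close>, and verifications become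
  rewriting problems for words in a few generators.

  The axioms of a triangulated category are not established for \<open>Kb A\<close>; its triangles
  are simply those isomorphic to mapping cones. Rotation therefore enters as two explicit homotopy
  equivalences: the cone of a degreewise split inclusion with the quotient
  (\<open>hinv_cone_of_inclusion\<close>), and the middle term of a cone triangle with the extension
  given by the projection of the cone to X[1] (\<open>heqv_cocone\<close>). Likewise the comparison
  maps between extensions are inverted by hand instead of by a five lemma: up to homotopy their
  composites are \<open>E + N\<close> with \<open>N * N = 0\<close>, with inverse
  \<open>E - N\<close>.\<close>

definition elt_group :: "('o, 'm) precat \<Rightarrow> 'o \<Rightarrow> 'o \<Rightarrow> 'm monoid" where
  "elt_group A T X = (if preadditive_category A \<and> T \<in> Ob A \<and> X \<in> Ob A then hom_group A T X
     else \<lparr>carrier = {undefined}, mult = (\<lambda>_ _. undefined), one = undefined\<rparr>)"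

text \<open>The trivial group on \<open>undefined\<close> stands in wherever there is no hom-group,
  so the group laws hold without side conditions, as the class instance for \<open>elt\<close>
  requires.\<close>

lemma elt_group: "comm_group (elt_group A T X)"
proof (cases "preadditive_category A \<and> T \<in> Ob A \<and> X \<in> Ob A")
  case True
  then show ?thesis
    by (simp add: elt_group_def preadditive_category.hom_comm_group)
next
  case False
  show ?thesis
    by (rule comm_groupI) (auto simp: elt_group_def False)
qed

lemma group_elt_group: "group (elt_group A T X)"
  using elt_group by (rule comm_group.axioms)

lemma monoid_elt_group: "monoid (elt_group A T X)"
  using group_elt_group by (rule group.is_monoid)

lemmas elt_group_simps [simp] =
  monoid.m_closed[OF monoid_elt_group] monoid.one_closed[OF monoid_elt_group]
  monoid.l_one[OF monoid_elt_group] monoid.r_one[OF monoid_elt_group]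
  group.inv_closed[OF group_elt_group] group.l_inv[OF group_elt_group]

typedef ('o, 'm) elt =
  "{v :: ('o, 'm) precat \<Rightarrow> 'o \<Rightarrow> 'o \<Rightarrow> 'm. \<forall>A T X. v A T X \<in> carrier (elt_group A T X)}"
  by (rule exI[of _ "\<lambda>A T X. \<one>\<^bsub>elt_group A T X\<^esub>"]) simp

lemma Rep_elt_closed [simp]: "Rep_elt v A T X \<in> carrier (elt_group A T X)"
  using Rep_elt[of v] by simp

lemma elt_eqI: "(\<And>A T X. Rep_elt v A T X = Rep_elt w A T X) \<Longrightarrow> v = w"
  by (metis Rep_elt_inject ext)

instantiation elt :: (type, type) ab_group_add
begin

definition "0 = Abs_elt (\<lambda>A T X. \<one>\<^bsub>elt_group A T X\<^esub>)"
definition "v + w = Abs_elt (\<lambda>A T X. Rep_elt v A T X \<otimes>\<^bsub>elt_group A T X\<^esub> Rep_elt w A T X)"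
definition "- v = Abs_elt (\<lambda>A T X. inv\<^bsub>elt_group A T X\<^esub> Rep_elt v A T X)"
definition "v - w = v + - (w :: ('a, 'b) elt)"

lemma Rep_elt_simps:
  "Rep_elt 0 A T X = \<one>\<^bsub>elt_group A T X\<^esub>"
  "Rep_elt (v + w) A T X = Rep_elt v A T X \<otimes>\<^bsub>elt_group A T X\<^esub> Rep_elt w A T X"
  "Rep_elt (- v) A T X = inv\<^bsub>elt_group A T X\<^esub> Rep_elt v A T X"
  by (simp_all add: zero_elt_def plus_elt_def uminus_elt_def Abs_elt_inverse)

instance
proof
  fix a b c :: "('a, 'b) elt"
  show "a + b + c = a + (b + c)"
    by (rule elt_eqI) (simp add: Rep_elt_simps monoid.m_assoc[OF monoid_elt_group])
  show "a + b = b + a"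
    by (rule elt_eqI)
      (simp add: Rep_elt_simps comm_monoid.m_comm[OF comm_group.axioms(1)[OF elt_group]])
  show "0 + a = a"
    by (rule elt_eqI) (simp add: Rep_elt_simps)
  show "- a + a = 0"
    by (rule elt_eqI) (simp add: Rep_elt_simps)
  show "a - b = a + - b"
    by (simp add: minus_elt_def)
qed

end

text \<open>Used over \<open>elt\<close> for single morphisms and, with pointwise addition, over
  \<open>int \<Rightarrow> elt\<close> for whole graded families.\<close>

typedef (overloaded) 'a endo = "{f :: 'a::ab_group_add \<Rightarrow> 'a. \<forall>x y. f (x + y) = f x + f y}"
  by (rule exI[of _ "\<lambda>x. x"]) simp

lemma Rep_endo_add [simp]: "Rep_endo f (x + y) = Rep_endo f x + Rep_endo f y"
  using Rep_endo[of f] by simp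

instantiation endo :: (ab_group_add) ring
begin

definition "0 = Abs_endo (\<lambda>x. 0)"
definition "f + g = Abs_endo (\<lambda>x. Rep_endo f x + Rep_endo g x)"
definition "- f = Abs_endo (\<lambda>x. - Rep_endo f x)"
definition "f - g = f + - (g :: 'a endo)"
definition "f * g = Abs_endo (\<lambda>x. Rep_endo f (Rep_endo g x))"

lemma Rep_endo_simps:
  "Rep_endo 0 x = 0"
  "Rep_endo (f + g) x = Rep_endo f x + Rep_endo g x"
  "Rep_endo (- f) x = - Rep_endo f x"
  "Rep_endo (f * g) x = Rep_endo f (Rep_endo g x)"
  by (simp_all add: zero_endo_def plus_endo_def uminus_endo_def times_endo_def
      Abs_endo_inverse algebra_simps)

instance
  by standard
    (simp_all add: Rep_endo_inject[symmetric] fun_eq_iff Rep_endo_simps minus_endo_def algebra_simps)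

end

lemma endo_eqI: "(\<And>x. Rep_endo f x = Rep_endo g x) \<Longrightarrow> f = g"
  by (metis Rep_endo_inject ext)

type_synonym ('o, 'm) mor = "('o, 'm) elt endo"

text \<open>Restricted to plain records: the category occurs as an argument of the elements of
  \<open>elt\<close>, whose type mentions \<open>precat\<close> without extension.\<close>

locale preadd = preadditive_category A for A :: "('o, 'm) precat"
begin

lemma elt_group_Ob: "\<lbrakk>T \<in> Ob A; X \<in> Ob A\<rbrakk> \<Longrightarrow> elt_group A T X = hom_group A T X"
  by (simp add: elt_group_def preadditive_category_axioms)

lemma Rep_elt_Hom: "\<lbrakk>T \<in> Ob A; X \<in> Ob A\<rbrakk> \<Longrightarrow> Rep_elt v A T X \<in> Hom A T X"
  using Rep_elt_closed[of v A T X] by (simp add: elt_group_Ob hom_group_def)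

text \<open>The Yoneda action of \<open>f\<close> by postcomposition on all groups
  \<open>Hom A T X\<close> at once. The other components are reset to the neutral element rather
  than kept, so that the action is additive in \<open>f\<close> as well as in
  \<open>v\<close>.\<close>

definition act :: "'o \<Rightarrow> 'o \<Rightarrow> 'm \<Rightarrow> ('o, 'm) elt \<Rightarrow> ('o, 'm) elt" where
  "act X Y f v = Abs_elt (\<lambda>A' T Z. if A' = A \<and> T \<in> Ob A \<and> Z = Y
     then Comp A T X Y f (Rep_elt v A T X) else \<one>\<^bsub>elt_group A' T Z\<^esub>)"

lemma Rep_act:
  assumes "X \<in> Ob A" "Y \<in> Ob A" "f \<in> Hom A X Y"
  shows "Rep_elt (act X Y f v) A' T Z = (if A' = A \<and> T \<in> Ob A \<and> Z = Y
     then Comp A T X Y f (Rep_elt v A T X) else \<one>\<^bsub>elt_group A' T Z\<^esub>)"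
proof -
  have "Comp A T X Y f (Rep_elt v A T X) \<in> carrier (elt_group A T Y)" if "T \<in> Ob A" for T
    using that assms by (simp add: elt_group_Ob hom_group_def Comp_in Rep_elt_Hom)
  then show ?thesis
    unfolding act_def by (subst Abs_elt_inverse) auto
qed

lemma act_add:
  assumes "X \<in> Ob A" "Y \<in> Ob A" "f \<in> Hom A X Y"
  shows "act X Y f (v + w) = act X Y f v + act X Y f w"
proof (rule elt_eqI)
  fix A' T Z
  show "Rep_elt (act X Y f (v + w)) A' T Z = Rep_elt (act X Y f v + act X Y f w) A' T Z"
    using assms Comp_Add_right[of T X Y "Rep_elt v A T X" "Rep_elt w A T X" f]
    by (auto simp: Rep_act Rep_elt_simps Rep_elt_Hom elt_group_Ob) (simp_all add: hom_group_def)
qed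

definition emb :: "'o \<Rightarrow> 'o \<Rightarrow> 'm \<Rightarrow> ('o, 'm) mor" where
  "emb X Y f = Abs_endo (act X Y f)"

lemma Rep_emb:
  "\<lbrakk>X \<in> Ob A; Y \<in> Ob A; f \<in> Hom A X Y\<rbrakk> \<Longrightarrow> Rep_endo (emb X Y f) = act X Y f"
  unfolding emb_def by (rule Abs_endo_inverse) (simp add: act_add)

lemma Add_in: "\<lbrakk>X \<in> Ob A; Y \<in> Ob A; f \<in> Hom A X Y; g \<in> Hom A X Y\<rbrakk> \<Longrightarrow> Add A X Y f g \<in> Hom A X Y"
  using monoid.m_closed[OF monoid_elt_group[of A X Y], of f g] by (simp add: elt_group_Ob hom_group_def)

lemma Zero_in: "\<lbrakk>X \<in> Ob A; Y \<in> Ob A\<rbrakk> \<Longrightarrow> Zero A X Y \<in> Hom A X Y"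
  using monoid.one_closed[OF monoid_elt_group[of A X Y]] by (simp add: elt_group_Ob hom_group_def)

lemma Neg_in: "\<lbrakk>X \<in> Ob A; Y \<in> Ob A; f \<in> Hom A X Y\<rbrakk> \<Longrightarrow> Neg A X Y f \<in> Hom A X Y"
  using group.inv_closed[OF group_elt_group[of A X Y], of f] by (simp add: elt_group_Ob) (simp add: hom_group_def)

lemma emb_Add:
  assumes "X \<in> Ob A" "Y \<in> Ob A" "f \<in> Hom A X Y" "g \<in> Hom A X Y"
  shows "emb X Y (Add A X Y f g) = emb X Y f + emb X Y g"
proof (rule endo_eqI, rule elt_eqI)
  fix v A' T Z
  show "Rep_elt (Rep_endo (emb X Y (Add A X Y f g)) v) A' T Z =
    Rep_elt (Rep_endo (emb X Y f + emb X Y g) v) A' T Z"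
    using assms Comp_Add_left[of T X Y "Rep_elt v A T X" f g]
    by (auto simp: Rep_emb Rep_endo_simps Add_in Rep_act Rep_elt_simps Rep_elt_Hom elt_group_Ob)
      (simp_all add: hom_group_def)
qed

lemma emb_Comp:
  assumes "X \<in> Ob A" "Y \<in> Ob A" "Z \<in> Ob A" "f \<in> Hom A X Y" "g \<in> Hom A Y Z"
  shows "emb X Z (Comp A X Y Z g f) = emb Y Z g * emb X Y f"
proof (rule endo_eqI, rule elt_eqI)
  fix v A' T W
  show "Rep_elt (Rep_endo (emb X Z (Comp A X Y Z g f)) v) A' T W =
    Rep_elt (Rep_endo (emb Y Z g * emb X Y f) v) A' T W"
    using assms by (auto simp: Rep_emb Rep_endo_simps Comp_in Rep_act Rep_elt_Hom Comp_assoc)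
qed

lemma emb_Zero:
  assumes "X \<in> Ob A" "Y \<in> Ob A"
  shows "emb X Y (Zero A X Y) = 0"
proof -
  have "Add A X Y (Zero A X Y) (Zero A X Y) = Zero A X Y"
    using monoid.l_one[OF monoid_elt_group[of A X Y] monoid.one_closed[OF monoid_elt_group]] assms
    by (simp add: elt_group_Ob hom_group_def)
  then show ?thesis
    using emb_Add[of X Y "Zero A X Y" "Zero A X Y"] assms by (simp add: Zero_in)
qed

lemma emb_Neg:
  assumes "X \<in> Ob A" "Y \<in> Ob A" "f \<in> Hom A X Y"
  shows "emb X Y (Neg A X Y f) = - emb X Y f"
proof -
  have "Add A X Y (Neg A X Y f) f = Zero A X Y"
    using group.l_inv[OF group_elt_group[of A X Y], of f] assms
    by (simp add: elt_group_Ob) (simp add: hom_group_def)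
  then have "emb X Y (Neg A X Y f) + emb X Y f = 0"
    using emb_Add[of X Y "Neg A X Y f" f] assms by (simp add: Neg_in emb_Zero)
  then show ?thesis
    by (simp add: eq_neg_iff_add_eq_0)
qed

text \<open>Yoneda: evaluated at the family \<open>v\<close> that is the identity in the component
  at \<open>A\<close>, \<open>X\<close>, \<open>X\<close> and neutral elsewhere, the operator
  returns the morphism itself.\<close>

lemma emb_inject:
  assumes "X \<in> Ob A" "Y \<in> Ob A" "f \<in> Hom A X Y" "g \<in> Hom A X Y" "emb X Y f = emb X Y g"
  shows "f = g"
proof -
  define v :: "('o, 'm) elt" where
    "v = Abs_elt (\<lambda>A' T Z. if A' = A \<and> T = X \<and> Z = X then Ident A X else \<one>\<^bsub>elt_group A' T Z\<^esub>)"
  have "Rep_elt v = (\<lambda>A' T Z. if A' = A \<and> T = X \<and> Z = X then Ident A X else \<one>\<^bsub>elt_group A' T Z\<^esub>)"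
    unfolding v_def by (rule Abs_elt_inverse) (use assms in \<open>auto simp: elt_group_Ob hom_group_def Ident_in\<close>)
  then have v: "Rep_elt v A X X = Ident A X"
    by simp
  have "Rep_elt (act X Y f v) A X Y = Rep_elt (act X Y g v) A X Y"
    using assms by (metis Rep_emb)
  then show ?thesis
    using assms by (simp add: Rep_act v Comp_Ident)
qed

text \<open>Empty unless \<open>X\<close> and \<open>Y\<close> are objects, so that membership carries this side condition along.\<close>

definition emb_hom :: "'o \<Rightarrow> 'o \<Rightarrow> ('o, 'm) mor set" where
  "emb_hom X Y = {emb X Y f | f. X \<in> Ob A \<and> Y \<in> Ob A \<and> f \<in> Hom A X Y}"

definition unemb :: "'o \<Rightarrow> 'o \<Rightarrow> ('o, 'm) mor \<Rightarrow> 'm" where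
  "unemb X Y = inv_into (Hom A X Y) (emb X Y)"

definition e :: "'o \<Rightarrow> ('o, 'm) mor" where
  "e X = emb X X (Ident A X)"

lemma emb_hom_Ob: "F \<in> emb_hom X Y \<Longrightarrow> X \<in> Ob A \<and> Y \<in> Ob A"
  by (auto simp: emb_hom_def)

lemma emb_emb_hom: "\<lbrakk>X \<in> Ob A; Y \<in> Ob A; f \<in> Hom A X Y\<rbrakk> \<Longrightarrow> emb X Y f \<in> emb_hom X Y"
  by (auto simp: emb_hom_def)

lemma unemb:
  assumes "F \<in> emb_hom X Y"
  shows unemb_in: "unemb X Y F \<in> Hom A X Y" and emb_unemb: "emb X Y (unemb X Y F) = F"
proof -
  have "F \<in> emb X Y ` Hom A X Y"
    using assms by (auto simp: emb_hom_def)
  then show "unemb X Y F \<in> Hom A X Y" "emb X Y (unemb X Y F) = F"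
    unfolding unemb_def by (rule inv_into_into, rule f_inv_into_f)
qed

lemma unemb_emb: "\<lbrakk>X \<in> Ob A; Y \<in> Ob A; f \<in> Hom A X Y\<rbrakk> \<Longrightarrow> unemb X Y (emb X Y f) = f"
  using emb_inject[of X Y "unemb X Y (emb X Y f)" f] by (simp add: unemb_in emb_emb_hom emb_unemb)

lemma emb_hom_mult: "\<lbrakk>F \<in> emb_hom X Y; G \<in> emb_hom Y Z\<rbrakk> \<Longrightarrow> G * F \<in> emb_hom X Z"
  unfolding emb_hom_def by (auto simp: emb_Comp[symmetric]) (metis Comp_in)

lemma emb_hom_add: "\<lbrakk>G \<in> emb_hom X Y; F \<in> emb_hom X Y\<rbrakk> \<Longrightarrow> G + F \<in> emb_hom X Y"
  unfolding emb_hom_def by (auto simp: emb_Add[symmetric]) (metis Add_in)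

lemma emb_hom_zero: "\<lbrakk>X \<in> Ob A; Y \<in> Ob A\<rbrakk> \<Longrightarrow> 0 \<in> emb_hom X Y"
  by (metis emb_Zero Zero_in emb_emb_hom)

lemma emb_hom_neg: "F \<in> emb_hom X Y \<Longrightarrow> - F \<in> emb_hom X Y"
  unfolding emb_hom_def by (auto simp: emb_Neg[symmetric]) (metis Neg_in)

lemma emb_hom_sum: "\<lbrakk>X \<in> Ob A; Y \<in> Ob A; \<And>i. i \<in> I \<Longrightarrow> F i \<in> emb_hom X Y\<rbrakk> \<Longrightarrow> (\<Sum>i\<in>I. F i) \<in> emb_hom X Y"
  by (induction I rule: infinite_finite_induct) (simp_all add: emb_hom_zero emb_hom_add)

lemma e_in: "X \<in> Ob A \<Longrightarrow> e X \<in> emb_hom X X"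
  by (simp add: e_def emb_emb_hom Ident_in)

lemma e_left: "F \<in> emb_hom X Y \<Longrightarrow> e Y * F = F"
  unfolding emb_hom_def e_def by (auto simp: emb_Comp[symmetric] Ident_in Ident_Comp)

lemma e_right: "F \<in> emb_hom X Y \<Longrightarrow> F * e X = F"
  unfolding emb_hom_def e_def by (auto simp: emb_Comp[symmetric] Ident_in Comp_Ident)

text \<open>Every morphism from or to \<open>X\<close> absorbs \<open>e X\<close> and so vanishes
  with it. Boundedness of a complex thereby becomes a condition on the operators
  \<open>e\<close>.\<close>

lemma is_zero_object_iff: "is_zero_object A X \<longleftrightarrow> X \<in> Ob A \<and> e X = 0"
proof
  assume *: "is_zero_object A X"
  then have X: "X \<in> Ob A"
    by (simp add: is_zero_object_def)
  then have "Ident A X = Zero A X X"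
    using * Ident_in Zero_in unfolding is_zero_object_def by metis
  then show "X \<in> Ob A \<and> e X = 0"
    using X by (simp add: e_def emb_Zero)
next
  assume *: "X \<in> Ob A \<and> e X = 0"
  have "f = Zero A X T" if "T \<in> Ob A" "f \<in> Hom A X T" for f T
    using e_right[of "emb X T f" X T] * that
    by (intro emb_inject[of X T]) (simp_all add: emb_emb_hom emb_Zero Zero_in)
  moreover have "f = Zero A T X" if "T \<in> Ob A" "f \<in> Hom A T X" for f T
    using e_left[of "emb T X f" T X] * that
    by (intro emb_inject[of T X]) (simp_all add: emb_emb_hom emb_Zero Zero_in)
  ultimately show "is_zero_object A X"
    unfolding is_zero_object_def using * Zero_in by metis
qed

section \<open>Direct sums\<close>

text \<open>The equational form of a biproduct: it trades the two universal properties and their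
  test objects for identities that can be checked by calculation in the ring.\<close>

definition dsum where
  "dsum I X P \<iota> \<pi> \<longleftrightarrow> P \<in> Ob A \<and>
     (\<forall>i\<in>I. X i \<in> Ob A \<and> \<iota> i \<in> emb_hom (X i) P \<and> \<pi> i \<in> emb_hom P (X i)) \<and>
     (\<forall>i\<in>I. \<forall>j\<in>I. \<pi> j * \<iota> i = (if i = j then e (X i) else 0)) \<and> (\<Sum>i\<in>I. \<iota> i * \<pi> i) = e P"

text \<open>The mediating morphism is the sum \<open>h\<close> of the \<open>f i\<close> followed by
  \<open>\<iota> i\<close>. Orthogonality gives its projections; inserting the sum that equals
  \<open>e P\<close> gives uniqueness.\<close>

lemma dsum_imp_product:
  assumes "finite I" and P: "P \<in> Ob A" and X: "\<And>i. i \<in> I \<Longrightarrow> X i \<in> Ob A"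
    and io: "\<And>i. i \<in> I \<Longrightarrow> \<iota> i \<in> Hom A (X i) P" and pr: "\<And>i. i \<in> I \<Longrightarrow> \<pi> i \<in> Hom A P (X i)"
    and ds: "dsum I X P (\<lambda>i. emb (X i) P (\<iota> i)) (\<lambda>i. emb P (X i) (\<pi> i))"
  shows "is_product A I X P \<pi>"
  unfolding is_product_def
proof (intro conjI ballI allI impI P X pr, assumption+)
  fix T f assume T: "T \<in> Ob A" and f: "\<forall>i\<in>I. f i \<in> Hom A T (X i)"
  define h where "h = (\<Sum>i\<in>I. emb (X i) P (\<iota> i) * emb T (X i) (f i))"
  have h: "h \<in> emb_hom T P"
    unfolding h_def by (intro emb_hom_sum T P) (use T X P io f in \<open>auto intro!: emb_hom_mult emb_emb_hom\<close>)
  show "\<exists>!h. h \<in> Hom A T P \<and> (\<forall>i\<in>I. Comp A T P (X i) (\<pi> i) h = f i)"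
  proof (rule ex1I[of _ "unemb T P h"], intro conjI ballI unemb_in h)
    fix j assume j: "j \<in> I"
    have "emb P (X j) (\<pi> j) * h = (\<Sum>i\<in>I. if i = j then emb T (X j) (f j) else 0)"
      unfolding h_def sum_distrib_left
    proof (rule sum.cong[OF refl])
      fix i assume i: "i \<in> I"
      have "emb P (X j) (\<pi> j) * (emb (X i) P (\<iota> i) * emb T (X i) (f i)) =
        (emb P (X j) (\<pi> j) * emb (X i) P (\<iota> i)) * emb T (X i) (f i)"
        by (simp add: mult.assoc)
      also have "\<dots> = (if i = j then emb T (X j) (f j) else 0)"
        using ds i j T X f by (auto simp: dsum_def e_left[OF emb_emb_hom])
      finally show "emb P (X j) (\<pi> j) * (emb (X i) P (\<iota> i) * emb T (X i) (f i)) =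
        (if i = j then emb T (X j) (f j) else 0)" .
    qed
    also have "\<dots> = emb T (X j) (f j)"
      using j \<open>finite I\<close> by simp
    finally show "Comp A T P (X j) (\<pi> j) (unemb T P h) = f j"
      using T P X j f pr h
      by (intro emb_inject[of T "X j"]) (auto intro!: Comp_in unemb_in simp: emb_Comp unemb_in emb_unemb)
  next
    fix k assume k: "k \<in> Hom A T P \<and> (\<forall>i\<in>I. Comp A T P (X i) (\<pi> i) k = f i)"
    have "emb T P k = e P * emb T P k"
      using k T P by (simp add: e_left[OF emb_emb_hom])
    also have "\<dots> = (\<Sum>i\<in>I. emb (X i) P (\<iota> i) * emb P (X i) (\<pi> i) * emb T P k)"
      using ds by (simp add: dsum_def sum_distrib_right[symmetric])
    also have "\<dots> = h"
      unfolding h_def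
    proof (rule sum.cong[OF refl])
      fix i assume i: "i \<in> I"
      show "emb (X i) P (\<iota> i) * emb P (X i) (\<pi> i) * emb T P k = emb (X i) P (\<iota> i) * emb T (X i) (f i)"
        using k T P X[OF i] pr[OF i] i emb_Comp[of T P "X i" k "\<pi> i"] by (simp add: mult.assoc)
    qed
    finally show "k = unemb T P h"
      using k T P unemb_emb by metis
  qed
qed

lemma dsum_imp_coproduct:
  assumes "finite I" and P: "P \<in> Ob A" and X: "\<And>i. i \<in> I \<Longrightarrow> X i \<in> Ob A"
    and io: "\<And>i. i \<in> I \<Longrightarrow> \<iota> i \<in> Hom A (X i) P" and pr: "\<And>i. i \<in> I \<Longrightarrow> \<pi> i \<in> Hom A P (X i)"
    and ds: "dsum I X P (\<lambda>i. emb (X i) P (\<iota> i)) (\<lambda>i. emb P (X i) (\<pi> i))"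
  shows "is_coproduct A I X P \<iota>"
  unfolding is_coproduct_def
proof (intro conjI ballI allI impI P X io, assumption+)
  fix T f assume T: "T \<in> Ob A" and f: "\<forall>i\<in>I. f i \<in> Hom A (X i) T"
  define h where "h = (\<Sum>i\<in>I. emb (X i) T (f i) * emb P (X i) (\<pi> i))"
  have h: "h \<in> emb_hom P T"
    unfolding h_def by (intro emb_hom_sum T P) (use T X P pr f in \<open>auto intro!: emb_hom_mult emb_emb_hom\<close>)
  show "\<exists>!h. h \<in> Hom A P T \<and> (\<forall>i\<in>I. Comp A (X i) P T h (\<iota> i) = f i)"
  proof (rule ex1I[of _ "unemb P T h"], intro conjI ballI unemb_in h)
    fix j assume j: "j \<in> I"
    have "h * emb (X j) P (\<iota> j) = (\<Sum>i\<in>I. if i = j then emb (X j) T (f j) else 0)"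
      unfolding h_def sum_distrib_right
    proof (rule sum.cong[OF refl])
      fix i assume i: "i \<in> I"
      show "emb (X i) T (f i) * emb P (X i) (\<pi> i) * emb (X j) P (\<iota> j) =
        (if i = j then emb (X j) T (f j) else 0)"
        using ds i j T X f by (auto simp: dsum_def e_right[OF emb_emb_hom] mult.assoc)
    qed
    also have "\<dots> = emb (X j) T (f j)"
      using j \<open>finite I\<close> by simp
    finally show "Comp A (X j) P T (unemb P T h) (\<iota> j) = f j"
      using T P X j f io h
      by (intro emb_inject[of "X j" T]) (auto intro!: Comp_in unemb_in simp: emb_Comp unemb_in emb_unemb)
  next
    fix k assume k: "k \<in> Hom A P T \<and> (\<forall>i\<in>I. Comp A (X i) P T k (\<iota> i) = f i)"
    have "emb P T k = emb P T k * e P"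
      using k T P by (simp add: e_right[OF emb_emb_hom])
    also have "\<dots> = (\<Sum>i\<in>I. emb P T k * (emb (X i) P (\<iota> i) * emb P (X i) (\<pi> i)))"
      using ds by (simp add: dsum_def sum_distrib_left[symmetric])
    also have "\<dots> = h"
      unfolding h_def
    proof (rule sum.cong[OF refl])
      fix i assume i: "i \<in> I"
      show "emb P T k * (emb (X i) P (\<iota> i) * emb P (X i) (\<pi> i)) = emb (X i) T (f i) * emb P (X i) (\<pi> i)"
        using k T P X[OF i] io[OF i] i emb_Comp[of "X i" P T "\<iota> i" k] by (simp add: mult.assoc[symmetric])
    qed
    finally show "k = unemb P T h"
      using k T P unemb_emb by metis
  qed
qed

text \<open>Only the completeness relation needs an argument: \<open>s\<close> and the identity have
  the same projections, so uniqueness in the product property identifies them.\<close>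

lemma is_direct_sum_imp_dsum:
  assumes "finite I" and ds: "is_direct_sum A I X P \<iota> \<pi>"
  shows "dsum I X P (\<lambda>i. emb (X i) P (\<iota> i)) (\<lambda>i. emb P (X i) (\<pi> i))"
proof -
  have P: "P \<in> Ob A" and X: "X i \<in> Ob A" and io: "\<iota> i \<in> Hom A (X i) P" and pr: "\<pi> i \<in> Hom A P (X i)"
    if "i \<in> I" for i
    using ds that by (auto simp: is_direct_sum_def is_product_def is_coproduct_def)
  have P: "P \<in> Ob A"
    using ds by (simp add: is_direct_sum_def is_product_def)
  have pi: "emb P (X j) (\<pi> j) * emb (X i) P (\<iota> i) = (if i = j then e (X i) else 0)"
    if "i \<in> I" "j \<in> I" for i j
    using that ds P X io pr emb_Comp[of "X i" P "X j" "\<iota> i" "\<pi> j"]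
    by (auto simp: is_direct_sum_def e_def emb_Zero)
  define s where "s = (\<Sum>i\<in>I. emb (X i) P (\<iota> i) * emb P (X i) (\<pi> i))"
  have s: "s \<in> emb_hom P P"
    unfolding s_def by (intro emb_hom_sum P) (use X P io pr in \<open>auto intro!: emb_hom_mult emb_emb_hom\<close>)
  have "emb P (X j) (\<pi> j) * s = emb P (X j) (\<pi> j)" if j: "j \<in> I" for j
  proof -
    have "emb P (X j) (\<pi> j) * s = (\<Sum>i\<in>I. if i = j then emb P (X j) (\<pi> j) else 0)"
      unfolding s_def sum_distrib_left using pi j P X pr
      by (intro sum.cong[OF refl]) (simp add: mult.assoc[symmetric] e_left[OF emb_emb_hom])
    then show ?thesis
      using j \<open>finite I\<close> by simp
  qed
  then have "Comp A P P (X j) (\<pi> j) (unemb P P s) = \<pi> j" if "j \<in> I" for j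
    using that P X pr s
    by (intro emb_inject[of P "X j"]) (auto intro!: Comp_in unemb_in simp: emb_Comp unemb_in emb_unemb)
  then have "\<forall>j\<in>I. Comp A P P (X j) (\<pi> j) (unemb P P s) = \<pi> j"
    by blast
  moreover have "\<forall>j\<in>I. Comp A P P (X j) (\<pi> j) (Ident A P) = \<pi> j"
    using P X pr by (simp add: Comp_Ident)
  moreover have "\<exists>!h. h \<in> Hom A P P \<and> (\<forall>i\<in>I. Comp A P P (X i) (\<pi> i) h = \<pi> i)"
    using ds P pr unfolding is_direct_sum_def is_product_def by blast
  ultimately have "unemb P P s = Ident A P"
    using unemb_in[OF s] Ident_in[OF P] by blast
  then have "s = e P"
    using emb_unemb[OF s] by (simp add: e_def)
  then show ?thesis
    using P X io pr pi s_def by (auto simp: dsum_def emb_emb_hom)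
qed

lemma is_direct_sum_iff:
  assumes "finite I"
  shows "is_direct_sum A I X P \<iota> \<pi> \<longleftrightarrow>
    (\<forall>i\<in>I. \<iota> i \<in> Hom A (X i) P \<and> \<pi> i \<in> Hom A P (X i)) \<and>
    dsum I X P (\<lambda>i. emb (X i) P (\<iota> i)) (\<lambda>i. emb P (X i) (\<pi> i))"
proof
  assume "is_direct_sum A I X P \<iota> \<pi>"
  then show "(\<forall>i\<in>I. \<iota> i \<in> Hom A (X i) P \<and> \<pi> i \<in> Hom A P (X i)) \<and>
    dsum I X P (\<lambda>i. emb (X i) P (\<iota> i)) (\<lambda>i. emb P (X i) (\<pi> i))"
    using is_direct_sum_imp_dsum[OF assms]
    by (auto simp: is_direct_sum_def is_product_def is_coproduct_def)
next
  assume *: "(\<forall>i\<in>I. \<iota> i \<in> Hom A (X i) P \<and> \<pi> i \<in> Hom A P (X i)) \<and>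
    dsum I X P (\<lambda>i. emb (X i) P (\<iota> i)) (\<lambda>i. emb P (X i) (\<pi> i))"
  then have P: "P \<in> Ob A" and X: "\<And>i. i \<in> I \<Longrightarrow> X i \<in> Ob A"
    by (auto simp: dsum_def)
  have "Comp A (X i) P (X j) (\<pi> j) (\<iota> i) = (if i = j then Ident A (X i) else Zero A (X i) (X j))"
    if "i \<in> I" "j \<in> I" for i j
    using that * P X
    by (intro emb_inject[of "X i" "X j"])
      (auto intro!: Comp_in simp: Ident_in Zero_in emb_Comp dsum_def e_def emb_Zero)
  moreover have "is_product A I X P \<pi>" "is_coproduct A I X P \<iota>"
    using * X by (auto intro!: dsum_imp_product[OF assms P] dsum_imp_coproduct[OF assms P])
  ultimately show "is_direct_sum A I X P \<iota> \<pi>"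
    by (simp add: is_direct_sum_def)
qed

lemma is_direct_sum_unemb:
  assumes "finite I" "dsum I X P \<iota> \<pi>"
  shows "is_direct_sum A I X P (\<lambda>i. unemb (X i) P (\<iota> i)) (\<lambda>i. unemb P (X i) (\<pi> i))"
  unfolding is_direct_sum_iff[OF assms(1)] using assms(2) by (simp add: dsum_def unemb_in emb_unemb)

end

section \<open>Graded morphisms\<close>

text \<open>\<open>graded k F\<close> is the total operator of a family \<open>F n : X\<^sup>n \<rightarrow> Y\<^sup>n\<^sup>+\<^sup>k\<close>; composing such operators needs no
  bookkeeping of degrees.\<close>

definition graded :: "int \<Rightarrow> (int \<Rightarrow> 'a::ab_group_add endo) \<Rightarrow> (int \<Rightarrow> 'a) endo" where
  "graded k F = Abs_endo (\<lambda>v m. Rep_endo (F (m - k)) (v (m - k)))"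

lemma Rep_graded: "Rep_endo (graded k F) v m = Rep_endo (F (m - k)) (v (m - k))"
  unfolding graded_def by (subst Abs_endo_inverse) (simp_all add: fun_eq_iff)

lemma Rep_endo_zero [simp]: "Rep_endo f 0 = 0"
  using Rep_endo_add[of f 0 0] by simp

lemma graded_add: "graded k F + graded k G = graded k (\<lambda>n. F n + G n)"
  by (intro endo_eqI ext) (simp add: Rep_endo_simps Rep_graded)

lemma graded_neg: "- graded k F = graded k (\<lambda>n. - F n)"
  by (intro endo_eqI ext) (simp add: Rep_endo_simps Rep_graded)

lemma graded_zero: "graded k (\<lambda>n. 0) = 0"
  by (intro endo_eqI ext) (simp add: Rep_endo_simps Rep_graded)

lemma graded_mult: "graded j G * graded k F = graded (j + k) (\<lambda>n. G (n + k) * F n)"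
  by (intro endo_eqI ext) (simp add: Rep_endo_simps Rep_graded algebra_simps)

text \<open>A family supported in the single degree \<open>n\<close> isolates the component
  \<open>F n\<close>, whose value is then found in degree \<open>n + k\<close>.\<close>

lemma graded_inject: "graded k F = graded k G \<longleftrightarrow> F = G"
proof
  assume eq: "graded k F = graded k G"
  show "F = G"
  proof (intro ext endo_eqI)
    fix n x
    have "Rep_endo (graded k F) (\<lambda>m. if m = n then x else 0) (n + k) =
      Rep_endo (graded k G) (\<lambda>m. if m = n then x else 0) (n + k)"
      by (simp add: eq)
    then show "Rep_endo (F n) x = Rep_endo (G n) x"
      by (simp add: Rep_graded)
  qed
qed simp

type_synonym ('o, 'm) gmor = "(int \<Rightarrow> ('o, 'm) elt) endo"

context preadd
begin

definition graded_hom :: "int \<Rightarrow> (int \<Rightarrow> 'o) \<Rightarrow> (int \<Rightarrow> 'o) \<Rightarrow> ('o, 'm) gmor set" where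
  "graded_hom k x y = {graded k F | F. \<forall>n. F n \<in> emb_hom (x n) (y (n + k))}"

definition E :: "(int \<Rightarrow> 'o) \<Rightarrow> ('o, 'm) gmor" where
  "E x = graded 0 (\<lambda>n. e (x n))"

lemma graded_homI: "(\<And>n. F n \<in> emb_hom (x n) (y (n + k))) \<Longrightarrow> graded k F \<in> graded_hom k x y"
  by (auto simp: graded_hom_def)

lemma graded_homE:
  assumes "\<Phi> \<in> graded_hom k x y"
  obtains F where "\<Phi> = graded k F" "\<And>n. F n \<in> emb_hom (x n) (y (n + k))"
  using assms by (auto simp: graded_hom_def)

text \<open>The degree \<open>m\<close> is a separate variable so that the rule unifies with any
  numeral and leaves the arithmetic \<open>m = j + k\<close> to the simplifier.\<close>

lemma graded_hom_mult:
  assumes "F \<in> graded_hom j x y" "G \<in> graded_hom k y z" "m = j + k"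
  shows "G * F \<in> graded_hom m x z"
proof -
  obtain f where f: "F = graded j f" "\<And>n. f n \<in> emb_hom (x n) (y (n + j))"
    using assms(1) by (blast elim: graded_homE)
  obtain g where g: "G = graded k g" "\<And>n. g n \<in> emb_hom (y n) (z (n + k))"
    using assms(2) by (blast elim: graded_homE)
  have "g (n + j) * f n \<in> emb_hom (x n) (z (n + (j + k)))" for n
    using emb_hom_mult[OF f(2) g(2)] by (simp add: add.assoc)
  then show ?thesis
    using assms(3) by (simp add: f(1) g(1) graded_mult add.commute[of k] graded_homI)
qed

lemma graded_hom_add: "\<lbrakk>F \<in> graded_hom k x y; G \<in> graded_hom k x y\<rbrakk> \<Longrightarrow> F + G \<in> graded_hom k x y"
  by (elim graded_homE) (simp add: graded_add graded_homI emb_hom_add)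

lemma graded_hom_neg: "F \<in> graded_hom k x y \<Longrightarrow> - F \<in> graded_hom k x y"
  by (elim graded_homE) (simp add: graded_neg graded_homI emb_hom_neg)

lemma graded_hom_diff: "\<lbrakk>F \<in> graded_hom k x y; G \<in> graded_hom k x y\<rbrakk> \<Longrightarrow> F - G \<in> graded_hom k x y"
  using graded_hom_add[of F k x y "- G"] by (simp add: graded_hom_neg)

lemma graded_hom_zero: "\<lbrakk>\<And>n. x n \<in> Ob A; \<And>n. y n \<in> Ob A\<rbrakk> \<Longrightarrow> 0 \<in> graded_hom k x y"
  unfolding graded_zero[of k, symmetric] by (intro graded_homI emb_hom_zero)

lemma E_in: "(\<And>n. x n \<in> Ob A) \<Longrightarrow> E x \<in> graded_hom 0 x x"
  unfolding E_def by (intro graded_homI) (simp add: e_in)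

lemma E_left: "F \<in> graded_hom k x y \<Longrightarrow> E y * F = F"
  unfolding E_def by (elim graded_homE) (auto simp: graded_mult graded_inject fun_eq_iff intro: e_left)

lemma E_right: "F \<in> graded_hom k x y \<Longrightarrow> F * E x = F"
  unfolding E_def by (elim graded_homE) (auto simp: graded_mult graded_inject fun_eq_iff intro: e_right)

section \<open>Complexes, chain maps and homotopies as operators\<close>

definition D :: "('o, 'm) cpx \<Rightarrow> ('o, 'm) gmor" where
  "D X = graded 1 (\<lambda>n. emb (obj X n) (obj X (n+1)) (diff X n))"

definition bounded :: "(int \<Rightarrow> 'o) \<Rightarrow> bool" where
  "bounded x \<longleftrightarrow> (\<exists>N. \<forall>n. \<bar>n\<bar> > N \<longrightarrow> e (x n) = 0)"

abbreviation bc :: "('o, 'm) cpx set" where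
  "bc \<equiv> bounded_complexes A"

lemma bc_iff: "X \<in> bc \<longleftrightarrow>
    (\<forall>n. obj X n \<in> Ob A \<and> diff X n \<in> Hom A (obj X n) (obj X (n+1))) \<and> D X * D X = 0 \<and> bounded (obj X)"
proof -
  have "(\<forall>n. Comp A (obj X n) (obj X (n+1)) (obj X (n+2)) (diff X (n+1)) (diff X n)
      = Zero A (obj X n) (obj X (n+2))) \<longleftrightarrow> D X * D X = 0"
    if *: "\<forall>n. obj X n \<in> Ob A \<and> diff X n \<in> Hom A (obj X n) (obj X (n+1))"
  proof -
    have d: "diff X (n+1) \<in> Hom A (obj X (n+1)) (obj X (n+2))" for n
      using *[rule_format, of "n+1"] by (simp add: add.commute)
    have "Comp A (obj X n) (obj X (n+1)) (obj X (n+2)) (diff X (n+1)) (diff X n)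
      = Zero A (obj X n) (obj X (n+2)) \<longleftrightarrow>
      emb (obj X (n+1)) (obj X (n+2)) (diff X (n+1)) * emb (obj X n) (obj X (n+1)) (diff X n) = 0" for n
      using * d by (metis emb_Comp emb_Zero emb_inject Comp_in Zero_in)
    then show ?thesis
      unfolding D_def graded_mult graded_zero[of 2, symmetric] by (simp add: graded_inject fun_eq_iff add.commute)
  qed
  then show ?thesis
    unfolding bounded_complexes_def bounded_def by (auto simp: is_zero_object_iff)
qed

lemma bc_Ob: "X \<in> bc \<Longrightarrow> obj X n \<in> Ob A"
  by (simp add: bc_iff)

lemma D_in: "X \<in> bc \<Longrightarrow> D X \<in> graded_hom 1 (obj X) (obj X)"
  unfolding D_def graded_hom_def by (auto simp: bc_iff emb_emb_hom intro!: exI)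

lemma D_D: "X \<in> bc \<Longrightarrow> D X * D X = 0"
  by (simp add: bc_iff)

lemma ex_complex:
  assumes "d \<in> graded_hom 1 x x" "d * d = 0" "bounded x"
  obtains X where "X \<in> bc" "obj X = x" "D X = d"
proof -
  obtain f where f: "d = graded 1 f" "\<And>n. f n \<in> emb_hom (x n) (x (n+1))"
    using assms(1) by (auto simp: graded_hom_def)
  define X where "X = \<lparr>obj = x, diff = (\<lambda>n. unemb (x n) (x (n+1)) (f n))\<rparr>"
  have "D X = d"
    using f by (simp add: D_def X_def emb_unemb)
  then show thesis
    using assms f emb_hom_Ob[OF f(2)] by (intro that[of X]) (auto simp: bc_iff X_def unemb_in)
qed

definition chain_map :: "('o, 'm) cpx \<Rightarrow> ('o, 'm) cpx \<Rightarrow> ('o, 'm) gmor \<Rightarrow> bool" where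
  "chain_map X Y F \<longleftrightarrow> X \<in> bc \<and> Y \<in> bc \<and> F \<in> graded_hom 0 (obj X) (obj Y) \<and> D Y * F = F * D X"

definition homotopic :: "('o, 'm) cpx \<Rightarrow> ('o, 'm) cpx \<Rightarrow> ('o, 'm) gmor \<Rightarrow> ('o, 'm) gmor \<Rightarrow> bool" where
  "homotopic X Y F G \<longleftrightarrow> (\<exists>h \<in> graded_hom (-1) (obj X) (obj Y). G = F + D Y * h + h * D X)"

lemma chain_map_bc: "chain_map X Y F \<Longrightarrow> X \<in> bc" "chain_map X Y F \<Longrightarrow> Y \<in> bc"
  by (simp_all add: chain_map_def)

lemma chain_map_graded_hom: "chain_map X Y F \<Longrightarrow> F \<in> graded_hom 0 (obj X) (obj Y)"
  by (simp add: chain_map_def)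

lemma chain_map_comm: "chain_map X Y F \<Longrightarrow> D Y * F = F * D X"
  by (simp add: chain_map_def)

text \<open>With products associated to the right, a relation for \<open>a * b\<close> must also
  fire inside \<open>a * (b * x)\<close>. A list of relations together with its image under this
  rule is the rewrite system behind the calculations below.\<close>

lemma mult_eq: "a * b = c \<Longrightarrow> a * (b * x) = c * (x :: 'a::semigroup_mult)"
  by (simp flip: mult.assoc)

lemma chain_map_E: "X \<in> bc \<Longrightarrow> chain_map X X (E (obj X))"
  by (simp add: chain_map_def E_in bc_Ob E_left[OF D_in] E_right[OF D_in])

lemma chain_map_mult:
  assumes "chain_map X Y F" "chain_map Y Z G"
  shows "chain_map X Z (G * F)"
proof -
  have "D Z * (G * F) = G * F * D X"
    by (simp add: mult_eq[OF chain_map_comm[OF assms(2)]] chain_map_comm[OF assms(1)] mult.assoc)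
  then show ?thesis
    using assms by (auto simp: chain_map_def intro: graded_hom_mult)
qed

lemma chain_map_diff: "\<lbrakk>chain_map X Y F; chain_map X Y G\<rbrakk> \<Longrightarrow> chain_map X Y (F - G)"
  unfolding chain_map_def by (auto intro: graded_hom_diff simp: algebra_simps)

lemma homotopic_refl: "chain_map X Y F \<Longrightarrow> homotopic X Y F F"
  unfolding homotopic_def by (rule bexI[of _ 0]) (auto simp: graded_hom_zero chain_map_def bc_Ob)

lemma homotopic_sym: "homotopic X Y F G \<Longrightarrow> homotopic X Y G F"
proof -
  assume "homotopic X Y F G"
  then obtain h where "h \<in> graded_hom (-1) (obj X) (obj Y)" "G = F + D Y * h + h * D X"
    by (auto simp: homotopic_def)
  then show ?thesis
    unfolding homotopic_def by (intro bexI[of _ "- h"]) (auto simp: graded_hom_neg algebra_simps)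
qed

lemma homotopic_trans: "\<lbrakk>homotopic X Y F G; homotopic X Y G H\<rbrakk> \<Longrightarrow> homotopic X Y F H"
proof -
  assume "homotopic X Y F G" "homotopic X Y G H"
  then obtain h k where "h \<in> graded_hom (-1) (obj X) (obj Y)" "G = F + D Y * h + h * D X"
    "k \<in> graded_hom (-1) (obj X) (obj Y)" "H = G + D Y * k + k * D X"
    by (auto simp: homotopic_def)
  then show ?thesis
    unfolding homotopic_def by (intro bexI[of _ "h + k"]) (auto simp: graded_hom_add algebra_simps)
qed

lemma homotopic_mult_left:
  assumes "homotopic X Y F F'" "chain_map Y Z G"
  shows "homotopic X Z (G * F) (G * F')"
proof -
  obtain h where h: "h \<in> graded_hom (-1) (obj X) (obj Y)" "F' = F + D Y * h + h * D X"
    using assms(1) by (auto simp: homotopic_def)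
  have "G * h \<in> graded_hom (-1) (obj X) (obj Z)"
    using graded_hom_mult[OF h(1) chain_map_graded_hom[OF assms(2)]] by simp
  moreover have "G * F' = G * F + D Z * (G * h) + G * h * D X"
    using chain_map_comm[OF assms(2)] by (simp add: h(2) algebra_simps flip: mult.assoc)
  ultimately show ?thesis
    by (auto simp: homotopic_def)
qed

lemma homotopic_mult_right:
  assumes "homotopic Y Z G G'" "chain_map X Y F"
  shows "homotopic X Z (G * F) (G' * F)"
proof -
  obtain h where h: "h \<in> graded_hom (-1) (obj Y) (obj Z)" "G' = G + D Z * h + h * D Y"
    using assms(1) by (auto simp: homotopic_def)
  have "h * F \<in> graded_hom (-1) (obj X) (obj Z)"
    using graded_hom_mult[OF chain_map_graded_hom[OF assms(2)] h(1)] by simp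
  moreover have "G' * F = G * F + D Z * (h * F) + h * F * D X"
    using chain_map_comm[OF assms(2)] by (simp add: h(2) algebra_simps)
  ultimately show ?thesis
    by (auto simp: homotopic_def)
qed

text \<open>The added term \<open>D Y * h + h * D X\<close> commutes with the differentials because
  both of them square to zero.\<close>

lemma homotopic_chain_map:
  assumes "chain_map X Y F" "homotopic X Y F G"
  shows "chain_map X Y G"
proof -
  obtain h where h: "h \<in> graded_hom (-1) (obj X) (obj Y)" "G = F + D Y * h + h * D X"
    using assms(2) by (auto simp: homotopic_def)
  have X: "X \<in> bc" and Y: "Y \<in> bc"
    using assms(1) by (auto simp: chain_map_def)
  have "G \<in> graded_hom 0 (obj X) (obj Y)"
    unfolding h(2)
    by (intro graded_hom_add chain_map_graded_hom[OF assms(1)] graded_hom_mult[OF h(1) D_in[OF Y]] graded_hom_mult[OF D_in[OF X] h(1)]) simp_all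
  then show ?thesis
    using assms(1) X Y
    by (simp add: chain_map_def h(2) algebra_simps D_D mult_eq[OF D_D[OF Y]])
qed

definition hinv where
  "hinv X Y F G \<longleftrightarrow> chain_map X Y F \<and> chain_map Y X G \<and> homotopic X X (G * F) (E (obj X)) \<and> homotopic Y Y (F * G) (E (obj Y))"

definition heqv :: "('o, 'm) cpx \<Rightarrow> ('o, 'm) cpx \<Rightarrow> bool" where
  "heqv X Y \<longleftrightarrow> (\<exists>F G. hinv X Y F G)"

lemma hinv_E: "X \<in> bc \<Longrightarrow> hinv X X (E (obj X)) (E (obj X))"
  by (simp add: hinv_def chain_map_E E_left[OF E_in[OF bc_Ob]] homotopic_refl)

lemma heqv_refl: "X \<in> bc \<Longrightarrow> heqv X X"
  unfolding heqv_def using hinv_E by blast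

lemma hinv_sym: "hinv X Y F G \<Longrightarrow> hinv Y X G F"
  unfolding hinv_def by blast

lemma heqv_sym: "heqv X Y \<Longrightarrow> heqv Y X"
  unfolding heqv_def using hinv_sym by blast

lemma heqv_bc: "heqv X Y \<Longrightarrow> X \<in> bc" "heqv X Y \<Longrightarrow> Y \<in> bc"
  by (auto simp: heqv_def hinv_def chain_map_def)

lemma homotopic_cancel:
  assumes "homotopic Y Y (G * F) (E (obj Y))" "chain_map X Y F'" "chain_map Y Z F" "chain_map Z Y G" "chain_map Y W G'"
  shows "homotopic X W ((G' * G) * (F * F')) (G' * F')"
proof -
  have "homotopic X W (G' * ((G * F) * F')) (G' * (E (obj Y) * F'))"
    using assms by (intro homotopic_mult_left homotopic_mult_right)
  then show ?thesis
    using E_left[OF chain_map_graded_hom[OF assms(2)]] by (simp add: mult.assoc)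
qed

lemma heqv_trans:
  assumes "heqv X Y" "heqv Y Z"
  shows "heqv X Z"
proof -
  obtain F G F' G' where "hinv X Y F G" "hinv Y Z F' G'"
    using assms by (auto simp: heqv_def)
  then have "hinv X Z (F' * F) (G * G')"
    unfolding hinv_def
    by (blast intro: chain_map_mult homotopic_trans[OF homotopic_cancel])
  then show ?thesis
    by (auto simp: heqv_def)
qed

text \<open>The right inverse \<open>P\<close> and the left inverse \<open>Q\<close> agree up to
  homotopy, since both are homotopic to \<open>Q * F * P\<close>.\<close>

lemma one_sided_inverses:
  assumes "chain_map X Y F" "chain_map Y X P" "homotopic Y Y (F * P) (E (obj Y))"
    and "chain_map Y X Q" "homotopic X X (Q * F) (E (obj X))"
  shows "heqv X Y"
proof -
  have "homotopic Y X ((Q * F) * P) (E (obj X) * P)"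
    using assms by (intro homotopic_mult_right)
  moreover have "homotopic Y X (Q * (F * P)) (Q * E (obj Y))"
    using assms by (intro homotopic_mult_left)
  ultimately have "homotopic Y X P Q"
    using E_left[OF chain_map_graded_hom[OF assms(2)]] E_right[OF chain_map_graded_hom[OF assms(4)]] homotopic_sym homotopic_trans
    by (metis mult.assoc)
  then have "homotopic X X (P * F) (E (obj X))"
    using homotopic_mult_right assms homotopic_trans by blast
  then show ?thesis
    using assms by (auto simp: heqv_def hinv_def)
qed

end

section \<open>Degreewise split extensions and mapping cones\<close>

text \<open>A degreewise split extension \<open>0 \<rightarrow> X \<rightarrow> Y \<rightarrow> Z \<rightarrow> 0\<close> with inclusion \<open>i\<close>, projection \<open>p\<close>,
  degreewise splittings \<open>r\<close>, \<open>t\<close> and connecting morphism \<open>w\<close> of degree 1.\<close>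

locale split_ext = preadd A for A :: "('o, 'm) precat" +
  fixes X Z Y :: "('o, 'm) cpx" and i t r p w :: "('o, 'm) gmor"
  assumes X: "X \<in> bc" and Z: "Z \<in> bc" and Y: "Y \<in> bc"
    and i: "i \<in> graded_hom 0 (obj X) (obj Y)" and t: "t \<in> graded_hom 0 (obj Z) (obj Y)"
    and r: "r \<in> graded_hom 0 (obj Y) (obj X)" and p: "p \<in> graded_hom 0 (obj Y) (obj Z)"
    and w: "w \<in> graded_hom 1 (obj Z) (obj X)"
    and ri: "r * i = E (obj X)" and pt: "p * t = E (obj Z)" and rt: "r * t = 0" and pi: "p * i = 0"
    and irtp: "i * r + t * p = E (obj Y)"
    and Di: "D Y * i = i * D X" and Dt: "D Y * t = i * w + t * D Z"
begin

lemmas units =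
  E_left[OF i] E_left[OF t] E_left[OF r] E_left[OF p] E_left[OF w]
  E_left[OF D_in[OF X]] E_left[OF D_in[OF Y]] E_left[OF D_in[OF Z]]
  E_right[OF i] E_right[OF t] E_right[OF r] E_right[OF p] E_right[OF w]
  E_right[OF D_in[OF X]] E_right[OF D_in[OF Y]] E_right[OF D_in[OF Z]]

lemmas base = units ri pt rt pi Di Dt D_D[OF X] D_D[OF Y] D_D[OF Z]

text \<open>The pattern for all relations on projections: insert \<open>i * r + t * p\<close> for
  the identity of \<open>Y\<close>, then use the relations for \<open>i\<close> and
  \<open>t\<close>.\<close>

lemma pD: "p * D Y = D Z * p"
proof -
  have "p * D Y = p * D Y * (i * r + t * p)"
    by (simp add: irtp units mult.assoc)
  also have "\<dots> = D Z * p"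
    by (simp add: base base[THEN mult_eq] algebra_simps)
  finally show ?thesis .
qed

lemma rD: "r * D Y = D X * r + w * p"
proof -
  have "r * D Y = r * D Y * (i * r + t * p)"
    by (simp add: irtp units mult.assoc)
  also have "\<dots> = D X * r + w * p"
    by (simp add: base base[THEN mult_eq] algebra_simps)
  finally show ?thesis .
qed

text \<open>This is the \<open>X\<close>-component, extracted by \<open>r\<close>, of
  \<open>D Y * (D Y * t) = 0\<close>.\<close>

lemma wD: "w * D Z = - (D X * w)"
proof -
  have "r * (D Y * (D Y * t)) = D X * w + w * D Z"
    by (simp only: Dt) (simp add: base base[THEN mult_eq] algebra_simps)
  then have "D X * w + w * D Z = 0"
    by (simp add: D_D[OF Y, THEN mult_eq])
  then show ?thesis
    by (simp add: add_eq_0_iff)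
qed

text \<open>Oriented so that \<open>D Y\<close> is eliminated next to \<open>i\<close>,
  \<open>t\<close>, \<open>r\<close> and \<open>p\<close>, and differentials move to the left of
  \<open>w\<close>.\<close>

lemmas rels = base pD rD wD
lemmas rels' = rels[THEN mult_eq]

lemma i_chain_map: "chain_map X Y i"
  by (simp add: chain_map_def X Y i Di)

end

text \<open>Here \<open>a\<close> and \<open>a'\<close> identify \<open>X[1]\<close> with a degreewise summand of the cone \<open>K\<close> of \<open>f\<close>;
  regarded as morphisms between \<open>X\<close> and \<open>K\<close> they have degrees \<open>-1\<close> and \<open>1\<close>.\<close>

locale cone_ext = preadd A for A :: "('o, 'm) precat" +
  fixes X Y K :: "('o, 'm) cpx" and f a b a' b' :: "('o, 'm) gmor"
  assumes X: "X \<in> bc" and Y: "Y \<in> bc" and K: "K \<in> bc"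
    and a: "a \<in> graded_hom (-1) (obj X) (obj K)" and b: "b \<in> graded_hom 0 (obj Y) (obj K)"
    and a': "a' \<in> graded_hom 1 (obj K) (obj X)" and b': "b' \<in> graded_hom 0 (obj K) (obj Y)"
    and f: "f \<in> graded_hom 0 (obj X) (obj Y)"
    and a'a: "a' * a = E (obj X)" and b'b: "b' * b = E (obj Y)" and a'b: "a' * b = 0" and b'a: "b' * a = 0"
    and aabb: "a * a' + b * b' = E (obj K)"
    and Db: "D K * b = b * D Y" and Da: "D K * a = b * f - a * D X"
begin

lemmas units =
  E_left[OF a] E_left[OF b] E_left[OF a'] E_left[OF b'] E_left[OF f]
  E_left[OF D_in[OF X]] E_left[OF D_in[OF Y]] E_left[OF D_in[OF K]]
  E_right[OF a] E_right[OF b] E_right[OF a'] E_right[OF b'] E_right[OF f]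
  E_right[OF D_in[OF X]] E_right[OF D_in[OF Y]] E_right[OF D_in[OF K]]

lemmas base = units a'a b'b a'b b'a Db Da D_D[OF X] D_D[OF Y] D_D[OF K]

lemma a'D: "a' * D K = - (D X * a')"
proof -
  have "a' * D K = a' * D K * (a * a' + b * b')"
    by (simp add: aabb units mult.assoc)
  also have "\<dots> = - (D X * a')"
    by (simp add: base base[THEN mult_eq] algebra_simps)
  finally show ?thesis .
qed

lemma b'D: "b' * D K = f * a' + D Y * b'"
proof -
  have "b' * D K = b' * D K * (a * a' + b * b')"
    by (simp add: aabb units mult.assoc)
  also have "\<dots> = f * a' + D Y * b'"
    by (simp add: base base[THEN mult_eq] algebra_simps)
  finally show ?thesis .
qed

text \<open>The chain map property of \<open>f\<close> is contained in that of \<open>K\<close>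
  being a complex: it is the \<open>Y\<close>-component of
  \<open>D K * (D K * a) = 0\<close>.\<close>

lemma Df: "D Y * f = f * D X"
proof -
  have "b' * (D K * (D K * a)) = D Y * f - f * D X"
    by (simp only: Da) (simp add: base base[THEN mult_eq] algebra_simps)
  then show ?thesis
    by (simp add: D_D[OF K, THEN mult_eq])
qed

lemmas rels = base a'D b'D Df
lemmas rels' = rels[THEN mult_eq]

lemma b_chain_map: "chain_map Y K b"
  by (simp add: chain_map_def K Y b Db)

end

section \<open>Rotation and homotopy invariance of split extensions\<close>

context preadd
begin

text \<open>First half of the rotation: in the cone of \<open>i\<close> the summand X[1] cancels
  against the copy of \<open>X\<close> inside \<open>Y\<close>, and \<open>Z\<close> is left. Hence
  every split extension is the middle term of a triangle.\<close>

lemma hinv_cone_of_inclusion: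
  assumes "split_ext A X Z Y i t r p w" "cone_ext A X Y L i a b a' b'"
  shows "hinv L Z (p * b') (b * t - a * w)"
proof -
  interpret S: split_ext A X Z Y i t r p w by fact
  interpret C: cone_ext A X Y L i a b a' b' by fact
  note rels = S.rels S.rels' C.rels C.rels'
  \<comment> \<open>The splitting \<open>t\<close> fails to be a chain map by \<open>i * w\<close>.
    In the cone this error equals the one produced by \<open>a * w\<close>, so the difference is a
    chain map.\<close>
  let ?c = "b * t - a * w"
  have q: "p * b' \<in> graded_hom 0 (obj L) (obj Z)"
    using C.b' S.p by (rule graded_hom_mult) simp
  have c: "?c \<in> graded_hom 0 (obj Z) (obj L)"
    by (intro graded_hom_diff graded_hom_mult[OF S.t C.b] graded_hom_mult[OF S.w C.a]) simp_all
  have "chain_map L Z (p * b')"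
    by (simp add: chain_map_def S.Z C.K q algebra_simps rels)
  moreover have "chain_map Z L ?c"
    by (simp add: chain_map_def S.Z C.K c algebra_simps rels)
  moreover have "p * b' * ?c = E (obj Z)"
    by (simp add: algebra_simps rels)
  \<comment> \<open>The contracting homotopy sends the \<open>X\<close>-part of \<open>Y\<close> to
    the summand X[1] and kills the rest.\<close>
  moreover have h: "a * r * b' \<in> graded_hom (-1) (obj L) (obj L)"
    by (rule graded_hom_mult[OF C.b' graded_hom_mult[OF S.r C.a]]) simp_all
  have "E (obj L) = ?c * (p * b') + D L * (a * r * b') + a * r * b' * D L"
  proof -
    have "b * (i * r + t * p) * b' = b * b'"
      by (simp add: S.irtp C.units mult.assoc)
    then have *: "b * (i * (r * b')) + b * (t * (p * b')) = b * b'"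
      by (simp add: algebra_simps)
    show ?thesis
      by (simp add: algebra_simps rels * flip: C.aabb)
  qed
  ultimately show ?thesis
    using h homotopic_refl[OF chain_map_E[OF S.Z]] unfolding hinv_def homotopic_def[of L L] by auto
qed

text \<open>Second half of the rotation: \<open>a'\<close>, the projection of the cone to X[1], is
  used as connecting morphism, and the resulting extension of \<open>K\<close> by \<open>X\<close>
  recovers \<open>Y\<close> because X[1] in \<open>K\<close> cancels against
  \<open>X\<close>.\<close>

lemma heqv_cocone:
  assumes "cone_ext A X Y K f a b a' b'" "split_ext A X K W i t r p a'"
  shows "heqv Y W"
proof -
  interpret C: cone_ext A X Y K f a b a' b' by fact
  interpret S: split_ext A X K W i t r p a' by fact
  note rels = S.rels S.rels' C.rels C.rels'
  \<comment> \<open>Passing \<open>b'\<close> through \<open>D K\<close> leaves the error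
    \<open>f * a' * p\<close>; passing \<open>r\<close> through \<open>D W\<close> leaves
    \<open>a' * p\<close>, so subtracting \<open>f * r\<close> cancels it.\<close>
  let ?g = "b' * p - f * r"
  have f: "t * b \<in> graded_hom 0 (obj Y) (obj W)"
    using C.b S.t by (rule graded_hom_mult) simp
  have g: "?g \<in> graded_hom 0 (obj W) (obj Y)"
    by (intro graded_hom_diff graded_hom_mult[OF S.p C.b'] graded_hom_mult[OF S.r C.f]) simp_all
  have "chain_map Y W (t * b)"
    by (simp add: chain_map_def S.Y C.Y f algebra_simps rels)
  moreover have "chain_map W Y ?g"
    by (simp add: chain_map_def S.Y C.Y g algebra_simps rels)
  moreover have "?g * (t * b) = E (obj Y)"
    by (simp add: algebra_simps rels)
  \<comment> \<open>The homotopy identifies the summand \<open>X\<close> of \<open>W\<close> with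
    the summand X[1] of \<open>K\<close> inside \<open>W\<close>.\<close>
  moreover have h: "t * a * r \<in> graded_hom (-1) (obj W) (obj W)"
    by (rule graded_hom_mult[OF S.r graded_hom_mult[OF C.a S.t]]) simp_all
  have "E (obj W) = t * b * ?g + D W * (t * a * r) + t * a * r * D W"
  proof -
    have "t * (a * a' + b * b') * p = t * p"
      by (simp add: C.aabb S.units mult.assoc)
    then have *: "t * (a * (a' * p)) + t * (b * (b' * p)) = t * p"
      by (simp add: algebra_simps)
    show ?thesis
      by (simp add: algebra_simps rels * flip: S.irtp)
  qed
  ultimately have "hinv Y W (t * b) ?g"
    using h homotopic_refl[OF chain_map_E[OF C.Y]] unfolding hinv_def homotopic_def[of W W] by auto
  then show ?thesis
    by (auto simp: heqv_def)
qed

text \<open>A triangular map whose diagonal blocks are homotopic to identities is homotopic to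
  \<open>E + N\<close> with \<open>N\<close> strictly triangular, hence of square zero because
  \<open>p * i = 0\<close>.\<close>

lemma unipotent_invertible:
  assumes "split_ext A X Z Y i t r p w" "chain_map Y Y F" "F = i * a * r + t * c * p + i * u * p"
    and "homotopic X X a (E (obj X))" "homotopic Z Z c (E (obj Z))" "u \<in> graded_hom 0 (obj Z) (obj X)"
  obtains P where "chain_map Y Y P" "homotopic Y Y (F * P) (E (obj Y))" "homotopic Y Y (P * F) (E (obj Y))"
proof -
  interpret S: split_ext A X Z Y i t r p w by fact
  obtain k where k: "k \<in> graded_hom (-1) (obj X) (obj X)" "E (obj X) = a + D X * k + k * D X"
    using assms by (auto simp: homotopic_def)
  obtain l where l: "l \<in> graded_hom (-1) (obj Z) (obj Z)" "E (obj Z) = c + D Z * l + l * D Z"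
    using assms by (auto simp: homotopic_def)
  \<comment> \<open>The block diagonal sum of the two given homotopies. It is a homotopy for
    \<open>Y\<close> only up to the terms in which it meets \<open>w\<close>; these are collected in
    \<open>N\<close>.\<close>
  define s where "s = i * k * r + t * l * p"
  have s: "s \<in> graded_hom (-1) (obj Y) (obj Y)"
    unfolding s_def
    by (intro graded_hom_add graded_hom_mult[OF S.r graded_hom_mult[OF k(1) S.i]] graded_hom_mult[OF S.p graded_hom_mult[OF l(1) S.t]]) simp_all
  \<comment> \<open>\<open>w * l\<close> arises from \<open>D Y * t\<close> and \<open>k * w\<close>
    from \<open>r * D Y\<close>; \<open>u\<close> is the off-diagonal block of \<open>F\<close>
    itself.\<close>
  define N where "N = i * (u + w * l + k * w) * p"
  have "E (obj X) * r = (a + D X * k + k * D X) * r" "E (obj Z) * p = (c + D Z * l + l * D Z) * p"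
    using k l by simp_all
  then have "r = (a + D X * k + k * D X) * r" "p = (c + D Z * l + l * D Z) * p"
    by (simp_all only: S.units)
  then have "E (obj Y) = i * ((a + D X * k + k * D X) * r) + t * ((c + D Z * l + l * D Z) * p)"
    using S.irtp by simp
  then have E: "E (obj Y) + N = F + D Y * s + s * D Y"
    by (simp add: assms(3) s_def N_def algebra_simps S.rels S.rels')
  then have FN: "homotopic Y Y F (E (obj Y) + N)"
    using s by (auto simp: homotopic_def)
  \<comment> \<open>That \<open>N\<close> commutes with the differential is inherited from
    \<open>F\<close> through the homotopy, not computed.\<close>
  then have "chain_map Y Y (E (obj Y) + N)"
    using homotopic_chain_map assms(2) by blast
  then have N: "chain_map Y Y N"
    using chain_map_diff[of Y Y "E (obj Y) + N" "E (obj Y)"] chain_map_E[OF S.Y] by simp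
  have NN: "N * N = 0"
    by (simp add: N_def algebra_simps S.rels')
  define P where "P = E (obj Y) - N"
  have P: "chain_map Y Y P"
    unfolding P_def using N chain_map_E[OF S.Y] by (rule chain_map_diff[rotated])
  have EE: "E (obj Y) * E (obj Y) = E (obj Y)"
    using E_left[OF chain_map_graded_hom[OF chain_map_E[OF S.Y]]] .
  have "(E (obj Y) + N) * P = E (obj Y)" "P * (E (obj Y) + N) = E (obj Y)"
    using NN EE E_left[OF chain_map_graded_hom[OF N]] E_right[OF chain_map_graded_hom[OF N]]
    by (simp_all add: P_def algebra_simps)
  then show thesis
    using that[OF P] homotopic_mult_right[OF FN P] homotopic_mult_left[OF FN P] by simp
qed

text \<open>The last assumption says that \<open>a\<close> and \<open>c\<close> intertwine
  \<open>w\<close> and \<open>w'\<close> up to the homotopy \<open>h\<close>, which becomes the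
  off-diagonal block of the map between the extensions.\<close>

lemma split_ext_map:
  assumes "split_ext A X Z Y i t r p w" "split_ext A X' Z' Y' i' t' r' p' w'"
    and "chain_map X X' a" "chain_map Z Z' c" "h \<in> graded_hom 0 (obj Z) (obj X')" "a * w + h * D Z = w' * c + D X' * h"
  shows "chain_map Y Y' (i' * a * r + t' * c * p + i' * h * p)"
proof -
  interpret S: split_ext A X Z Y i t r p w by fact
  interpret S': split_ext A X' Z' Y' i' t' r' p' w' by fact
  have "i' * a * r + t' * c * p + i' * h * p \<in> graded_hom 0 (obj Y) (obj Y')"
    using graded_hom_mult[OF S.r graded_hom_mult[OF chain_map_graded_hom[OF assms(3)] S'.i]]
      graded_hom_mult[OF S.p graded_hom_mult[OF chain_map_graded_hom[OF assms(4)] S'.t]] graded_hom_mult[OF S.p graded_hom_mult[OF assms(5) S'.i]]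
    by (intro graded_hom_add) simp_all
  moreover have "i' * (a * w + h * D Z) * p = i' * (w' * c + D X' * h) * p"
    by (simp only: assms(6))
  then have "i' * (a * (w * p)) + i' * (h * (D Z * p)) = i' * (w' * (c * p)) + i' * (D X' * (h * p))"
    by (simp add: algebra_simps)
  ultimately show ?thesis
    using chain_map_comm[OF assms(3), THEN mult_eq] chain_map_comm[OF assms(4), THEN mult_eq]
    by (simp add: chain_map_def S.Y S'.Y algebra_simps S.rels S'.rels S'.rels')
qed

text \<open>Homotopies for \<open>\<gamma>\<close> and \<open>\<alpha>\<close> yield the off-diagonal entries of comparison maps in both directions,
  and both composites of these maps are unipotent up to homotopy.\<close>

lemma heqv_split_ext:
  assumes "split_ext A X Z Y i t r p w" "split_ext A X' Z' Y' i' t' r' p' w'"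
    and "hinv X X' \<alpha> \<alpha>'" "hinv Z Z' \<gamma> \<gamma>'" "w' = \<alpha> * w * \<gamma>'"
  shows "heqv Y Y'"
proof -
  interpret S: split_ext A X Z Y i t r p w by fact
  interpret S': split_ext A X' Z' Y' i' t' r' p' w' by fact
  have al: "chain_map X X' \<alpha>" "chain_map X' X \<alpha>'" and ga: "chain_map Z Z' \<gamma>" "chain_map Z' Z \<gamma>'"
    using assms by (auto simp: hinv_def)
  note graded_hom = al[THEN chain_map_graded_hom] ga[THEN chain_map_graded_hom]
  obtain k where k: "k \<in> graded_hom (-1) (obj X) (obj X)" "E (obj X) = \<alpha>' * \<alpha> + D X * k + k * D X"
    using assms by (auto simp: hinv_def homotopic_def)
  obtain l where l: "l \<in> graded_hom (-1) (obj Z) (obj Z)" "E (obj Z) = \<gamma>' * \<gamma> + D Z * l + l * D Z"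
    using assms by (auto simp: hinv_def homotopic_def)
  \<comment> \<open>By the choice of \<open>w'\<close>, the difference of
    \<open>\<alpha> * w\<close> and \<open>w' * \<gamma>\<close> is \<open>\<alpha> * w\<close>
    times \<open>D Z * l + l * D Z\<close>; the sign appears because \<open>w\<close> anticommutes
    with the differentials. The case of \<open>h'\<close> is symmetric, with
    \<open>k\<close>.\<close>
  define h where "h = - (\<alpha> * w * l)"
  define h' where "h' = - (k * w * \<gamma>')"
  have h: "h \<in> graded_hom 0 (obj Z) (obj X')"
    unfolding h_def by (intro graded_hom_neg graded_hom_mult[OF l(1) graded_hom_mult[OF S.w graded_hom(1)]]) simp_all
  have h': "h' \<in> graded_hom 0 (obj Z') (obj X)"
    unfolding h'_def by (intro graded_hom_neg graded_hom_mult[OF graded_hom(4) graded_hom_mult[OF S.w k(1)]]) simp_all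
  note comm = al[THEN chain_map_comm] ga[THEN chain_map_comm]
  note comm' = comm[THEN mult_eq]
  have "\<alpha> * w * E (obj Z) = \<alpha> * w * (\<gamma>' * \<gamma> + D Z * l + l * D Z)"
    by (simp only: l(2))
  then have "\<alpha> * w + h * D Z = w' * \<gamma> + D X' * h"
    by (simp add: assms(5) h_def algebra_simps comm comm' S.rels S.rels')
  from split_ext_map[OF assms(1,2) al(1) ga(1) h this]
  have F: "chain_map Y Y' (i' * \<alpha> * r + t' * \<gamma> * p + i' * h * p)" (is "chain_map Y Y' ?F") .
  have "E (obj X) * w * \<gamma>' = (\<alpha>' * \<alpha> + D X * k + k * D X) * w * \<gamma>'"
    by (simp only: k(2))
  then have "\<alpha>' * w' + h' * D Z' = w * \<gamma>' + D X * h'"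
    by (simp add: assms(5) h'_def algebra_simps comm[symmetric] S.rels S.rels')
  from split_ext_map[OF assms(2,1) al(2) ga(2) h' this]
  have G: "chain_map Y' Y (i * \<alpha>' * r' + t * \<gamma>' * p' + i * h' * p')" (is "chain_map Y' Y ?G") .
  have FG: "?F * ?G = i' * (\<alpha> * \<alpha>') * r' + t' * (\<gamma> * \<gamma>') * p' + i' * (\<alpha> * h' + h * \<gamma>') * p'"
    by (simp add: algebra_simps S.rels S.rels' graded_hom[THEN E_left, THEN mult_eq] h'[THEN E_left, THEN mult_eq])
  have GF: "?G * ?F = i * (\<alpha>' * \<alpha>) * r + t * (\<gamma>' * \<gamma>) * p + i * (\<alpha>' * h + h' * \<gamma>) * p"
    by (simp add: algebra_simps S'.rels S'.rels' graded_hom[THEN E_left, THEN mult_eq] h[THEN E_left, THEN mult_eq])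
  have "\<alpha> * h' + h * \<gamma>' \<in> graded_hom 0 (obj Z') (obj X')" "\<alpha>' * h + h' * \<gamma> \<in> graded_hom 0 (obj Z) (obj X)"
    by (intro graded_hom_add graded_hom_mult[OF h' graded_hom(1)] graded_hom_mult[OF graded_hom(4) h] graded_hom_mult[OF h graded_hom(2)] graded_hom_mult[OF graded_hom(3) h']; simp)+
  moreover have "homotopic X' X' (\<alpha> * \<alpha>') (E (obj X'))" "homotopic Z' Z' (\<gamma> * \<gamma>') (E (obj Z'))"
    "homotopic X X (\<alpha>' * \<alpha>) (E (obj X))" "homotopic Z Z (\<gamma>' * \<gamma>) (E (obj Z))"
    using assms(3,4) by (auto simp: hinv_def)
  ultimately obtain P Q where P: "chain_map Y' Y' P" "homotopic Y' Y' (?F * ?G * P) (E (obj Y'))"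
    and Q: "chain_map Y Y Q" "homotopic Y Y (Q * (?G * ?F)) (E (obj Y))"
    using unipotent_invertible[OF assms(2) chain_map_mult[OF G F] FG]
      unipotent_invertible[OF assms(1) chain_map_mult[OF F G] GF] by metis
  \<comment> \<open>Up to homotopy, \<open>?G * P\<close> is a right inverse and
    \<open>Q * ?G\<close> a left inverse of \<open>?F\<close>.\<close>
  have "chain_map Y' Y (?G * P)" "chain_map Y' Y (Q * ?G)"
    using chain_map_mult P Q F G by blast+
  then show ?thesis
    using one_sided_inverses[OF F] P Q by (simp only: mult.assoc)
qed

text \<open>That \<open>K\<close> is a complex is derived from the block form of \<open>D K\<close>:
  the only entry of \<open>D K * D K\<close> not vanishing at once is
  \<open>D Y * f - f * D X\<close>.\<close>

lemma cone_extI: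
  assumes X: "X \<in> bc" and Y: "Y \<in> bc" and f: "chain_map X Y f" and k: "bounded (obj K)"
    and K: "\<And>n. obj K n \<in> Ob A" "\<And>n. diff K n \<in> Hom A (obj K n) (obj K (n + 1))"
    and a: "a \<in> graded_hom (-1) (obj X) (obj K)" and b: "b \<in> graded_hom 0 (obj Y) (obj K)"
    and a': "a' \<in> graded_hom 1 (obj K) (obj X)" and b': "b' \<in> graded_hom 0 (obj K) (obj Y)"
    and eqs: "a' * a = E (obj X)" "b' * b = E (obj Y)" "a' * b = 0" "b' * a = 0" "a * a' + b * b' = E (obj K)"
    and d: "D K = b * f * a' + b * D Y * b' - a * D X * a'"
  shows "cone_ext A X Y K f a b a' b'"
proof -
  note rels = eqs(1-4) D_D[OF X] D_D[OF Y] E_left[OF D_in[OF X]] E_left[OF D_in[OF Y]] E_left[OF chain_map_graded_hom[OF f]]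
    E_left[OF a'] E_left[OF b'] E_right[OF D_in[OF X]] E_right[OF D_in[OF Y]] E_right[OF chain_map_graded_hom[OF f]]
    E_right[OF a] E_right[OF b] chain_map_comm[OF f]
  have "D K * D K = 0"
    by (simp add: d algebra_simps rels rels[THEN mult_eq])
  then have "K \<in> bc"
    using K k by (simp add: bc_iff)
  then show ?thesis
    using X Y f a b a' b' eqs
    by unfold_locales (simp_all add: d algebra_simps rels chain_map_graded_hom)
qed

end

section \<open>Existence of graded biproducts, split extensions and cones\<close>

locale addit = additive_category A for A :: "('o, 'm) precat"

sublocale addit \<subseteq> preadd ..

context addit
begin

lemma ex_biproduct:
  assumes "X \<in> Ob A" "Z \<in> Ob A"
  obtains P i t r p where "P \<in> Ob A" "i \<in> emb_hom X P" "t \<in> emb_hom Z P" "r \<in> emb_hom P X" "p \<in> emb_hom P Z"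
    "r * i = e X" "p * t = e Z" "r * t = 0" "p * i = 0" "i * r + t * p = e P"
proof -
  have "\<exists>P \<iota> \<pi>. is_direct_sum A {..<2::nat} (\<lambda>j. if j = 0 then X else Z) P \<iota> \<pi>"
    by (rule direct_sums) (use assms in auto)
  then obtain P \<iota> \<pi> where "is_direct_sum A {..<2::nat} (\<lambda>j. if j = 0 then X else Z) P \<iota> \<pi>"
    by blast
  then have *: "dsum {..<2::nat} (\<lambda>j. if j = 0 then X else Z) P
    (\<lambda>j. emb (if j = 0 then X else Z) P (\<iota> j)) (\<lambda>j. emb P (if j = 0 then X else Z) (\<pi> j))"
    by (simp add: is_direct_sum_iff)
  have "{..<2::nat} = {0, 1}"
    by auto
  with * show thesis
    by (intro that[of P "emb X P (\<iota> 0)" "emb Z P (\<iota> 1)" "emb P X (\<pi> 0)" "emb P Z (\<pi> 1)"])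
      (auto simp: dsum_def)
qed

lemma bc_bounded: "X \<in> bc \<Longrightarrow> bounded (obj X)"
  by (simp add: bc_iff)

text \<open>The offset \<open>k\<close> covers both applications: \<open>k = 0\<close> for split
  extensions, and \<open>k = 1\<close> for cones, where the first summand is shifted.\<close>

lemma ex_graded_biproduct:
  assumes x: "\<And>n. x n \<in> Ob A" and z: "\<And>n. z n \<in> Ob A" and "bounded x" "bounded z"
  obtains y i t r p where "\<And>n. y n \<in> Ob A" "bounded y" "i \<in> graded_hom (- k) x y" "t \<in> graded_hom 0 z y" "r \<in> graded_hom k y x" "p \<in> graded_hom 0 y z"
    "r * i = E x" "p * t = E z" "r * t = 0" "p * i = 0" "i * r + t * p = E y"
proof -
  have "\<exists>P i t r p. P \<in> Ob A \<and> i \<in> emb_hom (x (n + k)) P \<and> t \<in> emb_hom (z n) P \<and> r \<in> emb_hom P (x (n + k)) \<and> p \<in> emb_hom P (z n) \<and>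
    r * i = e (x (n + k)) \<and> p * t = e (z n) \<and> r * t = 0 \<and> p * i = 0 \<and> i * r + t * p = e P" for n
    using ex_biproduct[OF x[of "n + k"] z[of n]] by metis
  then obtain P i t r p where *: "P n \<in> Ob A \<and> i n \<in> emb_hom (x (n + k)) (P n) \<and> t n \<in> emb_hom (z n) (P n) \<and>
      r n \<in> emb_hom (P n) (x (n + k)) \<and> p n \<in> emb_hom (P n) (z n) \<and>
      r n * i n = e (x (n + k)) \<and> p n * t n = e (z n) \<and> r n * t n = 0 \<and> p n * i n = 0 \<and>
      i n * r n + t n * p n = e (P n)" for n
    by metis
  note ** = *[of "_ - k", simplified]
  show thesis
  \<comment> \<open>The inclusion \<open>i n\<close> starts at \<open>x (n + k)\<close>, so the
    component at index \<open>n\<close> of the graded operator is \<open>i (n - k)\<close>.\<close>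
  proof (rule that[of P "graded (- k) (\<lambda>n. i (n - k))" "graded 0 t" "graded k r" "graded 0 p"])
    obtain M N where M: "\<And>n. \<bar>n\<bar> > M \<Longrightarrow> e (x n) = 0" and N: "\<And>n. \<bar>n\<bar> > N \<Longrightarrow> e (z n) = 0"
      using assms(3,4) by (auto simp: bounded_def)
    have "e (P n) = 0" if "\<bar>n\<bar> > max (M + \<bar>k\<bar>) N" for n
    proof -
      have "e (x (n + k)) = 0" "e (z n) = 0"
        using that by (auto intro: M N)
      then have "i n = 0" "t n = 0"
        using e_right * by (metis mult_zero_right)+
      then show ?thesis
        using *[of n] by auto
    qed
    then show "bounded P"
      unfolding bounded_def by blast
  qed (use * ** in \<open>auto intro!: graded_homI simp: graded_mult graded_add E_def graded_zero\<close>)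
qed

text \<open>The differential is block triangular with off-diagonal block \<open>w\<close>; the only
  entry of its square not already zero is \<open>D X * w + w * D Z\<close>.\<close>

lemma ex_split_ext:
  assumes X: "X \<in> bc" and Z: "Z \<in> bc" and w: "w \<in> graded_hom 1 (obj Z) (obj X)" and wD: "D X * w + w * D Z = 0"
  obtains Y i t r p where "split_ext A X Z Y i t r p w"
proof -
  obtain y i t r p where y: "\<And>n. y n \<in> Ob A" "bounded y"
    and i: "i \<in> graded_hom 0 (obj X) y" and t: "t \<in> graded_hom 0 (obj Z) y" and r: "r \<in> graded_hom 0 y (obj X)" and p: "p \<in> graded_hom 0 y (obj Z)"
    and eqs: "r * i = E (obj X)" "p * t = E (obj Z)" "r * t = 0" "p * i = 0" "i * r + t * p = E y"
    using ex_graded_biproduct[where k=0, simplified, OF bc_Ob[OF X] bc_Ob[OF Z] bc_bounded[OF X] bc_bounded[OF Z]] by metis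
  define d where "d = i * D X * r + t * D Z * p + i * w * p"
  have d: "d \<in> graded_hom 1 y y"
    unfolding d_def
    by (intro graded_hom_add graded_hom_mult[OF r graded_hom_mult[OF D_in[OF X] i]] graded_hom_mult[OF p graded_hom_mult[OF D_in[OF Z] t]]
        graded_hom_mult[OF p graded_hom_mult[OF w i]]) simp_all
  note rels = eqs(1-4) D_D[OF X] D_D[OF Z] E_left[OF D_in[OF X]] E_left[OF D_in[OF Z]] E_left[OF w]
    E_left[OF r] E_left[OF p] E_right[OF D_in[OF X]] E_right[OF D_in[OF Z]] E_right[OF w] E_right[OF i] E_right[OF t]
  have "i * (D X * w + w * D Z) * p = 0"
    by (simp add: wD)
  then have "d * d = 0"
    by (simp add: d_def algebra_simps rels rels[THEN mult_eq])
  then obtain Y where Y: "Y \<in> bc" "obj Y = y" "D Y = d"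
    using ex_complex[OF d _ y(2)] by blast
  have "split_ext A X Z Y i t r p w"
    using X Z Y w i t r p eqs
    by unfold_locales (simp_all add: d_def algebra_simps rels)
  then show thesis
    by (rule that)
qed

lemma ex_cone_ext:
  assumes f: "chain_map X Y f"
  obtains K a b a' b' where "cone_ext A X Y K f a b a' b'"
proof -
  have X: "X \<in> bc" and Y: "Y \<in> bc"
    using f chain_map_bc by auto
  obtain y a b a' b' where y: "\<And>n. y n \<in> Ob A" "bounded y"
    and a: "a \<in> graded_hom (-1) (obj X) y" and b: "b \<in> graded_hom 0 (obj Y) y" and a': "a' \<in> graded_hom 1 y (obj X)" and b': "b' \<in> graded_hom 0 y (obj Y)"
    and eqs: "a' * a = E (obj X)" "b' * b = E (obj Y)" "a' * b = 0" "b' * a = 0" "a * a' + b * b' = E y"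
    using ex_graded_biproduct[where k=1, OF bc_Ob[OF X] bc_Ob[OF Y] bc_bounded[OF X] bc_bounded[OF Y]] by metis
  define d where "d = b * f * a' + b * D Y * b' - a * D X * a'"
  have "d \<in> graded_hom 1 y y"
    unfolding d_def
    by (intro graded_hom_add graded_hom_diff graded_hom_mult[OF a' graded_hom_mult[OF chain_map_graded_hom[OF f] b]] graded_hom_mult[OF b' graded_hom_mult[OF D_in[OF Y] b]]
        graded_hom_mult[OF a' graded_hom_mult[OF D_in[OF X] a]]) simp_all
  then obtain g where g: "d = graded 1 g" "\<And>n. g n \<in> emb_hom (y n) (y (n + 1))"
    by (blast elim: graded_homE)
  define K where "K = \<lparr>obj = y, diff = (\<lambda>n. unemb (y n) (y (n+1)) (g n))\<rparr>"
  have "D K = d" "obj K = y"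
    using g by (simp_all add: D_def K_def emb_unemb)
  then have "cone_ext A X Y K f a b a' b'"
    using X Y f y a b a' b' eqs g by (intro cone_extI) (simp_all add: d_def[symmetric], simp add: K_def unemb_in)
  then show thesis
    by (rule that)
qed

end

context preadd
begin

section \<open>The homotopy category in terms of graded morphisms\<close>

definition assemble :: "('o, 'm) cpx \<Rightarrow> ('o, 'm) cpx \<Rightarrow> (int \<Rightarrow> 'm) \<Rightarrow> ('o, 'm) gmor" where
  "assemble X Y f = graded 0 (\<lambda>n. emb (obj X n) (obj Y n) (f n))"

definition components :: "('o, 'm) cpx \<Rightarrow> ('o, 'm) cpx \<Rightarrow> ('o, 'm) gmor \<Rightarrow> int \<Rightarrow> 'm" where
  "components X Y F = (THE f. (\<forall>n. f n \<in> Hom A (obj X n) (obj Y n)) \<and> assemble X Y f = F)"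

lemma assemble_inject:
  assumes "X \<in> bc" "Y \<in> bc" "\<And>n. f n \<in> Hom A (obj X n) (obj Y n)" "\<And>n. g n \<in> Hom A (obj X n) (obj Y n)"
    "assemble X Y f = assemble X Y g"
  shows "f = g"
proof
  fix n
  have "emb (obj X n) (obj Y n) (f n) = emb (obj X n) (obj Y n) (g n)"
    using assms(5) by (simp add: assemble_def graded_inject fun_eq_iff)
  then show "f n = g n"
    using assms(3)[of n] assms(4)[of n] bc_Ob[OF assms(1), of n] bc_Ob[OF assms(2), of n] by (metis emb_inject)
qed

lemma assemble_in: "\<lbrakk>X \<in> bc; Y \<in> bc; \<And>n. f n \<in> Hom A (obj X n) (obj Y n)\<rbrakk> \<Longrightarrow> assemble X Y f \<in> graded_hom 0 (obj X) (obj Y)"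
  unfolding assemble_def by (intro graded_homI) (simp add: emb_emb_hom bc_Ob)

lemma components_assemble:
  assumes "X \<in> bc" "Y \<in> bc" "\<And>n. f n \<in> Hom A (obj X n) (obj Y n)"
  shows "components X Y (assemble X Y f) = f"
  unfolding components_def by (rule the_equality) (use assms assemble_inject in blast)+

lemma components:
  assumes "X \<in> bc" "Y \<in> bc" "F \<in> graded_hom 0 (obj X) (obj Y)"
  shows components_in: "components X Y F n \<in> Hom A (obj X n) (obj Y n)" and assemble_components: "assemble X Y (components X Y F) = F"
proof -
  obtain G where G: "F = graded 0 G" "\<And>n. G n \<in> emb_hom (obj X n) (obj Y (n + 0))"
    using assms(3) by (blast elim: graded_homE)
  define f where "f = (\<lambda>n. unemb (obj X n) (obj Y n) (G n))"
  have f: "f n \<in> Hom A (obj X n) (obj Y n)" for n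
    using unemb_in[OF G(2)] by (simp add: f_def)
  have F: "F = assemble X Y f"
    using emb_unemb[OF G(2)] by (simp add: f_def assemble_def G(1))
  show "components X Y F n \<in> Hom A (obj X n) (obj Y n)" "assemble X Y (components X Y F) = F"
    unfolding F components_assemble[OF assms(1,2) f] using f by simp_all
qed

lemma chain_maps_iff:
  assumes X: "X \<in> bc" and Y: "Y \<in> bc"
  shows "f \<in> chain_maps A X Y \<longleftrightarrow> (\<forall>n. f n \<in> Hom A (obj X n) (obj Y n)) \<and> chain_map X Y (assemble X Y f)"
proof -
  have "(\<forall>n. Comp A (obj X n) (obj Y n) (obj Y (n+1)) (diff Y n) (f n) =
      Comp A (obj X n) (obj X (n+1)) (obj Y (n+1)) (f (n+1)) (diff X n)) \<longleftrightarrow> D Y * assemble X Y f = assemble X Y f * D X"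
    if f: "\<forall>n. f n \<in> Hom A (obj X n) (obj Y n)"
  proof -
    have "Comp A (obj X n) (obj Y n) (obj Y (n+1)) (diff Y n) (f n) =
        Comp A (obj X n) (obj X (n+1)) (obj Y (n+1)) (f (n+1)) (diff X n) \<longleftrightarrow>
      emb (obj Y n) (obj Y (n+1)) (diff Y n) * emb (obj X n) (obj Y n) (f n) =
      emb (obj X (n+1)) (obj Y (n+1)) (f (n+1)) * emb (obj X n) (obj X (n+1)) (diff X n)" for n
      using f X Y unfolding bc_iff by (metis emb_Comp emb_inject Comp_in)
    then show ?thesis
      by (simp add: D_def assemble_def graded_mult graded_inject fun_eq_iff)
  qed
  then show ?thesis
    unfolding chain_maps_def chain_map_def using X Y assemble_in by auto
qed

lemma components_chain_maps: "chain_map X Y F \<Longrightarrow> components X Y F \<in> chain_maps A X Y"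
  using chain_maps_iff[of X Y] chain_map_bc[of X Y F] components[of X Y F] chain_map_graded_hom[of X Y F] by auto

lemma assemble_components_chain_map: "chain_map X Y F \<Longrightarrow> assemble X Y (components X Y F) = F"
  using chain_map_bc[of X Y F] assemble_components[of X Y F] chain_map_graded_hom[of X Y F] by auto

lemma homotopy_rel_iff:
  assumes X: "X \<in> bc" and Y: "Y \<in> bc"
  shows "(f, g) \<in> homotopy_rel A X Y \<longleftrightarrow>
    f \<in> chain_maps A X Y \<and> g \<in> chain_maps A X Y \<and> homotopic X Y (assemble X Y f) (assemble X Y g)"
proof -
  have "(\<exists>h. (\<forall>n. h n \<in> Hom A (obj X n) (obj Y (n-1))) \<and>
        (\<forall>n. g n = Add A (obj X n) (obj Y n) (f n)
           (Add A (obj X n) (obj Y n)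
              (Comp A (obj X n) (obj Y (n-1)) (obj Y n) (diff Y (n-1)) (h n))
              (Comp A (obj X n) (obj X (n+1)) (obj Y n) (h (n+1)) (diff X n))))) \<longleftrightarrow> homotopic X Y (assemble X Y f) (assemble X Y g)"
    (is "(\<exists>h. ?H h \<and> (\<forall>n. ?eq h n)) \<longleftrightarrow> _")
    if f: "\<And>n. f n \<in> Hom A (obj X n) (obj Y n)" and g: "\<And>n. g n \<in> Hom A (obj X n) (obj Y n)"
  proof -
    have dX: "diff X n \<in> Hom A (obj X n) (obj X (n+1))" and dY: "diff Y n \<in> Hom A (obj Y n) (obj Y (n+1))" for n
      using X Y by (simp_all add: bc_iff)
    have dY': "diff Y (n-1) \<in> Hom A (obj Y (n-1)) (obj Y n)" for n
      using dY[of "n-1"] by simp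
    note Ob = bc_Ob[OF X] bc_Ob[OF Y]
    let ?h = "\<lambda>h. graded (-1) (\<lambda>n. emb (obj X n) (obj Y (n-1)) (h n))"
    have eq: "(\<forall>n. ?eq h n) \<longleftrightarrow> assemble X Y g = assemble X Y f + D Y * ?h h + ?h h * D X" if h: "?H h" for h
    proof -
      have h': "h (n+1) \<in> Hom A (obj X (n+1)) (obj Y n)" for n
        using h[rule_format, of "n+1"] by simp
      let ?r = "\<lambda>n. Add A (obj X n) (obj Y n) (f n)
           (Add A (obj X n) (obj Y n)
              (Comp A (obj X n) (obj Y (n-1)) (obj Y n) (diff Y (n-1)) (h n))
              (Comp A (obj X n) (obj X (n+1)) (obj Y n) (h (n+1)) (diff X n)))"
      have r: "?r n \<in> Hom A (obj X n) (obj Y n)" for n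
        using h by (auto intro!: Add_in Comp_in f Ob dX dY' h')
      have "assemble X Y f + D Y * ?h h + ?h h * D X = assemble X Y ?r"
        using h by (simp add: assemble_def D_def graded_mult graded_add graded_inject fun_eq_iff
            emb_Add emb_Comp Add_in Comp_in f Ob dX dY' h' add.assoc)
      note * = this
      show ?thesis
      proof
        assume "\<forall>n. ?eq h n"
        then have "g = ?r"
          by (intro ext) (erule spec)
        then show "assemble X Y g = assemble X Y f + D Y * ?h h + ?h h * D X"
          by (simp only: *)
      next
        assume "assemble X Y g = assemble X Y f + D Y * ?h h + ?h h * D X"
        then have "assemble X Y g = assemble X Y ?r"
          by (simp only: *)
        then have "g = ?r"
          by (rule assemble_inject[OF X Y g r])
        then show "\<forall>n. ?eq h n"
          by (intro allI) (rule fun_cong)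
      qed
    qed
    show ?thesis
    proof
      assume "\<exists>h. ?H h \<and> (\<forall>n. ?eq h n)"
      then obtain h where h: "?H h" "\<forall>n. ?eq h n"
        by (elim exE conjE)
      have "?h h \<in> graded_hom (-1) (obj X) (obj Y)"
        using h(1) by (intro graded_homI) (simp add: emb_emb_hom Ob)
      moreover have "assemble X Y g = assemble X Y f + D Y * ?h h + ?h h * D X"
        using eq[OF h(1)] h(2) by (rule iffD1)
      ultimately show "homotopic X Y (assemble X Y f) (assemble X Y g)"
        unfolding homotopic_def by (rule bexI[rotated])
    next
      assume "homotopic X Y (assemble X Y f) (assemble X Y g)"
      then obtain H where H: "H \<in> graded_hom (-1) (obj X) (obj Y)" "assemble X Y g = assemble X Y f + D Y * H + H * D X"
        unfolding homotopic_def by (elim bexE)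
      obtain G where G: "H = graded (-1) G" "\<And>n. G n \<in> emb_hom (obj X n) (obj Y (n + -1))"
        using H(1) by (blast elim: graded_homE)
      define h where "h = (\<lambda>n. unemb (obj X n) (obj Y (n-1)) (G n))"
      have h: "?H h" "H = ?h h"
        using unemb[OF G(2)] by (simp_all add: G(1) h_def)
      then have "\<forall>n. ?eq h n"
        using H(2) by (intro iffD2[OF eq]) simp_all
      then show "\<exists>h. ?H h \<and> (\<forall>n. ?eq h n)"
        using h(1) by (intro exI conjI)
    qed
  qed
  then show ?thesis
    unfolding homotopy_rel_def using chain_maps_iff[OF X Y] by auto
qed

text \<open>Names the morphisms of the homotopy category, which are sets of families, by operators;
  with it composition becomes multiplication and equality becomes \<open>homotopic\<close>.\<close>

definition hclass :: "('o, 'm) cpx \<Rightarrow> ('o, 'm) cpx \<Rightarrow> ('o, 'm) gmor \<Rightarrow> (int \<Rightarrow> 'm) set" where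
  "hclass X Y F = htpy_class A X Y (components X Y F)"

lemma mem_hclass: "chain_map X Y F \<Longrightarrow> g \<in> hclass X Y F \<longleftrightarrow> g \<in> chain_maps A X Y \<and> homotopic X Y F (assemble X Y g)"
  using chain_map_bc[of X Y F] components_chain_maps[of X Y F] assemble_components_chain_map[of X Y F]
  by (auto simp: hclass_def htpy_class_def homotopy_rel_iff)

lemma htpy_class_hclass: "\<lbrakk>X \<in> bc; Y \<in> bc; f \<in> chain_maps A X Y\<rbrakk> \<Longrightarrow> htpy_class A X Y f = hclass X Y (assemble X Y f)"
  unfolding hclass_def by (subst components_assemble) (auto simp: chain_maps_iff)

lemma components_mem_hclass: "\<lbrakk>chain_map X Y F; homotopic X Y F G\<rbrakk> \<Longrightarrow> components X Y G \<in> hclass X Y F"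
  using homotopic_chain_map[of X Y F G] by (simp add: mem_hclass components_chain_maps assemble_components_chain_map)

lemma hclass_eq_iff:
  assumes "chain_map X Y F" "chain_map X Y G"
  shows "hclass X Y F = hclass X Y G \<longleftrightarrow> homotopic X Y F G"
proof
  assume "hclass X Y F = hclass X Y G"
  then have "components X Y G \<in> hclass X Y F"
    using components_mem_hclass assms homotopic_refl by blast
  then show "homotopic X Y F G"
    using assms by (simp add: mem_hclass assemble_components_chain_map)
next
  assume FG: "homotopic X Y F G"
  show "hclass X Y F = hclass X Y G"
    unfolding set_eq_iff mem_hclass[OF assms(1)] mem_hclass[OF assms(2)]
    using homotopic_trans[OF FG] homotopic_trans[OF homotopic_sym[OF FG]] by blast
qed

lemma Ob_Kb: "Ob (Kb A) = bc" and Hom_Kb: "Hom (Kb A) = Hom (homotopy_category A)"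
  and Ident_Kb: "Ident (Kb A) = Ident (homotopy_category A)"
  and Comp_Kb: "Comp (Kb A) = Comp (homotopy_category A)"
  and Distinguished_Kb: "Distinguished (Kb A) = Kb_triangles A"
  by (simp_all add: Kb_def precat.extend_def tricat.fields_def homotopy_category_def)

lemma Ob_H: "Ob (homotopy_category A) = bc"
  by (simp add: homotopy_category_def)

lemma Hom_H:
  assumes "X \<in> bc" "Y \<in> bc"
  shows "Hom (homotopy_category A) X Y = {hclass X Y F | F. chain_map X Y F}"
proof -
  have "Hom (homotopy_category A) X Y = htpy_class A X Y ` chain_maps A X Y"
    by (auto simp: homotopy_category_def quotient_def htpy_class_def)
  also have "\<dots> = {hclass X Y F | F. chain_map X Y F}"
    using assms htpy_class_hclass chain_maps_iff components_chain_maps by (auto simp: hclass_def image_iff) blast+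
  finally show ?thesis .
qed

lemma Ident_H: "X \<in> bc \<Longrightarrow> Ident (homotopy_category A) X = hclass X X (E (obj X))"
proof -
  assume X: "X \<in> bc"
  have u: "assemble X X (\<lambda>n. Ident A (obj X n)) = E (obj X)"
    by (simp add: assemble_def E_def e_def)
  have "(\<lambda>n. Ident A (obj X n)) \<in> chain_maps A X X"
    using X by (simp add: chain_maps_iff u chain_map_E Ident_in bc_Ob)
  then show ?thesis
    using X u by (simp add: homotopy_category_def htpy_class_hclass)
qed

lemma assemble_Comp:
  assumes "X \<in> bc" "Y \<in> bc" "Z \<in> bc" "f \<in> chain_maps A X Y" "g \<in> chain_maps A Y Z"
  shows "assemble X Z (\<lambda>n. Comp A (obj X n) (obj Y n) (obj Z n) (g n) (f n)) = assemble Y Z g * assemble X Y f"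
    and "(\<lambda>n. Comp A (obj X n) (obj Y n) (obj Z n) (g n) (f n)) \<in> chain_maps A X Z"
proof -
  show "assemble X Z (\<lambda>n. Comp A (obj X n) (obj Y n) (obj Z n) (g n) (f n)) = assemble Y Z g * assemble X Y f"
    using assms by (simp add: assemble_def graded_mult graded_inject fun_eq_iff emb_Comp bc_Ob chain_maps_iff)
  then show "(\<lambda>n. Comp A (obj X n) (obj Y n) (obj Z n) (g n) (f n)) \<in> chain_maps A X Z"
    using assms by (auto simp: chain_maps_iff Comp_in bc_Ob chain_map_mult)
qed

text \<open>Composition is a union over all representatives. Homotopy invariance makes all members
  of the union equal, and \<open>components\<close> provides a representative, so that the union is
  not empty.\<close>

lemma Comp_H:
  assumes "chain_map X Y F" "chain_map Y Z G"
  shows "Comp (homotopy_category A) X Y Z (hclass Y Z G) (hclass X Y F) = hclass X Z (G * F)"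
proof -
  have bc: "X \<in> bc" "Y \<in> bc" "Z \<in> bc"
    using assms chain_map_bc by auto
  have "htpy_class A X Z (\<lambda>n. Comp A (obj X n) (obj Y n) (obj Z n) (g n) (f n)) = hclass X Z (G * F)"
    if g: "g \<in> hclass Y Z G" and f: "f \<in> hclass X Y F" for g f
  proof -
    have f': "f \<in> chain_maps A X Y" "homotopic X Y F (assemble X Y f)" and g': "g \<in> chain_maps A Y Z" "homotopic Y Z G (assemble Y Z g)"
      using f g assms by (simp_all add: mem_hclass)
    have "homotopic X Z (G * F) (G * assemble X Y f)" "homotopic X Z (G * assemble X Y f) (assemble Y Z g * assemble X Y f)"
      using f' g' assms bc by (auto intro!: homotopic_mult_left homotopic_mult_right simp: chain_maps_iff)
    then have "homotopic X Z (G * F) (assemble Y Z g * assemble X Y f)"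
      by (rule homotopic_trans)
    moreover have "chain_map X Z (assemble Y Z g * assemble X Y f)"
      using f' g' bc by (auto simp: chain_maps_iff intro: chain_map_mult)
    ultimately have "hclass X Z (G * F) = hclass X Z (assemble Y Z g * assemble X Y f)"
      using hclass_eq_iff[OF chain_map_mult[OF assms]] by blast
    then show ?thesis
      by (simp add: htpy_class_hclass[OF bc(1,3) assemble_Comp(2)[OF bc f'(1) g'(1)]] assemble_Comp(1)[OF bc f'(1) g'(1)])
  qed
  moreover have "components X Y F \<in> hclass X Y F" "components Y Z G \<in> hclass Y Z G"
    using assms components_mem_hclass homotopic_refl by auto
  ultimately show ?thesis
    unfolding homotopy_category_def by auto
qed

lemma is_iso_H_iff:
  assumes "X \<in> bc" "Y \<in> bc"
  shows "is_iso (homotopy_category A) X Y u \<longleftrightarrow> (\<exists>F G. u = hclass X Y F \<and> hinv X Y F G)"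
proof
  assume "is_iso (homotopy_category A) X Y u"
  then obtain F G where "u = hclass X Y F" "chain_map X Y F" "chain_map Y X G"
    "Comp (homotopy_category A) X Y X (hclass Y X G) (hclass X Y F) = Ident (homotopy_category A) X"
    "Comp (homotopy_category A) Y X Y (hclass X Y F) (hclass Y X G) = Ident (homotopy_category A) Y"
    using assms by (auto simp: is_iso_def Hom_H)
  then show "\<exists>F G. u = hclass X Y F \<and> hinv X Y F G"
    using assms by (auto simp: hinv_def Comp_H Ident_H hclass_eq_iff chain_map_mult chain_map_E)
next
  assume "\<exists>F G. u = hclass X Y F \<and> hinv X Y F G"
  then obtain F G where *: "u = hclass X Y F" "hinv X Y F G"
    by blast
  then have "chain_map X Y F" "chain_map Y X G"
    by (simp_all add: hinv_def)
  then have "u \<in> Hom (homotopy_category A) X Y" "hclass Y X G \<in> Hom (homotopy_category A) Y X"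
    "Comp (homotopy_category A) X Y X (hclass Y X G) u = Ident (homotopy_category A) X"
    "Comp (homotopy_category A) Y X Y u (hclass Y X G) = Ident (homotopy_category A) Y"
    using * assms by (auto simp only: hinv_def Hom_H Comp_H Ident_H hclass_eq_iff chain_map_mult chain_map_E)
  then show "is_iso (homotopy_category A) X Y u"
    unfolding is_iso_def by blast
qed

lemma isomorphic_Kb_iff: "isomorphic (Kb A) X Y \<longleftrightarrow> heqv X Y"
proof -
  have "is_iso (Kb A) X Y u \<longleftrightarrow> is_iso (homotopy_category A) X Y u" for u
    by (simp add: is_iso_def Hom_Kb Comp_Kb Ident_Kb)
  then have "(\<exists>u. is_iso (Kb A) X Y u) \<longleftrightarrow> heqv X Y" if "X \<in> bc" "Y \<in> bc"
    unfolding heqv_def using is_iso_H_iff[OF that] by blast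
  then show ?thesis
    using heqv_bc[of X Y] unfolding isomorphic_def Ob_Kb by blast
qed

lemma zero_object_KbI:
  assumes "Z \<in> bc" "E (obj Z) = 0"
  shows "is_zero_object (Kb A) Z"
proof -
  have "F = 0" if "chain_map Z T F" for T F
    using E_right[OF chain_map_graded_hom[OF that]] assms by simp
  moreover have "F = 0" if "chain_map T Z F" for T F
    using E_left[OF chain_map_graded_hom[OF that]] assms by simp
  moreover have "chain_map Z T 0" "chain_map T Z 0" if "T \<in> bc" for T
    using that assms by (simp_all add: chain_map_def graded_hom_zero bc_Ob)
  ultimately have "Hom (Kb A) Z T = {hclass Z T 0}" "Hom (Kb A) T Z = {hclass T Z 0}" if "T \<in> bc" for T
    using that assms(1) unfolding Hom_Kb by (fastforce simp: Hom_H)+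
  then show ?thesis
    using assms(1) by (simp add: is_zero_object_def Ob_Kb)
qed

text \<open>\<open>Z\<close> has just one endomorphism in \<open>Kb A\<close>, so its identity is
  homotopic to zero, and zero maps are then mutually inverse.\<close>

lemma zero_object_Kb_heqv:
  assumes "is_zero_object (Kb A) Z" "Y \<in> bc" "E (obj Y) = 0"
  shows "heqv Z Y"
proof -
  have Z: "Z \<in> bc"
    using assms by (simp add: is_zero_object_def Ob_Kb)
  have zero: "chain_map Z Z 0" "chain_map Z Y 0" "chain_map Y Z 0" "chain_map Y Y 0"
    using Z assms(2) by (simp_all add: chain_map_def graded_hom_zero bc_Ob)
  have "\<exists>!u. u \<in> {hclass Z Z F | F. chain_map Z Z F}"
    using assms(1) Z by (simp add: is_zero_object_def Ob_Kb Hom_Kb flip: Hom_H[OF Z Z])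
  then have "hclass Z Z 0 = hclass Z Z (E (obj Z))"
    using zero(1) chain_map_E[OF Z] by blast
  then have "homotopic Z Z 0 (E (obj Z))"
    using hclass_eq_iff zero(1) chain_map_E[OF Z] by blast
  then have "hinv Z Y 0 0"
    using zero assms(3) homotopic_refl by (simp add: hinv_def)
  then show ?thesis
    by (auto simp: heqv_def)
qed

end

lemma graded_eqD: "graded k F = graded l G \<Longrightarrow> k = l \<Longrightarrow> F n = G n"
  by (simp add: graded_inject)

context preadd
begin

lemma diff_in: "X \<in> bc \<Longrightarrow> diff X n \<in> Hom A (obj X n) (obj X (n+1))"
  by (simp add: bc_iff)

lemma diff_Suc_in: "X \<in> bc \<Longrightarrow> diff X (n+1) \<in> Hom A (obj X (n+1)) (obj X (n+2))"
  using diff_in[of X "n+1"] by (simp add: add.commute)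

section \<open>Distinguished triangles\<close>

abbreviation sh :: "('o, 'm) cpx \<Rightarrow> ('o, 'm) cpx" where
  "sh \<equiv> shift_cpx A"

text \<open>The identity of \<open>X\<close> read as an operator of degree \<open>-1\<close> to the
  shift, with inverse \<open>desusp\<close> of degree \<open>1\<close>. The shifted differential is,
  up to sign, the conjugate of \<open>D X\<close> by them.\<close>

definition susp :: "('o, 'm) cpx \<Rightarrow> ('o, 'm) gmor" where
  "susp X = graded (-1) (\<lambda>n. e (obj X n))"

definition desusp :: "('o, 'm) cpx \<Rightarrow> ('o, 'm) gmor" where
  "desusp X = graded 1 (\<lambda>n. e (obj X (n + 1)))"

lemma obj_sh [simp]: "obj (sh X) n = obj X (n + 1)"
  by (simp add: shift_cpx_def)

lemma susp_in: "X \<in> bc \<Longrightarrow> susp X \<in> graded_hom (-1) (obj X) (obj (sh X))"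
  and desusp_in: "X \<in> bc \<Longrightarrow> desusp X \<in> graded_hom 1 (obj (sh X)) (obj X)"
  unfolding susp_def desusp_def by (intro graded_homI; simp add: e_in bc_Ob)+

lemma e_e: "X \<in> Ob A \<Longrightarrow> e X * e X = e X"
  by (rule e_left[OF e_in])

lemma desusp_susp: "X \<in> bc \<Longrightarrow> desusp X * susp X = E (obj X)"
  and susp_desusp: "X \<in> bc \<Longrightarrow> susp X * desusp X = E (obj (sh X))"
  by (simp_all add: susp_def desusp_def E_def graded_mult e_e bc_Ob)

lemma D_sh:
  assumes X: "X \<in> bc"
  shows "D (sh X) = - (susp X * D X * desusp X)"
proof -
  have d: "diff X (n+1) \<in> Hom A (obj X (n+1)) (obj X (n+2))" for n
    using X by (rule diff_Suc_in)
  have "emb (obj X (n+1)) (obj X (n+2)) (diff X (n+1)) \<in> emb_hom (obj X (n+1)) (obj X (n+2))" for n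
    using d by (simp add: emb_emb_hom bc_Ob X)
  note * = e_left[OF this] e_right[OF this]
  show ?thesis
    using * d
    by (simp add: D_def shift_cpx_def susp_def desusp_def graded_mult graded_neg graded_inject fun_eq_iff emb_Neg bc_Ob X
        add.commute[of 2] mult.assoc)
qed

lemma sh_bc:
  assumes X: "X \<in> bc"
  shows "sh X \<in> bc"
proof -
  have "D (sh X) * D (sh X) = susp X * (D X * ((desusp X * susp X) * (D X * desusp X)))"
    by (simp add: D_sh[OF X] mult.assoc)
  also have "\<dots> = susp X * (D X * (D X * desusp X))"
    by (simp add: desusp_susp[OF X] E_left[OF graded_hom_mult[OF desusp_in[OF X] D_in[OF X] refl]])
  also have "\<dots> = 0"
    by (simp add: D_D[OF X, THEN mult_eq])
  finally have "D (sh X) * D (sh X) = 0" .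
  moreover have "diff (sh X) n \<in> Hom A (obj X (n+1)) (obj X (n+1+1))" for n
  proof -
    have "diff X (n+1) \<in> Hom A (obj X (n+1)) (obj X (n+2))"
      using X by (rule diff_Suc_in)
    then show ?thesis
      using Neg_in[OF bc_Ob[OF X] bc_Ob[OF X]] by (simp add: shift_cpx_def add.commute)
  qed
  moreover have "bounded (obj (sh X))"
  proof -
    obtain N where "\<And>n. \<bar>n\<bar> > N \<Longrightarrow> e (obj X n) = 0"
      using X by (auto simp: bc_iff bounded_def)
    then show ?thesis
      unfolding bounded_def by (intro exI[of _ "N + 1"]) auto
  qed
  ultimately show ?thesis
    using X by (auto simp: bc_iff)
qed

text \<open>\<open>shift_mor\<close> is a union over representatives, so each \<open>f\<close>
  homotopic to the identity must be shown to shift to the same class; its homotopy is conjugated by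
  \<open>susp\<close> and \<open>desusp\<close>.\<close>

lemma shift_mor_E:
  assumes X: "X \<in> bc"
  shows "shift_mor A X X (hclass X X (E (obj X))) = hclass (sh X) (sh X) (E (obj (sh X)))"
proof -
  have "htpy_class A (sh X) (sh X) (\<lambda>n. f (n+1)) = hclass (sh X) (sh X) (E (obj (sh X)))"
    if f: "f \<in> hclass X X (E (obj X))" for f
  proof -
    have f: "f \<in> chain_maps A X X" "homotopic X X (E (obj X)) (assemble X X f)"
      using f mem_hclass[OF chain_map_E[OF X]] by auto
    then have fh: "f n \<in> Hom A (obj X n) (obj X n)" for n
      using chain_maps_iff[OF X X] by blast
    have fe: "e (obj X n) * emb (obj X n) (obj X n) (f n) = emb (obj X n) (obj X n) (f n)"
      "emb (obj X n) (obj X n) (f n) * e (obj X n) = emb (obj X n) (obj X n) (f n)" for n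
      using e_left[OF emb_emb_hom] e_right[OF emb_emb_hom] fh bc_Ob[OF X] by auto
    have u: "assemble (sh X) (sh X) (\<lambda>n. f (n+1)) = susp X * assemble X X f * desusp X"
      by (simp add: assemble_def susp_def desusp_def graded_mult graded_inject fun_eq_iff fe)
    obtain h where h: "h \<in> graded_hom (-1) (obj X) (obj X)" "assemble X X f = E (obj X) + D X * h + h * D X"
      using f(2) by (auto simp: homotopic_def)
    have "susp X * h * desusp X \<in> graded_hom (-1) (obj (sh X)) (obj (sh X))"
      by (rule graded_hom_mult[OF desusp_in[OF X] graded_hom_mult[OF h(1) susp_in[OF X], where m="-2"]]) simp_all
    \<comment> \<open>The sign compensates for the one in \<open>D (sh X)\<close>.\<close>
    then have h': "- (susp X * h * desusp X) \<in> graded_hom (-1) (obj (sh X)) (obj (sh X))"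
      by (rule graded_hom_neg)
    note rels = desusp_susp[OF X] susp_desusp[OF X] E_left[OF desusp_in[OF X]] E_left[OF D_in[OF X]] E_left[OF h(1)]
    have "assemble (sh X) (sh X) (\<lambda>n. f (n+1)) = E (obj (sh X)) + D (sh X) * - (susp X * h * desusp X)
        + - (susp X * h * desusp X) * D (sh X)"
      unfolding u h(2) D_sh[OF X] by (simp add: algebra_simps rels rels[THEN mult_eq])
    with h' have ht: "homotopic (sh X) (sh X) (E (obj (sh X))) (assemble (sh X) (sh X) (\<lambda>n. f (n+1)))"
      unfolding homotopic_def by (rule bexI[rotated])
    note cm = homotopic_chain_map[OF chain_map_E[OF sh_bc[OF X]] ht]
    then have "(\<lambda>n. f (n+1)) \<in> chain_maps A (sh X) (sh X)"
      using fh chain_maps_iff[OF sh_bc[OF X] sh_bc[OF X]] by auto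
    then have "htpy_class A (sh X) (sh X) (\<lambda>n. f (n+1)) = hclass (sh X) (sh X) (assemble (sh X) (sh X) (\<lambda>n. f (n+1)))"
      using htpy_class_hclass sh_bc X by blast
    also have "\<dots> = hclass (sh X) (sh X) (E (obj (sh X)))"
      using hclass_eq_iff[OF chain_map_E[OF sh_bc[OF X]] cm] ht by simp
    finally show ?thesis .
  qed
  moreover have "components X X (E (obj X)) \<in> hclass X X (E (obj X))"
    using components_mem_hclass chain_map_E[OF X] homotopic_refl by blast
  ultimately show ?thesis
    unfolding shift_mor_def by auto
qed

lemma emb_Comp3:
  assumes "X \<in> Ob A" "P \<in> Ob A" "Q \<in> Ob A" "Y \<in> Ob A" "f \<in> Hom A X P" "u \<in> Hom A P Q" "g \<in> Hom A Q Y"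
  shows "emb X Y (Comp A X P Y (Comp A P Q Y g u) f) = emb Q Y g * emb P Q u * emb X P f"
  using assms by (simp add: emb_Comp Comp_in)

lemma given_by_matrix_iff:
  assumes P: "P \<in> Ob A" and Q: "Q \<in> Ob A" and u: "u \<in> Hom A P Q"
    and "\<And>k. k \<in> I \<Longrightarrow> X k \<in> Ob A" "\<And>l. l \<in> J \<Longrightarrow> Y l \<in> Ob A"
    and "\<And>k. k \<in> I \<Longrightarrow> \<iota> k \<in> Hom A (X k) P" "\<And>l. l \<in> J \<Longrightarrow> \<pi> l \<in> Hom A Q (Y l)"
    and "\<And>k l. \<lbrakk>k \<in> I; l \<in> J\<rbrakk> \<Longrightarrow> m k l \<in> Hom A (X k) (Y l)"
  shows "given_by_matrix A I X P \<iota> J Y Q \<pi> m u \<longleftrightarrow>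
    (\<forall>k\<in>I. \<forall>l\<in>J. emb Q (Y l) (\<pi> l) * emb P Q u * emb (X k) P (\<iota> k) = emb (X k) (Y l) (m k l))"
proof -
  have "Comp A (X k) P (Y l) (Comp A P Q (Y l) (\<pi> l) u) (\<iota> k) = m k l \<longleftrightarrow>
    emb Q (Y l) (\<pi> l) * emb P Q u * emb (X k) P (\<iota> k) = emb (X k) (Y l) (m k l)"
    if "k \<in> I" "l \<in> J" for k l
    using that assms emb_Comp3[of "X k" P Q "Y l" "\<iota> k" u "\<pi> l"]
      emb_inject[of "X k" "Y l" "Comp A (X k) P (Y l) (Comp A P Q (Y l) (\<pi> l) u) (\<iota> k)" "m k l"]
    by (auto simp: Comp_in)
  then show ?thesis
    using u by (auto simp: given_by_matrix_def)
qed

text \<open>Inclusion and projection occurring in the standard triangle are kept as \<open>b\<close>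
  and \<open>a'\<close>; the other two exist but are not named.\<close>

lemma mapping_coneD:
  assumes X: "X \<in> bc" and Y: "Y \<in> bc" and f: "f \<in> chain_maps A X Y" and mc: "mapping_cone A X Y f K \<iota> \<pi>"
  defines "a' \<equiv> graded 1 (\<lambda>n. emb (obj K n) (obj X (n+1)) (\<pi> n 0))"
  shows "\<exists>a b'. cone_ext A X Y K (assemble X Y f) a (assemble Y K (\<lambda>n. \<iota> n 1)) a' b'"
    and "\<iota> n 1 \<in> Hom A (obj Y n) (obj K n)" "\<pi> n 0 \<in> Hom A (obj K n) (obj X (n+1))"
proof -
  let ?part = "\<lambda>n j. if j = (0::nat) then obj X (n+1) else obj Y n"
  have ds: "is_direct_sum A {0,1} (?part n) (obj K n) (\<iota> n) (\<pi> n)" for n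
    using mc by (auto simp: mapping_cone_def Let_def)
  let ?m = "\<lambda>n k l. if k = (0::nat) \<and> l = (0::nat) then Neg A (obj X (n+1)) (obj X (n+2)) (diff X (n+1))
                   else if k = 0 \<and> l = 1 then f (n+1)
                   else if k = 1 \<and> l = 0 then Zero A (obj Y n) (obj X (n+2))
                   else diff Y n"
  have gm: "given_by_matrix A {0,1} (?part n) (obj K n) (\<iota> n)
            {0,1} (?part (n+1)) (obj K (n+1)) (\<pi> (n+1)) (?m n) (diff K n)" for n
    using mc unfolding mapping_cone_def Let_def by blast
  have K: "obj K n \<in> Ob A" for n
    using ds[of n] by (auto simp: is_direct_sum_def is_product_def)
  have dK: "diff K n \<in> Hom A (obj K n) (obj K (n+1))" for n
    using gm[of n] by (simp add: given_by_matrix_def)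
  have io: "\<iota> n 0 \<in> Hom A (obj X (n+1)) (obj K n)" "\<iota> n 1 \<in> Hom A (obj Y n) (obj K n)"
    and pr: "\<pi> n 0 \<in> Hom A (obj K n) (obj X (n+1))" "\<pi> n 1 \<in> Hom A (obj K n) (obj Y n)" for n
    using ds[of n] by (auto simp: is_direct_sum_def is_product_def is_coproduct_def)
  show "\<iota> n 1 \<in> Hom A (obj Y n) (obj K n)" "\<pi> n 0 \<in> Hom A (obj K n) (obj X (n+1))"
    using io pr by auto
  define i0 where "i0 = (\<lambda>n. emb (obj X (n+1)) (obj K n) (\<iota> n 0))"
  define i1 where "i1 = (\<lambda>n. emb (obj Y n) (obj K n) (\<iota> n 1))"
  define p0 where "p0 = (\<lambda>n. emb (obj K n) (obj X (n+1)) (\<pi> n 0))"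
  define p1 where "p1 = (\<lambda>n. emb (obj K n) (obj Y n) (\<pi> n 1))"
  define d where "d = (\<lambda>n. emb (obj K n) (obj K (n+1)) (diff K n))"
  define dX where "dX = (\<lambda>n. emb (obj X n) (obj X (n+1)) (diff X n))"
  define dY where "dY = (\<lambda>n. emb (obj Y n) (obj Y (n+1)) (diff Y n))"
  define g where "g = (\<lambda>n. emb (obj X n) (obj Y n) (f n))"
  note defs = i0_def i1_def p0_def p1_def d_def dX_def dY_def g_def
  have emb_hom: "i0 n \<in> emb_hom (obj X (n+1)) (obj K n)" "i1 n \<in> emb_hom (obj Y n) (obj K n)"
    "p0 n \<in> emb_hom (obj K n) (obj X (n+1))" "p1 n \<in> emb_hom (obj K n) (obj Y n)" "d n \<in> emb_hom (obj K n) (obj K (n+1))" for n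
    using io[of n] pr[of n] dK[of n] K X Y by (simp_all add: defs emb_emb_hom bc_Ob)
  have eqs: "p0 n * i0 n = e (obj X (n+1))" "p1 n * i1 n = e (obj Y n)" "p0 n * i1 n = 0" "p1 n * i0 n = 0"
    "i0 n * p0 n + i1 n * p1 n = e (obj K n)" for n
    using is_direct_sum_imp_dsum[OF _ ds[of n]] by (auto simp: dsum_def defs)
  have fh: "f n \<in> Hom A (obj X n) (obj Y n)" for n
    using f chain_maps_iff[OF X Y] by blast
  have dX1: "diff X (n+1) \<in> Hom A (obj X (n+1)) (obj X (n+2))" for n
    using X by (rule diff_Suc_in)
  have dY1: "diff Y n \<in> Hom A (obj Y n) (obj Y (n+1))" for n
    using Y by (simp add: bc_iff)
  have mh: "?m n k l \<in> Hom A (?part n k) (?part (n+1) l)" if "k \<in> {0,1}" "l \<in> {0,1}" for n k l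
    using that fh[of "n+1"] dX1[of n] dY1[of n] Neg_in[OF _ _ dX1[of n]] X Y
    by (auto simp: bc_Ob Zero_in add.commute[of 2] add.assoc)
  have gm': "\<forall>k\<in>{0,1}. \<forall>l\<in>{0,1}. emb (obj K (n+1)) (?part (n+1) l) (\<pi> (n+1) l) *
      emb (obj K n) (obj K (n+1)) (diff K n) * emb (?part n k) (obj K n) (\<iota> n k) =
      emb (?part n k) (?part (n+1) l) (?m n k l)" for n
  proof -
    have "given_by_matrix A {0,1} (?part n) (obj K n) (\<iota> n)
      {0,1} (?part (n+1)) (obj K (n+1)) (\<pi> (n+1)) (?m n) (diff K n) \<longleftrightarrow>
      (\<forall>k\<in>{0,1}. \<forall>l\<in>{0,1}. emb (obj K (n+1)) (?part (n+1) l) (\<pi> (n+1) l) *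
        emb (obj K n) (obj K (n+1)) (diff K n) * emb (?part n k) (obj K n) (\<iota> n k) =
        emb (?part n k) (?part (n+1) l) (?m n k l))"
    proof (rule given_by_matrix_iff)
      show "\<And>k l. k \<in> {0,1} \<Longrightarrow> l \<in> {0,1} \<Longrightarrow> ?m n k l \<in> Hom A (?part n k) (?part (n+1) l)"
        by (rule mh)
    qed (use K dK io pr pr(1)[of "n+1"] X Y bc_Ob in auto)
    with gm[of n] show ?thesis
      by (rule iffD1[rotated])
  qed
  have m: "p0 (n+1) * d n * i0 n = - dX (n+1)" "p1 (n+1) * d n * i0 n = g (n+1)"
    "p0 (n+1) * d n * i1 n = 0" "p1 (n+1) * d n * i1 n = dY n" for n
    using gm'[of n] dX1[of n] X Y
    by (auto simp: defs emb_Neg emb_Zero bc_Ob add.commute[of 2] add.assoc)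
  \<comment> \<open>A morphism between biproducts is recovered from its four matrix entries by
    inserting the completeness relation on both sides.\<close>
  have dd: "d n = i1 (n+1) * g (n+1) * p0 n + i1 (n+1) * dY n * p1 n - i0 (n+1) * dX (n+1) * p0 n" for n
  proof -
    have "d n = e (obj K (n+1)) * d n * e (obj K n)"
      by (simp add: e_left[OF emb_hom(5)] e_right[OF emb_hom(5)])
    also have "\<dots> = (i0 (n+1) * p0 (n+1) + i1 (n+1) * p1 (n+1)) * d n * (i0 n * p0 n + i1 n * p1 n)"
      by (simp only: eqs(5))
    also have "\<dots> = i0 (n+1) * (p0 (n+1) * d n * i0 n) * p0 n + i0 (n+1) * (p0 (n+1) * d n * i1 n) * p1 n
      + i1 (n+1) * (p1 (n+1) * d n * i0 n) * p0 n + i1 (n+1) * (p1 (n+1) * d n * i1 n) * p1 n"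
      by (simp only: algebra_simps)
    also have "\<dots> = i1 (n+1) * g (n+1) * p0 n + i1 (n+1) * dY n * p1 n - i0 (n+1) * dX (n+1) * p0 n"
      unfolding m by (simp add: algebra_simps)
    finally show ?thesis .
  qed
  have bdd: "bounded (obj K)"
  proof -
    obtain M N where M: "\<And>n. \<bar>n\<bar> > M \<Longrightarrow> e (obj X n) = 0" and N: "\<And>n. \<bar>n\<bar> > N \<Longrightarrow> e (obj Y n) = 0"
      using X Y by (auto simp: bc_iff bounded_def)
    have "e (obj K n) = 0" if "\<bar>n\<bar> > max (M + 1) N" for n
    proof -
      have "e (obj X (n+1)) = 0" "e (obj Y n) = 0"
        using that by (auto intro: M N)
      then have "i0 n = 0" "i1 n = 0"
        using e_right[OF emb_hom(1)[of n]] e_right[OF emb_hom(2)[of n]] by simp_all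
      then show ?thesis
        using eqs(5)[of n] by simp
    qed
    then show ?thesis
      unfolding bounded_def by blast
  qed
  have u: "assemble X Y f = graded 0 g" "assemble Y K (\<lambda>n. \<iota> n 1) = graded 0 i1" "a' = graded 1 p0" "D K = graded 1 d" "D X = graded 1 dX" "D Y = graded 1 dY"
    by (simp_all add: assemble_def defs a'_def D_def)
  \<comment> \<open>\<open>i0 n\<close> starts at \<open>obj X (n+1)\<close>, so the component
    starting at \<open>obj X n\<close> is \<open>i0 (n-1)\<close>.\<close>
  have "cone_ext A X Y K (graded 0 g) (graded (-1) (\<lambda>n. i0 (n-1))) (graded 0 i1) (graded 1 p0) (graded 0 p1)"
  proof (rule cone_extI[OF X Y _ bdd K dK])
    show "chain_map X Y (graded 0 g)"
      using f chain_maps_iff[OF X Y] u by auto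
    show "graded (-1) (\<lambda>n. i0 (n-1)) \<in> graded_hom (-1) (obj X) (obj K)"
      using emb_hom(1)[of "_ - 1"] by (intro graded_homI) simp
    show "D K = graded 0 i1 * graded 0 g * graded 1 p0 + graded 0 i1 * D Y * graded 0 p1 -
        graded (- 1) (\<lambda>n. i0 (n - 1)) * D X * graded 1 p0"
      unfolding u by (simp add: graded_mult graded_add graded_neg graded_inject fun_eq_iff dd diff_conv_add_uminus del: add_uminus_conv_diff)
  qed (use emb_hom eqs eqs(1)[of "_ - 1"] in \<open>auto intro!: graded_homI simp: graded_mult graded_add E_def graded_zero\<close>)
  then show "\<exists>a b'. cone_ext A X Y K (assemble X Y f) a (assemble Y K (\<lambda>n. \<iota> n 1)) a' b'"
    unfolding u by blast
qed

text \<open>The third map of a standard triangle ends in \<open>sh X\<close>; hence the projection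
  is expressed by \<open>susp X * a'\<close>, which has degree \<open>0\<close>, and not by
  \<open>a'\<close>.\<close>

lemma mapping_coneI:
  assumes "cone_ext A X Y K F a b a' b'"
  obtains \<iota> \<pi> where "mapping_cone A X Y (components X Y F) K \<iota> \<pi>"
    "\<And>n. \<iota> n 1 = components Y K b n" "\<And>n. \<pi> n 0 = components K (sh X) (susp X * a') n"
proof -
  interpret C: cone_ext A X Y K F a b a' b' by fact
  note X = C.X and Y = C.Y and K = C.K
  obtain \<alpha> where a: "a = graded (-1) \<alpha>" "\<And>n. \<alpha> n \<in> emb_hom (obj X n) (obj K (n + -1))"
    using C.a by (blast elim: graded_homE)
  have sa: "susp X * a' \<in> graded_hom 0 (obj K) (obj (sh X))"
    by (rule graded_hom_mult[OF C.a' susp_in[OF X]]) simp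
  define i0 where "i0 = (\<lambda>n. unemb (obj X (n+1)) (obj K n) (\<alpha> (n+1)))"
  have al: "\<alpha> (n+1) \<in> emb_hom (obj X (n+1)) (obj K n)" for n
    using a(2)[of "n+1"] by simp
  have i0: "i0 n \<in> Hom A (obj X (n+1)) (obj K n)" for n
    using unemb_in[OF al] by (simp add: i0_def)
  have a: "a = graded (-1) (\<lambda>n. emb (obj X n) (obj K (n-1)) (i0 (n-1)))"
    using emb_unemb[OF al[of "_ - 1"]] by (simp add: a i0_def)
  define i1 where "i1 = components Y K b"
  have i1: "i1 n \<in> Hom A (obj Y n) (obj K n)" for n
    using components_in[OF Y K C.b] by (simp add: i1_def)
  have b: "b = graded 0 (\<lambda>n. emb (obj Y n) (obj K n) (i1 n))"
    using assemble_components[OF Y K C.b] by (simp add: i1_def assemble_def)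
  define p1 where "p1 = components K Y b'"
  have p1: "p1 n \<in> Hom A (obj K n) (obj Y n)" for n
    using components_in[OF K Y C.b'] by (simp add: p1_def)
  have b': "b' = graded 0 (\<lambda>n. emb (obj K n) (obj Y n) (p1 n))"
    using assemble_components[OF K Y C.b'] by (simp add: p1_def assemble_def)
  define p0 where "p0 = components K (sh X) (susp X * a')"
  have p0: "p0 n \<in> Hom A (obj K n) (obj X (n+1))" for n
    using components_in[OF K sh_bc[OF X] sa] by (simp add: p0_def)
  have "a' = desusp X * (susp X * a')"
    by (simp add: desusp_susp[OF X] C.units flip: mult.assoc)
  also have "\<dots> = desusp X * graded 0 (\<lambda>n. emb (obj K n) (obj X (n+1)) (p0 n))"
    using assemble_components[OF K sh_bc[OF X] sa] by (simp add: p0_def assemble_def)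
  also have "\<dots> = graded 1 (\<lambda>n. emb (obj K n) (obj X (n+1)) (p0 n))"
    using e_left[OF emb_emb_hom[OF bc_Ob[OF K] bc_Ob[OF X] p0]] by (simp add: desusp_def graded_mult)
  finally have a': "a' = graded 1 (\<lambda>n. emb (obj K n) (obj X (n+1)) (p0 n))" .
  have "F = graded 0 (\<lambda>n. emb (obj X n) (obj Y n) (components X Y F n))"
    using assemble_components[OF X Y C.f] by (simp add: assemble_def)
  note fams = a b a' b' this
  have fh: "components X Y F n \<in> Hom A (obj X n) (obj Y n)" for n
    using components_in[OF X Y C.f] .
  have dX1: "diff X (n+1) \<in> Hom A (obj X (n+1)) (obj X (n+2))" for n
    using X by (rule diff_Suc_in)
  have dY: "diff Y n \<in> Hom A (obj Y n) (obj Y (n+1))" and dK: "diff K n \<in> Hom A (obj K n) (obj K (n+1))" for n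
    using Y K by (simp_all add: bc_iff)
  note Ob = bc_Ob[OF X] bc_Ob[OF Y] bc_Ob[OF K]
  have 1: "emb (obj K n) (obj X (n+1)) (p0 n) * emb (obj X (n+1)) (obj K n) (i0 n) = e (obj X (n+1))" for n
    using graded_eqD[OF C.a'a[unfolded a' a E_def graded_mult], of "n+1"] by simp
  have 2: "emb (obj K n) (obj Y n) (p1 n) * emb (obj Y n) (obj K n) (i1 n) = e (obj Y n)" for n
    using graded_eqD[OF C.b'b[unfolded b' b E_def graded_mult], of n] by simp
  have 3: "emb (obj K n) (obj X (n+1)) (p0 n) * emb (obj Y n) (obj K n) (i1 n) = 0" for n
    using graded_eqD[OF C.a'b[unfolded a' b graded_zero[of 1, symmetric] graded_mult], of n] by simp
  have 4: "emb (obj K n) (obj Y n) (p1 n) * emb (obj X (n+1)) (obj K n) (i0 n) = 0" for n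
    using graded_eqD[OF C.b'a[unfolded b' a graded_zero[of "-1", symmetric] graded_mult], of "n+1"] by simp
  have 5: "emb (obj X (n+1)) (obj K n) (i0 n) * emb (obj K n) (obj X (n+1)) (p0 n) +
    emb (obj Y n) (obj K n) (i1 n) * emb (obj K n) (obj Y n) (p1 n) = e (obj K n)" for n
    using C.aabb[unfolded a' b' a b E_def graded_mult] by (simp add: graded_add graded_inject fun_eq_iff)
  have "a' * D K * a = - D X" "b' * D K * a = F" "a' * D K * b = 0" "b' * D K * b = D Y"
    by (simp_all add: C.rels C.rels' algebra_simps)
  note mat = this(1,4)[unfolded fams(1-4), unfolded D_def graded_mult graded_neg]
    this(3)[unfolded fams(1-4) graded_zero[of 2, symmetric], unfolded D_def graded_mult]
    trans[OF this(2) fams(5), unfolded fams(1-4), unfolded D_def graded_mult]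
  define \<iota> where "\<iota> = (\<lambda>n j. if j = (0::nat) then i0 n else i1 n)"
  define \<pi> where "\<pi> = (\<lambda>n j. if j = (0::nat) then p0 n else p1 n)"
  let ?part = "\<lambda>n j. if j = (0::nat) then obj X (n+1) else obj Y n"
  let ?m = "\<lambda>n k l. if k = (0::nat) \<and> l = (0::nat) then Neg A (obj X (n+1)) (obj X (n+2)) (diff X (n+1))
                   else if k = 0 \<and> l = 1 then components X Y F (n+1)
                   else if k = 1 \<and> l = 0 then Zero A (obj Y n) (obj X (n+2))
                   else diff Y n"
  have "is_direct_sum A {0,1} (?part n) (obj K n) (\<iota> n) (\<pi> n)" for n
    using 1 2 3 4 5 i0 i1 p0 p1 Ob by (subst is_direct_sum_iff) (auto simp: dsum_def \<iota>_def \<pi>_def emb_emb_hom)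
  moreover have "given_by_matrix A {0,1} (?part n) (obj K n) (\<iota> n)
            {0,1} (?part (n+1)) (obj K (n+1)) (\<pi> (n+1)) (?m n) (diff K n)" for n
  proof -
    have m: "emb (obj K (n+1)) (obj X (n+2)) (p0 (n+1)) * emb (obj K n) (obj K (n+1)) (diff K n) * emb (obj X (n+1)) (obj K n) (i0 n)
        = - emb (obj X (n+1)) (obj X (n+2)) (diff X (n+1))"
      "emb (obj K (n+1)) (obj Y (n+1)) (p1 (n+1)) * emb (obj K n) (obj K (n+1)) (diff K n) * emb (obj X (n+1)) (obj K n) (i0 n)
        = emb (obj X (n+1)) (obj Y (n+1)) (components X Y F (n+1))"
      "emb (obj K (n+1)) (obj X (n+2)) (p0 (n+1)) * emb (obj K n) (obj K (n+1)) (diff K n) * emb (obj Y n) (obj K n) (i1 n) = 0"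
      "emb (obj K (n+1)) (obj Y (n+1)) (p1 (n+1)) * emb (obj K n) (obj K (n+1)) (diff K n) * emb (obj Y n) (obj K n) (i1 n)
        = emb (obj Y n) (obj Y (n+1)) (diff Y n)"
      using graded_eqD[OF mat(1), of "n+1"] graded_eqD[OF mat(4), of "n+1"] graded_eqD[OF mat(3), of n] graded_eqD[OF mat(2), of n]
      by (simp_all add: add.commute[of 2])
    have dX1': "Neg A (obj X (n+1)) (obj X (n+2)) (diff X (n+1)) \<in> Hom A (obj X (n+1)) (obj X (n+2))"
      using Neg_in Ob dX1 by simp
    have "p0 (n+1) \<in> Hom A (obj K (n+1)) (obj X (n+2))"
      using p0[of "n+1"] by (simp add: add.commute)
    then show ?thesis
      using m dX1[of n] dX1' dY[of n] dK[of n] fh[of "n+1"] i0[of n] i1[of n] p1[of "n+1"] Ob Zero_in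
      by (subst given_by_matrix_iff) (auto simp: \<iota>_def \<pi>_def emb_Neg emb_Zero add.commute[of 2])
  qed
  ultimately have "mapping_cone A X Y (components X Y F) K \<iota> \<pi>"
    unfolding mapping_cone_def Let_def by blast
  then show thesis
    by (rule that) (simp_all add: \<iota>_def \<pi>_def i1_def p0_def)
qed

text \<open>The standard triangle on \<open>K\<close> is transported to \<open>Z\<close>. The
  comparison uses identities at \<open>X\<close> and \<open>Y\<close>, so only the shift of an
  identity has to be known.\<close>

lemma distinguishedI:
  assumes "cone_ext A X Y K F a b a' b'" "hinv K Z q c"
  shows "\<exists>u v w. (X, Y, Z, u, v, w) \<in> Distinguished (Kb A)"
proof -
  interpret C: cone_ext A X Y K F a b a' b' by fact
  note X = C.X and Y = C.Y and K = C.K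
  have cm: "chain_map K Z q" "chain_map Z K c" "homotopic K K (c * q) (E (obj K))"
    using assms(2) by (auto simp: hinv_def)
  have Z: "Z \<in> bc"
    using cm chain_map_bc by blast
  have F: "chain_map X Y F"
    by (simp add: chain_map_def X Y C.f C.Df)
  have "D (sh X) * (susp X * a') = - (susp X * (D X * ((desusp X * susp X) * a')))"
    by (simp add: D_sh[OF X] mult.assoc)
  also have "\<dots> = susp X * a' * D K"
    by (simp add: desusp_susp[OF X] C.units C.a'D mult.assoc)
  finally have p: "chain_map K (sh X) (susp X * a')"
    using graded_hom_mult[OF C.a' susp_in[OF X], of 0] by (simp add: chain_map_def K sh_bc X)
  obtain \<iota> \<pi> where mc: "mapping_cone A X Y (components X Y F) K \<iota> \<pi>"
    and io: "\<And>n. \<iota> n 1 = components Y K b n" and pr: "\<And>n. \<pi> n 0 = components K (sh X) (susp X * a') n"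
    using mapping_coneI[OF assms(1)] by metis
  let ?H = "homotopy_category A"
  \<comment> \<open>The maps at \<open>Z\<close> are forced by commutation: into \<open>Z\<close>
    through \<open>q\<close>, out of \<open>Z\<close> through its homotopy inverse
    \<open>c\<close>.\<close>
  define u v w where "u = hclass X Y F" and "v = hclass Y Z (q * b)" and "w = hclass Z (sh X) (susp X * a' * c)"
  have st: "(X, Y, K, hclass X Y F, hclass Y K b, hclass K (sh X) (susp X * a')) \<in> standard_triangles A"
    using X Y mc components_chain_maps[OF F] unfolding standard_triangles_def mem_Collect_eq
    by - (rule exI[of _ X], rule exI[of _ Y], rule exI[of _ "components X Y F"], rule exI[of _ K],
        rule exI[of _ \<iota>], rule exI[of _ \<pi>], simp add: io[simplified] pr hclass_def)
  have isos: "is_iso ?H X X (hclass X X (E (obj X)))" "is_iso ?H Y Y (hclass Y Y (E (obj Y)))" "is_iso ?H Z K (hclass Z K c)"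
    using X Y Z K hinv_sym[OF assms(2)] hinv_E by (auto simp: is_iso_H_iff)
  have bq: "homotopic Y K (c * (q * b)) b"
    using homotopic_mult_right[OF cm(3) C.b_chain_map] by (simp add: C.units mult.assoc)
  have "Comp ?H X X Y (hclass X Y F) (hclass X X (E (obj X))) = Comp ?H X Y Y (hclass Y Y (E (obj Y))) u"
    using F by (simp add: u_def Comp_H chain_map_E X Y C.units)
  moreover have "Comp ?H Y Y K (hclass Y K b) (hclass Y Y (E (obj Y))) = Comp ?H Y Z K (hclass Z K c) v"
    using hclass_eq_iff[OF chain_map_mult[OF chain_map_mult[OF C.b_chain_map cm(1)] cm(2)] C.b_chain_map] bq
    by (simp add: v_def Comp_H chain_map_E Y C.b_chain_map cm chain_map_mult[OF C.b_chain_map cm(1)] C.units)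
  moreover have "Comp ?H Z K (sh X) (hclass K (sh X) (susp X * a')) (hclass Z K c) =
    Comp ?H Z (sh X) (sh X) (shift_mor A X X (hclass X X (E (obj X)))) w"
    using E_left[OF chain_map_graded_hom[OF chain_map_mult[OF cm(2) p]]]
    by (simp add: w_def shift_mor_E[OF X] Comp_H cm p chain_map_mult[OF cm(2) p] chain_map_E sh_bc X)
  moreover have "u \<in> Hom ?H X Y" "v \<in> Hom ?H Y Z" "w \<in> Hom ?H Z (sh X)"
    using F chain_map_mult[OF C.b_chain_map cm(1)] chain_map_mult[OF cm(2) p] X Y Z sh_bc[OF X]
    by (auto simp: u_def v_def w_def Hom_H)
  ultimately have "(X, Y, Z, u, v, w) \<in> Kb_triangles A"
    using st isos X Y Z unfolding Kb_triangles_def Let_def mem_Collect_eq case_prod_conv Ob_H by blast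
  then show ?thesis
    by (auto simp: Distinguished_Kb)
qed

text \<open>The morphisms of the triangle may be forgotten, since extension-closure concerns objects
  and the cone retains the connecting morphism \<open>a'\<close>.\<close>

lemma distinguishedE:
  assumes "(X, Y, Z, u, v, w) \<in> Distinguished (Kb A)"
  obtains X' Y' K f a b a' b' where "cone_ext A X' Y' K f a b a' b'" "heqv X X'" "heqv Y Y'" "heqv Z K"
proof -
  let ?H = "homotopy_category A"
  obtain X' Y' K u' v' w' \<alpha> \<beta> \<gamma> where bc: "X \<in> bc" "Y \<in> bc" "Z \<in> bc"
    and st: "(X', Y', K, u', v', w') \<in> standard_triangles A"
    and iso: "is_iso ?H X X' \<alpha>" "is_iso ?H Y Y' \<beta>" "is_iso ?H Z K \<gamma>"
    using assms unfolding Distinguished_Kb Kb_triangles_def Let_def mem_Collect_eq case_prod_conv Ob_H by blast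
  obtain f \<iota> \<pi> where "X' \<in> bc" "Y' \<in> bc" "f \<in> chain_maps A X' Y'" "mapping_cone A X' Y' f K \<iota> \<pi>"
    using st unfolding standard_triangles_def by blast
  then obtain f a b a' b' where c: "cone_ext A X' Y' K f a b a' b'"
    using mapping_coneD(1) by blast
  then have "X' \<in> bc" "Y' \<in> bc" "K \<in> bc"
    by (auto dest: cone_ext.X cone_ext.Y cone_ext.K)
  then have "heqv X X'" "heqv Y Y'" "heqv Z K"
    using iso bc by (auto simp: is_iso_H_iff heqv_def)
  with c show thesis
    by (rule that)
qed

end

context addit
begin

lemma ex_dsum:
  assumes "\<And>j. j \<in> {1..n} \<Longrightarrow> X j \<in> Ob A"
  obtains P \<iota> \<pi> where "dsum {1..n::nat} X P \<iota> \<pi>"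
proof -
  have "\<exists>P \<iota> \<pi>. is_direct_sum A {..<n} (\<lambda>j. X (Suc j)) P \<iota> \<pi>"
    by (rule direct_sums) (use assms in auto)
  then obtain P \<iota> \<pi> where "dsum {..<n} (\<lambda>j. X (Suc j)) P \<iota> \<pi>"
    using is_direct_sum_imp_dsum finite_lessThan by blast
  then have *: "dsum {..<n} (\<lambda>j. X (Suc j)) P \<iota> \<pi>" .
  have im: "{1..n} = Suc ` {..<n}"
    by (auto simp: image_Suc_lessThan)
  have "dsum {1..n} X P (\<lambda>j. \<iota> (j - 1)) (\<lambda>j. \<pi> (j - 1))"
    unfolding im using * by (auto simp: dsum_def sum.reindex)
  then show thesis
    by (rule that)
qed

abbreviation z where "z \<equiv> zero_ob A"

lemma zero_ob: "z \<in> Ob A" "e z = 0"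
proof -
  \<comment> \<open>In an empty direct sum the completeness relation reads
    \<open>0 = e P\<close>.\<close>
  obtain P \<iota> \<pi> where "dsum {1..0::nat} (\<lambda>_. undefined) P \<iota> \<pi>"
    by (rule ex_dsum[of 0 "\<lambda>_. undefined"]) auto
  then have "is_zero_object A P"
    by (simp add: dsum_def is_zero_object_iff)
  then have "is_zero_object A z"
    unfolding zero_ob_def by (rule someI)
  then show "z \<in> Ob A" "e z = 0"
    by (simp_all add: is_zero_object_iff)
qed

section \<open>Two-term complexes\<close>

text \<open>Calculus of operators between two-term complexes: \<open>deg0\<close> holds a pair of
  morphisms in degrees \<open>-1\<close> and \<open>0\<close>, \<open>deg1\<close> a morphism from
  degree \<open>-1\<close> to degree \<open>0\<close>.\<close>

definition deg0 where "deg0 a b = graded 0 (\<lambda>m. if m = -1 then a else if m = 0 then b else 0)"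
definition deg1 where "deg1 a = graded 1 (\<lambda>m. if m = -1 then a else 0)"

lemma deg0_deg1_simps:
  "deg0 a b * deg0 c d = deg0 (a * c) (b * d)" "deg1 a * deg0 c d = deg1 (a * c)" "deg0 a b * deg1 c = deg1 (b * c)"
  "deg0 a b + deg0 c d = deg0 (a + c) (b + d)" "deg1 a + deg1 c = deg1 (a + c)"
  by (simp_all add: deg0_def deg1_def graded_mult graded_add graded_inject fun_eq_iff)

lemma deg0_deg1_zero: "deg0 0 0 = 0" "deg1 0 = 0" "deg1 a * deg1 b = 0"
proof -
  have "deg0 0 0 = graded 0 (\<lambda>_. 0)" "deg1 0 = graded 1 (\<lambda>_. 0)" "deg1 a * deg1 b = graded 2 (\<lambda>_. 0)"
    by (simp_all add: deg0_def deg1_def graded_mult graded_inject fun_eq_iff)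
  then show "deg0 0 0 = 0" "deg1 0 = 0" "deg1 a * deg1 b = 0"
    by (simp_all add: graded_zero)
qed

lemma obj_cone: "obj (cone A P Q M) n = (if n = -1 then P else if n = 0 then Q else z)"
  by (simp add: cone_def Let_def)

lemma D_cone: "\<lbrakk>P \<in> Ob A; Q \<in> Ob A\<rbrakk> \<Longrightarrow> D (cone A P Q M) = deg1 (emb P Q M)"
  using zero_ob by (auto simp: D_def deg1_def cone_def Let_def graded_inject fun_eq_iff emb_Zero)

lemma E_cone: "E (obj (cone A P Q M)) = deg0 (e P) (e Q)"
  by (auto simp: E_def deg0_def obj_cone zero_ob graded_inject fun_eq_iff)

lemma cone_bc:
  assumes "P \<in> Ob A" "Q \<in> Ob A" "M \<in> Hom A P Q"
  shows "cone A P Q M \<in> bc"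
proof -
  have "bounded (obj (cone A P Q M))"
    unfolding bounded_def by (rule exI[of _ 1]) (auto simp: obj_cone zero_ob)
  then show ?thesis
    using assms zero_ob Zero_in by (auto simp: bc_iff D_cone deg0_deg1_zero) (auto simp: cone_def Let_def)
qed

lemma deg0_in: "\<lbrakk>a \<in> emb_hom P P'; b \<in> emb_hom Q Q'\<rbrakk> \<Longrightarrow> deg0 a b \<in> graded_hom 0 (obj (cone A P Q M)) (obj (cone A P' Q' M'))"
  unfolding deg0_def by (rule graded_homI) (simp add: obj_cone emb_hom_zero zero_ob)

lemma deg1_in: "\<lbrakk>a \<in> emb_hom P Q'; Q \<in> Ob A; P' \<in> Ob A\<rbrakk> \<Longrightarrow> deg1 a \<in> graded_hom 1 (obj (cone A P Q M)) (obj (cone A P' Q' M'))"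
  unfolding deg1_def by (rule graded_homI) (auto simp: obj_cone emb_hom_zero zero_ob)

text \<open>A map from degree \<open>n\<close> to \<open>n + 1\<close> has zero target for
  \<open>n = 0\<close> and zero source for the remaining \<open>n\<close> other than
  \<open>-1\<close>. So a connecting morphism of two-term complexes is a single block.\<close>

lemma degree1_cone:
  assumes "F \<in> graded_hom 1 (obj (cone A P Q M)) (obj (cone A P' Q' M'))"
  obtains a where "a \<in> emb_hom P Q'" "F = deg1 a"
proof -
  obtain g where g: "F = graded 1 g" "\<And>n. g n \<in> emb_hom (obj (cone A P Q M) n) (obj (cone A P' Q' M') (n + 1))"
    using assms by (blast elim: graded_homE)
  have "g n = 0" if "n \<noteq> -1" for n
  proof (cases "n = 0")
    case True
    then show ?thesis
      using e_left[OF g(2)[of n]] by (simp add: obj_cone zero_ob)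
  next
    case False
    then show ?thesis
      using e_right[OF g(2)[of n]] that by (simp add: obj_cone zero_ob)
  qed
  then have "F = deg1 (g (-1))"
    unfolding g(1) by (auto simp: deg1_def graded_inject fun_eq_iff)
  then show thesis
    using g(2)[of "-1"] by (intro that[of "g (-1)"]) (simp_all add: obj_cone)
qed

definition biproduct where
  "biproduct X Z P i t r p \<longleftrightarrow> i \<in> emb_hom X P \<and> t \<in> emb_hom Z P \<and> r \<in> emb_hom P X \<and> p \<in> emb_hom P Z \<and>
    r * i = e X \<and> p * t = e Z \<and> r * t = 0 \<and> p * i = 0 \<and> i * r + t * p = e P"

text \<open>\<open>Mi\<close> and \<open>pM\<close> state that \<open>M\<close> is block triangular
  with diagonal blocks \<open>x\<close> and \<open>y\<close>; the remaining block is the connecting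
  morphism. This serves both for cutting a matrix and for assembling one.\<close>

lemma split_cone:
  assumes P: "biproduct X1 Z1 P iP tP rP pP" and Q: "biproduct X0 Z0 Q iQ tQ rQ pQ"
    and x: "x \<in> Hom A X1 X0" and y: "y \<in> Hom A Z1 Z0" and M: "M \<in> Hom A P Q"
    and Mi: "emb P Q M * iP = iQ * emb X1 X0 x" and pM: "pQ * emb P Q M = emb Z1 Z0 y * pP"
  shows "split_ext A (cone A X1 X0 x) (cone A Z1 Z0 y) (cone A P Q M)
    (deg0 iP iQ) (deg0 tP tQ) (deg0 rP rQ) (deg0 pP pQ) (deg1 (rQ * emb P Q M * tP))"
proof -
  have emb_hom: "iP \<in> emb_hom X1 P" "tP \<in> emb_hom Z1 P" "rP \<in> emb_hom P X1" "pP \<in> emb_hom P Z1"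
    "iQ \<in> emb_hom X0 Q" "tQ \<in> emb_hom Z0 Q" "rQ \<in> emb_hom Q X0" "pQ \<in> emb_hom Q Z0"
    using P Q by (auto simp: biproduct_def)
  have Ob: "X1 \<in> Ob A" "Z1 \<in> Ob A" "P \<in> Ob A" "X0 \<in> Ob A" "Z0 \<in> Ob A" "Q \<in> Ob A"
    using emb_hom emb_hom_Ob by blast+
  define w where "w = rQ * emb P Q M * tP"
  have w: "w \<in> emb_hom Z1 X0"
    unfolding w_def by (rule emb_hom_mult[OF emb_hom(2) emb_hom_mult[OF emb_emb_hom[OF Ob(3,6) M] emb_hom(7)]])
  \<comment> \<open>Expanding the identity of \<open>Q\<close> splits this block column of
    \<open>M\<close> into its two entries.\<close>
  have "emb P Q M * tP = (iQ * rQ + tQ * pQ) * emb P Q M * tP"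
    using Q e_left[OF emb_emb_hom[OF Ob(3,6) M]] by (simp add: biproduct_def)
  also have "\<dots> = iQ * w + tQ * (pQ * emb P Q M) * tP"
    by (simp add: w_def algebra_simps)
  also have "\<dots> = iQ * w + tQ * (emb Z1 Z0 y * (pP * tP))"
    by (simp add: pM mult.assoc)
  also have "pP * tP = e Z1"
    using P by (simp add: biproduct_def)
  also have "emb Z1 Z0 y * e Z1 = emb Z1 Z0 y"
    by (rule e_right[OF emb_emb_hom[OF Ob(2,5) y]])
  finally have Mt: "emb P Q M * tP = iQ * w + tQ * emb Z1 Z0 y" .
  show ?thesis
    unfolding w_def[symmetric] using P Q
    by unfold_locales
      (simp_all add: cone_bc deg0_in deg1_in E_cone D_cone deg0_deg1_simps deg0_deg1_zero biproduct_def emb_hom Ob x y M Mi Mt w)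
qed

section \<open>Triangular matrices\<close>

text \<open>\<open>k\<close> is the column and \<open>l\<close> the row: only the entries on and
  above the diagonal are prescribed, so the arbitrary entries below it need no names.\<close>

definition triangular :: "('o \<times> 'o \<times> 'm) set \<Rightarrow> nat \<Rightarrow> 'o \<Rightarrow> 'o \<Rightarrow> 'm \<Rightarrow> bool" where
  "triangular S n P Q M \<longleftrightarrow> M \<in> Hom A P Q \<and> (\<exists>S1 S0 s \<iota> \<pi> \<iota>' \<pi>'.
     (\<forall>j\<in>{1..n}. (S1 j, S0 j, s j) \<in> S) \<and> dsum {1..n} S1 P \<iota> \<pi> \<and> dsum {1..n} S0 Q \<iota>' \<pi>' \<and>
     (\<forall>k\<in>{1..n}. \<forall>l\<in>{1..n}. l \<le> k \<longrightarrow>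
        \<pi>' l * emb P Q M * \<iota> k = (if k = l then emb (S1 k) (S0 k) (s k) else 0)))"

lemma triangular_iff:
  assumes S: "S \<subseteq> arrows A"
  shows "triangular S n P Q M \<longleftrightarrow> (\<exists>S1 S0 s f \<iota>P \<pi>P \<iota>Q \<pi>Q.
       (\<forall>j\<in>{1..n}. (S1 j, S0 j, s j) \<in> S) \<and>
       (\<forall>k\<in>{1..n}. \<forall>l\<in>{1..n}. k < l \<longrightarrow> f k l \<in> Hom A (S1 k) (S0 l)) \<and>
       is_direct_sum A {1..n} S1 P \<iota>P \<pi>P \<and>
       is_direct_sum A {1..n} S0 Q \<iota>Q \<pi>Q \<and>
       given_by_matrix A {1..n} S1 P \<iota>P {1..n} S0 Q \<pi>Q
         (\<lambda>k l. if k = l then s k else if k < l then f k l else Zero A (S1 k) (S0 l)) M)"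
    (is "_ \<longleftrightarrow> (\<exists>S1 S0 s f \<iota>P \<pi>P \<iota>Q \<pi>Q. ?R S1 S0 s f \<iota>P \<pi>P \<iota>Q \<pi>Q)")
proof
  assume "triangular S n P Q M"
  then obtain S1 S0 s \<iota> \<pi> \<iota>' \<pi>' where M: "M \<in> Hom A P Q" and s: "\<forall>j\<in>{1..n}. (S1 j, S0 j, s j) \<in> S"
    and P: "dsum {1..n} S1 P \<iota> \<pi>" and Q: "dsum {1..n} S0 Q \<iota>' \<pi>'"
    and m': "\<forall>k\<in>{1..n}. \<forall>l\<in>{1..n}. l \<le> k \<longrightarrow>
        \<pi>' l * emb P Q M * \<iota> k = (if k = l then emb (S1 k) (S0 k) (s k) else 0)"
    unfolding triangular_def by (elim conjE exE) (rule that)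
  note m = m'[rule_format]
  have Ob: "P \<in> Ob A" "Q \<in> Ob A" "\<And>k. k \<in> {1..n} \<Longrightarrow> S1 k \<in> Ob A" "\<And>k. k \<in> {1..n} \<Longrightarrow> S0 k \<in> Ob A"
    and io: "\<And>k. k \<in> {1..n} \<Longrightarrow> \<iota> k \<in> emb_hom (S1 k) P" "\<And>l. l \<in> {1..n} \<Longrightarrow> \<pi>' l \<in> emb_hom Q (S0 l)"
    using P Q by (auto simp: dsum_def)
  have sh: "s j \<in> Hom A (S1 j) (S0 j)" if "j \<in> {1..n}" for j
    using s S that by (auto simp: arrows_def)
  \<comment> \<open>The unprescribed entries are read off from \<open>M\<close>.\<close>
  define f where "f = (\<lambda>k l. unemb (S1 k) (S0 l) (\<pi>' l * emb P Q M * \<iota> k))"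
  have emb_hom: "\<pi>' l * emb P Q M * \<iota> k \<in> emb_hom (S1 k) (S0 l)" if "k \<in> {1..n}" "l \<in> {1..n}" for k l
    using emb_hom_mult[OF io(1) emb_hom_mult[OF emb_emb_hom[OF Ob(1,2) M] io(2)]] that by blast
  have f: "f k l \<in> Hom A (S1 k) (S0 l)" "emb (S1 k) (S0 l) (f k l) = \<pi>' l * emb P Q M * \<iota> k"
    if "k \<in> {1..n}" "l \<in> {1..n}" for k l
    using unemb[OF emb_hom[OF that]] by (simp_all add: f_def)
  have "given_by_matrix A {1..n} S1 P (\<lambda>i. unemb (S1 i) P (\<iota> i)) {1..n} S0 Q (\<lambda>i. unemb Q (S0 i) (\<pi>' i))
         (\<lambda>k l. if k = l then s k else if k < l then f k l else Zero A (S1 k) (S0 l)) M"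
    by (subst given_by_matrix_iff[OF Ob(1,2) M])
      (auto simp: Ob sh f unemb_in[OF io(1)] unemb_in[OF io(2)] emb_unemb[OF io(1)] emb_unemb[OF io(2)] Zero_in emb_Zero m)
  then have "?R S1 S0 s f (\<lambda>i. unemb (S1 i) P (\<iota> i)) (\<lambda>i. unemb P (S1 i) (\<pi> i))
    (\<lambda>i. unemb (S0 i) Q (\<iota>' i)) (\<lambda>i. unemb Q (S0 i) (\<pi>' i))"
    using s f(1) is_direct_sum_unemb[OF _ P] is_direct_sum_unemb[OF _ Q] by simp
  then show "\<exists>S1 S0 s f \<iota>P \<pi>P \<iota>Q \<pi>Q. ?R S1 S0 s f \<iota>P \<pi>P \<iota>Q \<pi>Q"
    by (intro exI)
next
  assume "\<exists>S1 S0 s f \<iota>P \<pi>P \<iota>Q \<pi>Q. ?R S1 S0 s f \<iota>P \<pi>P \<iota>Q \<pi>Q"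
  then obtain S1 S0 s f \<iota> \<pi> \<iota>' \<pi>' where s: "\<forall>j\<in>{1..n}. (S1 j, S0 j, s j) \<in> S"
    and f: "\<forall>k\<in>{1..n}. \<forall>l\<in>{1..n}. k < l \<longrightarrow> f k l \<in> Hom A (S1 k) (S0 l)"
    and P: "is_direct_sum A {1..n} S1 P \<iota> \<pi>" and Q: "is_direct_sum A {1..n} S0 Q \<iota>' \<pi>'"
    and m: "given_by_matrix A {1..n} S1 P \<iota> {1..n} S0 Q \<pi>'
         (\<lambda>k l. if k = l then s k else if k < l then f k l else Zero A (S1 k) (S0 l)) M"
    by (elim conjE exE) (rule that)
  have sh: "s j \<in> Hom A (S1 j) (S0 j)" if "j \<in> {1..n}" for j
    using s S that by (auto simp: arrows_def)
  have dsum: "dsum {1..n} S1 P (\<lambda>i. emb (S1 i) P (\<iota> i)) (\<lambda>i. emb P (S1 i) (\<pi> i))"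
    "dsum {1..n} S0 Q (\<lambda>i. emb (S0 i) Q (\<iota>' i)) (\<lambda>i. emb Q (S0 i) (\<pi>' i))"
    using P Q by (simp_all add: is_direct_sum_imp_dsum)
  then have Ob: "P \<in> Ob A" "Q \<in> Ob A" "\<And>k. k \<in> {1..n} \<Longrightarrow> S1 k \<in> Ob A" "\<And>k. k \<in> {1..n} \<Longrightarrow> S0 k \<in> Ob A"
    by (auto simp: dsum_def)
  have io: "\<And>k. k \<in> {1..n} \<Longrightarrow> \<iota> k \<in> Hom A (S1 k) P" "\<And>l. l \<in> {1..n} \<Longrightarrow> \<pi>' l \<in> Hom A Q (S0 l)"
    using P Q by (simp_all add: is_direct_sum_iff)
  have M: "M \<in> Hom A P Q"
    using m by (simp add: given_by_matrix_def)
  let ?m = "\<lambda>k l. if k = l then s k else if k < l then f k l else Zero A (S1 k) (S0 l)"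
  have "\<forall>k\<in>{1..n}. \<forall>l\<in>{1..n}. emb Q (S0 l) (\<pi>' l) * emb P Q M * emb (S1 k) P (\<iota> k) = emb (S1 k) (S0 l) (?m k l)"
  proof (rule iffD1[OF given_by_matrix_iff m])
    show "?m k l \<in> Hom A (S1 k) (S0 l)" if "k \<in> {1..n}" "l \<in> {1..n}" for k l
      using that f sh Ob Zero_in by auto
  qed (use Ob io M in auto)
  then have "\<forall>k\<in>{1..n}. \<forall>l\<in>{1..n}. l \<le> k \<longrightarrow>
    emb Q (S0 l) (\<pi>' l) * emb P Q M * emb (S1 k) P (\<iota> k) = (if k = l then emb (S1 k) (S0 k) (s k) else 0)"
    using Ob by (auto simp: emb_Zero)
  with M s dsum show "triangular S n P Q M"
    unfolding triangular_def by (intro conjI exI)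
qed

text \<open>The last summand is made the subobject because the last column of a lower triangular
  matrix has only its diagonal entry, so the last summands form a subcomplex. \<open>P'\<close> is
  any sum of the others; \<open>t\<close> and \<open>p\<close> compare it with
  \<open>P\<close>.\<close>

lemma dsum_peel:
  assumes P: "dsum {1..Suc n} X P \<iota> \<pi>" and P': "dsum {1..n} X P' \<iota>' \<pi>'"
  obtains t p where "biproduct (X (Suc n)) P' P (\<iota> (Suc n)) t (\<pi> (Suc n)) p"
    "\<And>l. l \<in> {1..n} \<Longrightarrow> \<pi>' l * p = \<pi> l" "\<And>k. k \<in> {1..n} \<Longrightarrow> t * \<iota>' k = \<iota> k"
proof -
  define t where "t = (\<Sum>j\<in>{1..n}. \<iota> j * \<pi>' j)"
  define p where "p = (\<Sum>j\<in>{1..n}. \<iota>' j * \<pi> j)"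
  have emb_hom: "\<And>j. j \<in> {1..Suc n} \<Longrightarrow> \<iota> j \<in> emb_hom (X j) P" "\<And>j. j \<in> {1..Suc n} \<Longrightarrow> \<pi> j \<in> emb_hom P (X j)"
    "\<And>j. j \<in> {1..n} \<Longrightarrow> \<iota>' j \<in> emb_hom (X j) P'" "\<And>j. j \<in> {1..n} \<Longrightarrow> \<pi>' j \<in> emb_hom P' (X j)"
    and Ob: "P \<in> Ob A" "P' \<in> Ob A"
    using P P' by (auto simp: dsum_def)
  have pi: "\<And>i j. i \<in> {1..Suc n} \<Longrightarrow> j \<in> {1..Suc n} \<Longrightarrow> \<pi> j * \<iota> i = (if i = j then e (X i) else 0)"
    "\<And>i j. i \<in> {1..n} \<Longrightarrow> j \<in> {1..n} \<Longrightarrow> \<pi>' j * \<iota>' i = (if i = j then e (X i) else 0)"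
    and one: "(\<Sum>i\<in>{1..Suc n}. \<iota> i * \<pi> i) = e P" "(\<Sum>i\<in>{1..n}. \<iota>' i * \<pi>' i) = e P'"
    using P P' unfolding dsum_def by blast+
  have t: "t \<in> emb_hom P' P" and p: "p \<in> emb_hom P P'"
    unfolding t_def p_def by (auto intro!: emb_hom_sum Ob emb_hom_mult[OF emb_hom(4,1)] emb_hom_mult[OF emb_hom(2,3)])
  have pp: "\<pi>' l * p = \<pi> l" if l: "l \<in> {1..n}" for l
  proof -
    have "\<pi>' l * p = (\<Sum>j\<in>{1..n}. if j = l then \<pi> l else 0)"
      unfolding p_def sum_distrib_left using l emb_hom(2)[of l]
      by (intro sum.cong[OF refl]) (auto simp: pi mult.assoc[symmetric] e_left)
    then show ?thesis
      using l by simp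
  qed
  have tt: "t * \<iota>' k = \<iota> k" if k: "k \<in> {1..n}" for k
  proof -
    have "t * \<iota>' k = (\<Sum>j\<in>{1..n}. if j = k then \<iota> k else 0)"
      unfolding t_def sum_distrib_right using k emb_hom(1)[of k]
      by (intro sum.cong[OF refl]) (auto simp: pi mult.assoc e_right)
    then show ?thesis
      using k by simp
  qed
  have "p * t = (\<Sum>j\<in>{1..n}. p * (\<iota> j * \<pi>' j))"
    by (simp add: t_def sum_distrib_left)
  also have "\<dots> = (\<Sum>j\<in>{1..n}. \<iota>' j * \<pi>' j)"
  proof (rule sum.cong[OF refl])
    fix j assume j: "j \<in> {1..n}"
    have "p * \<iota> j = (\<Sum>i\<in>{1..n}. if i = j then \<iota>' j else 0)"
      unfolding p_def sum_distrib_right using j emb_hom(3)[of j]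
      by (intro sum.cong[OF refl]) (auto simp: pi mult.assoc e_right)
    then show "p * (\<iota> j * \<pi>' j) = \<iota>' j * \<pi>' j"
      using j by (simp flip: mult.assoc)
  qed
  finally have pt: "p * t = e P'"
    using one by simp
  have "t * p = (\<Sum>j\<in>{1..n}. t * \<iota>' j * \<pi> j)"
    by (simp add: p_def sum_distrib_left mult.assoc)
  also have "\<dots> = (\<Sum>j\<in>{1..n}. \<iota> j * \<pi> j)"
    using tt by (intro sum.cong) auto
  finally have "\<iota> (Suc n) * \<pi> (Suc n) + t * p = e P"
    using one(1) by (simp add: add.commute)
  moreover have "\<pi> (Suc n) * t = 0" "p * \<iota> (Suc n) = 0"
    unfolding t_def p_def sum_distrib_left sum_distrib_right
    by (auto intro!: sum.neutral simp: mult.assoc[symmetric] pi) (auto simp: mult.assoc pi)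
  ultimately have "biproduct (X (Suc n)) P' P (\<iota> (Suc n)) t (\<pi> (Suc n)) p"
    using emb_hom t p pt pi by (simp add: biproduct_def)
  then show thesis
    using pp tt by (rule that)
qed

text \<open>The summands of the quotient \<open>P\<close> are numbered before those of the subobject
  \<open>Q\<close>, in accordance with \<open>dsum_peel\<close>.\<close>

lemma dsum_append:
  assumes X: "dsum {1..m::nat} X P \<iota> \<pi>" and Y: "dsum {1..n} Y Q \<iota>' \<pi>'" and R: "biproduct Q P R i t r p"
  shows "dsum {1..m + n} (\<lambda>j. if j \<le> m then X j else Y (j - m)) R
    (\<lambda>j. if j \<le> m then t * \<iota> j else i * \<iota>' (j - m)) (\<lambda>j. if j \<le> m then \<pi> j * p else \<pi>' (j - m) * r)"
    (is "dsum _ ?Z R ?\<iota> ?\<pi>")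
proof -
  have R: "i \<in> emb_hom Q R" "t \<in> emb_hom P R" "r \<in> emb_hom R Q" "p \<in> emb_hom R P"
    "r * i = e Q" "p * t = e P" "r * t = 0" "p * i = 0" "i * r + t * p = e R"
    using R by (simp_all add: biproduct_def)
  have emb_hom: "\<And>j. j \<in> {1..m} \<Longrightarrow> \<iota> j \<in> emb_hom (X j) P" "\<And>j. j \<in> {1..m} \<Longrightarrow> \<pi> j \<in> emb_hom P (X j)"
    "\<And>j. j \<in> {1..n} \<Longrightarrow> \<iota>' j \<in> emb_hom (Y j) Q" "\<And>j. j \<in> {1..n} \<Longrightarrow> \<pi>' j \<in> emb_hom Q (Y j)"
    using X Y by (auto simp: dsum_def)
  have pi: "\<And>i j. i \<in> {1..m} \<Longrightarrow> j \<in> {1..m} \<Longrightarrow> \<pi> j * \<iota> i = (if i = j then e (X i) else 0)"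
    "\<And>i j. i \<in> {1..n} \<Longrightarrow> j \<in> {1..n} \<Longrightarrow> \<pi>' j * \<iota>' i = (if i = j then e (Y i) else 0)"
    and one: "(\<Sum>i\<in>{1..m}. \<iota> i * \<pi> i) = e P" "(\<Sum>i\<in>{1..n}. \<iota>' i * \<pi>' i) = e Q"
    using X Y unfolding dsum_def by blast+
  have "?\<iota> j \<in> emb_hom (?Z j) R \<and> ?\<pi> j \<in> emb_hom R (?Z j)" if "j \<in> {1..m + n}" for j
  proof (cases "j \<le> m")
    case True
    then show ?thesis
      using that emb_hom_mult[OF emb_hom(1) R(2)] emb_hom_mult[OF R(4) emb_hom(2)] by simp
  next
    case False
    then have "j - m \<in> {1..n}"
      using that by auto
    then show ?thesis
      using False emb_hom_mult[OF emb_hom(3) R(1)] emb_hom_mult[OF R(3) emb_hom(4)] by simp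
  qed
  moreover have "?\<pi> l * ?\<iota> k = (if k = l then e (?Z k) else 0)" if "k \<in> {1..m + n}" "l \<in> {1..m + n}" for k l
  proof -
    have mid: "?\<pi> l * ?\<iota> k = (if l \<le> m then if k \<le> m then \<pi> l * ((p * t) * \<iota> k) else \<pi> l * ((p * i) * \<iota>' (k - m))
      else if k \<le> m then \<pi>' (l - m) * ((r * t) * \<iota> k) else \<pi>' (l - m) * ((r * i) * \<iota>' (k - m)))"
      by (simp add: mult.assoc)
    have k: "k \<in> {1..m} \<or> \<not> k \<le> m \<and> k - m \<in> {1..n}" and l: "l \<in> {1..m} \<or> \<not> l \<le> m \<and> l - m \<in> {1..n}"
      using that by auto
    have "\<not> k \<le> m \<Longrightarrow> \<not> l \<le> m \<Longrightarrow> k - m = l - m \<longleftrightarrow> k = l"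
      by auto
    with k l show ?thesis
      unfolding mid R(5-8) by (elim disjE conjE) (simp_all add: pi e_left[OF emb_hom(1)] e_left[OF emb_hom(3)])
  qed
  moreover have "(\<Sum>j\<in>{1..m + n}. ?\<iota> j * ?\<pi> j) = e R"
  proof -
    have "(\<Sum>j\<in>{1..m + n}. ?\<iota> j * ?\<pi> j) = (\<Sum>j\<in>{1..m}. ?\<iota> j * ?\<pi> j) + (\<Sum>j\<in>{m + 1..m + n}. ?\<iota> j * ?\<pi> j)"
      by (rule sum.ub_add_nat) simp
    also have "(\<Sum>j\<in>{1..m}. ?\<iota> j * ?\<pi> j) = t * (\<Sum>j\<in>{1..m}. \<iota> j * \<pi> j) * p"
      by (simp add: sum_distrib_left sum_distrib_right mult.assoc)
    also have "(\<Sum>j\<in>{m + 1..m + n}. ?\<iota> j * ?\<pi> j) = (\<Sum>j\<in>{1..n}. ?\<iota> (j + m) * ?\<pi> (j + m))"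
      using sum.shift_bounds_cl_nat_ivl[of "\<lambda>j. ?\<iota> j * ?\<pi> j" 1 m n] by (simp add: add.commute)
    also have "\<dots> = i * (\<Sum>j\<in>{1..n}. \<iota>' j * \<pi>' j) * r"
      unfolding sum_distrib_left sum_distrib_right by (intro sum.cong[OF refl]) (simp add: mult.assoc)
    finally show ?thesis
      using R(9) e_right[OF R(2)] e_right[OF R(1)] one by (simp add: add.commute)
  qed
  moreover have "?Z j \<in> Ob A" if "j \<in> {1..m + n}" for j
    using calculation(1)[OF that] emb_hom_Ob by blast
  moreover have "R \<in> Ob A"
    using R(1) emb_hom_Ob by blast
  ultimately show ?thesis
    unfolding dsum_def by blast
qed

text \<open>The block of the quotient stands first. \<open>M0\<close> is the vanishing upper right
  block, from the subobject of \<open>P\<close> to the quotient of \<open>Q\<close>; the lower left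
  block is arbitrary.\<close>

lemma triangular_append:
  assumes "triangular S m P2 Q2 M2" "triangular S n P1 Q1 M1"
    and P: "biproduct P1 P2 P iP tP rP pP" and Q: "biproduct Q1 Q2 Q iQ tQ rQ pQ" and M: "M \<in> Hom A P Q"
    and M1: "rQ * emb P Q M * iP = emb P1 Q1 M1" and M2: "pQ * emb P Q M * tP = emb P2 Q2 M2"
    and M0: "pQ * emb P Q M * iP = 0"
  shows "triangular S (m + n) P Q M"
proof -
  obtain S1 S0 s \<iota> \<pi> \<iota>' \<pi>' where s: "\<forall>j\<in>{1..m}. (S1 j, S0 j, s j) \<in> S"
    and d: "dsum {1..m} S1 P2 \<iota> \<pi>" "dsum {1..m} S0 Q2 \<iota>' \<pi>'"
    and m: "\<forall>k\<in>{1..m}. \<forall>l\<in>{1..m}. l \<le> k \<longrightarrow>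
        \<pi>' l * emb P2 Q2 M2 * \<iota> k = (if k = l then emb (S1 k) (S0 k) (s k) else 0)"
    using assms(1) unfolding triangular_def by (elim conjE exE) (rule that)
  obtain T1 T0 t \<kappa> \<rho> \<kappa>' \<rho>' where t: "\<forall>j\<in>{1..n}. (T1 j, T0 j, t j) \<in> S"
    and d': "dsum {1..n} T1 P1 \<kappa> \<rho>" "dsum {1..n} T0 Q1 \<kappa>' \<rho>'"
    and m': "\<forall>k\<in>{1..n}. \<forall>l\<in>{1..n}. l \<le> k \<longrightarrow>
        \<rho>' l * emb P1 Q1 M1 * \<kappa> k = (if k = l then emb (T1 k) (T0 k) (t k) else 0)"
    using assms(2) unfolding triangular_def by (elim conjE exE) (rule that)
  let ?S1 = "\<lambda>j. if j \<le> m then S1 j else T1 (j - m)" and ?S0 = "\<lambda>j. if j \<le> m then S0 j else T0 (j - m)"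
    and ?s = "\<lambda>j. if j \<le> m then s j else t (j - m)"
  let ?\<iota> = "\<lambda>j. if j \<le> m then tP * \<iota> j else iP * \<kappa> (j - m)"
  let ?\<pi>' = "\<lambda>j. if j \<le> m then \<pi>' j * pQ else \<rho>' (j - m) * rQ"
  have "\<forall>k\<in>{1..m + n}. \<forall>l\<in>{1..m + n}. l \<le> k \<longrightarrow>
        ?\<pi>' l * emb P Q M * ?\<iota> k = (if k = l then emb (?S1 k) (?S0 k) (?s k) else 0)"
  proof (intro ballI impI)
    fix k l assume hclass: "k \<in> {1..m + n}" "l \<in> {1..m + n}" "l \<le> k"
    \<comment> \<open>Since \<open>l \<le> k\<close>, the three cases lie in the block
      \<open>M2\<close>, the zero block and the block \<open>M1\<close>; the arbitrary block never
      occurs.\<close>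
    consider "k \<le> m" | "l \<le> m" "\<not> k \<le> m" | "\<not> l \<le> m"
      by blast
    then show "?\<pi>' l * emb P Q M * ?\<iota> k = (if k = l then emb (?S1 k) (?S0 k) (?s k) else 0)"
    proof cases
      case 1
      then have "?\<pi>' l * emb P Q M * ?\<iota> k = \<pi>' l * (pQ * emb P Q M * tP) * \<iota> k"
        using hclass by (simp add: mult.assoc)
      then show ?thesis
        using 1 hclass m unfolding M2 by auto
    next
      case 2
      then have "?\<pi>' l * emb P Q M * ?\<iota> k = \<pi>' l * (pQ * emb P Q M * iP) * \<kappa> (k - m)"
        by (simp add: mult.assoc)
      then show ?thesis
        using 2 unfolding M0 by auto
    next
      case 3
      then have "?\<pi>' l * emb P Q M * ?\<iota> k = \<rho>' (l - m) * (rQ * emb P Q M * iP) * \<kappa> (k - m)"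
        using hclass by (simp add: mult.assoc)
      moreover have "k - m \<in> {1..n}" "l - m \<in> {1..n}" "l - m \<le> k - m"
        using 3 hclass by auto
      ultimately show ?thesis
        using 3 hclass m' unfolding M1 by auto
    qed
  qed
  moreover have "\<forall>j\<in>{1..m + n}. (?S1 j, ?S0 j, ?s j) \<in> S"
  proof
    fix j assume "j \<in> {1..m + n}"
    then have "j \<in> {1..m} \<or> \<not> j \<le> m \<and> j - m \<in> {1..n}"
      by auto
    then show "(?S1 j, ?S0 j, ?s j) \<in> S"
      using s t by auto
  qed
  moreover note dsum_append[OF d(1) d'(1) P] dsum_append[OF d(2) d'(2) Q]
  ultimately show ?thesis
    unfolding triangular_def using M by (intro conjI exI)
qed

lemma triangular_zero: "triangular S 0 z z (Zero A z z)"
  unfolding triangular_def using zero_ob Zero_in by (auto simp: dsum_def)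

lemma triangular_single:
  assumes "(X, Y, s) \<in> S" "X \<in> Ob A" "Y \<in> Ob A" "s \<in> Hom A X Y"
  shows "triangular S 1 X Y s"
proof -
  have d: "dsum {1..1::nat} (\<lambda>_. V) V (\<lambda>_. e V) (\<lambda>_. e V)" if "V \<in> Ob A" for V
    using that e_e e_in by (simp add: dsum_def)
  have "\<forall>k\<in>{1..1::nat}. \<forall>l\<in>{1..1}. l \<le> k \<longrightarrow> e Y * emb X Y s * e X = (if k = l then emb X Y s else 0)"
    using e_left[OF emb_emb_hom[OF assms(2-4)]] e_right[OF emb_emb_hom[OF assms(2-4)]] by simp
  moreover have "\<forall>j\<in>{1..1::nat}. (X, Y, s) \<in> S"
    using assms by simp
  ultimately show ?thesis
    unfolding triangular_def using assms(4) d[OF assms(2)] d[OF assms(3)]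
    by (intro conjI exI[of _ "\<lambda>_. X"] exI[of _ "\<lambda>_. Y"] exI[of _ "\<lambda>_. s"] exI)
qed

lemma triangular_Ob: "triangular S n P Q M \<Longrightarrow> P \<in> Ob A \<and> Q \<in> Ob A \<and> M \<in> Hom A P Q"
  unfolding triangular_def dsum_def by blast

section \<open>Extension-closed classes\<close>

lemma zero_cone: "cone A z z (Zero A z z) \<in> bc" "E (obj (cone A z z (Zero A z z))) = 0"
  using zero_ob Zero_in by (simp_all add: cone_bc E_cone deg0_deg1_zero)

text \<open>The definition of extension-closed does not mention isomorphisms; invariance comes from
  the triangle 0, \<open>Y\<close>, \<open>X\<close>, whose first term is a zero object.\<close>

lemma closed_heqv:
  assumes cl: "extension_closed (Kb A) \<E>" and X: "X \<in> \<E>" and "heqv X Y"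
  shows "Y \<in> \<E>"
proof -
  let ?O = "cone A z z (Zero A z z)"
  have Y: "Y \<in> bc"
    using assms heqv_bc by blast
  have "?O \<in> \<E>"
    using cl zero_object_KbI[OF zero_cone] by (simp add: extension_closed_def)
  \<comment> \<open>\<open>Y\<close> is its own cone over the zero map from \<open>?O\<close>, as
    the identity of \<open>?O\<close> vanishes.\<close>
  moreover have "cone_ext A ?O Y Y 0 0 (E (obj Y)) 0 (E (obj Y))"
    using zero_cone Y
    by unfold_locales
      (simp_all add: graded_hom_zero bc_Ob E_in E_left[OF E_in] E_left[OF D_in[OF Y]] E_right[OF D_in[OF Y]])
  then have "\<exists>u v w. (?O, Y, X, u, v, w) \<in> Distinguished (Kb A)"
    using distinguishedI hinv_sym assms(3) unfolding heqv_def by blast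
  ultimately show ?thesis
    using cl X unfolding extension_closed_def by blast
qed

text \<open>The inclusion is completed by its cone, which is then replaced by the homotopy
  equivalent \<open>Z\<close>.\<close>

lemma closed_split_ext:
  assumes cl: "extension_closed (Kb A) \<E>" and "X \<in> \<E>" "Z \<in> \<E>" and S: "split_ext A X Z Y i t r p w"
  shows "Y \<in> \<E>"
proof -
  obtain K a b a' b' where "cone_ext A X Y K i a b a' b'"
    using ex_cone_ext[OF split_ext.i_chain_map[OF S]] .
  from distinguishedI[OF this hinv_cone_of_inclusion[OF S this]] show ?thesis
    using assms unfolding extension_closed_def by blast
qed

text \<open>\<open>P\<close> and \<open>Q\<close> may be any direct sums, so for the induction step
  sums \<open>P'\<close> and \<open>Q'\<close> of the first \<open>n\<close> summands are chosen
  afresh. For \<open>n = 0\<close> both terms are empty sums and the complex is zero.\<close>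

lemma closed_triangular:
  assumes cl: "extension_closed (Kb A) \<E>" and S: "S \<subseteq> arrows A"
    and SE: "\<And>X Y s. (X, Y, s) \<in> S \<Longrightarrow> cone A X Y s \<in> \<E>"
  shows "triangular S n P Q M \<Longrightarrow> cone A P Q M \<in> \<E>"
proof (induction n arbitrary: P Q M)
  case 0
  then have "e P = 0" "e Q = 0" "P \<in> Ob A" "Q \<in> Ob A" "M \<in> Hom A P Q"
    by (auto simp: triangular_def dsum_def)
  then have "is_zero_object (Kb A) (cone A P Q M)"
    by (intro zero_object_KbI) (simp_all add: cone_bc E_cone deg0_deg1_zero)
  then show ?case
    using cl by (simp add: extension_closed_def)
next
  case (Suc n)
  then have M: "M \<in> Hom A P Q"
    by (simp add: triangular_def)
  obtain S1 S0 s \<iota> \<pi> \<iota>' \<pi>' where s: "\<forall>j\<in>{1..Suc n}. (S1 j, S0 j, s j) \<in> S"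
    and d: "dsum {1..Suc n} S1 P \<iota> \<pi>" "dsum {1..Suc n} S0 Q \<iota>' \<pi>'"
    and m: "\<forall>k\<in>{1..Suc n}. \<forall>l\<in>{1..Suc n}. l \<le> k \<longrightarrow>
        \<pi>' l * emb P Q M * \<iota> k = (if k = l then emb (S1 k) (S0 k) (s k) else 0)"
    using Suc.prems unfolding triangular_def by (elim conjE exE) (rule that)
  have Ob: "P \<in> Ob A" "Q \<in> Ob A" "\<And>j. j \<in> {1..Suc n} \<Longrightarrow> S1 j \<in> Ob A" "\<And>j. j \<in> {1..Suc n} \<Longrightarrow> S0 j \<in> Ob A"
    and emb_hom: "\<And>j. j \<in> {1..Suc n} \<Longrightarrow> \<iota> j \<in> emb_hom (S1 j) P"
    using d by (auto simp: dsum_def)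
  obtain P' \<kappa> \<rho> where P': "dsum {1..n} S1 P' \<kappa> \<rho>"
    by (rule ex_dsum[of n S1]) (use Ob in auto)
  obtain Q' \<kappa>' \<rho>' where Q': "dsum {1..n} S0 Q' \<kappa>' \<rho>'"
    by (rule ex_dsum[of n S0]) (use Ob in auto)
  obtain tP pP where P: "biproduct (S1 (Suc n)) P' P (\<iota> (Suc n)) tP (\<pi> (Suc n)) pP"
    and tP: "\<And>k. k \<in> {1..n} \<Longrightarrow> tP * \<kappa> k = \<iota> k"
    using dsum_peel[OF d(1) P'] by metis
  obtain tQ pQ where Q: "biproduct (S0 (Suc n)) Q' Q (\<iota>' (Suc n)) tQ (\<pi>' (Suc n)) pQ"
    and pQ: "\<And>l. l \<in> {1..n} \<Longrightarrow> \<rho>' l * pQ = \<pi>' l"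
    using dsum_peel[OF d(2) Q'] by metis
  have Ob': "P' \<in> Ob A" "Q' \<in> Ob A"
    using P' Q' by (auto simp: dsum_def)
  have eM: "emb P Q M \<in> emb_hom P Q"
    using emb_emb_hom[OF Ob(1,2) M] .
  have hm': "pQ \<in> emb_hom Q Q'" "tP \<in> emb_hom P' P"
    using P Q by (auto simp: biproduct_def)
  have N: "pQ * emb P Q M * tP \<in> emb_hom P' Q'"
    by (rule emb_hom_mult[OF hm'(2) emb_hom_mult[OF eM hm'(1)]])
  define N where "N = unemb P' Q' (pQ * emb P Q M * tP)"
  have N: "N \<in> Hom A P' Q'" "emb P' Q' N = pQ * emb P Q M * tP"
    unfolding N_def using unemb[OF N] by auto
  have "triangular S n P' Q' N"
    unfolding triangular_def
  proof (intro conjI exI N)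
    show "\<forall>j\<in>{1..n}. (S1 j, S0 j, s j) \<in> S"
      using s by simp
    show "\<forall>k\<in>{1..n}. \<forall>l\<in>{1..n}. l \<le> k \<longrightarrow>
        \<rho>' l * emb P' Q' N * \<kappa> k = (if k = l then emb (S1 k) (S0 k) (s k) else 0)"
    proof (intro ballI impI)
      fix k l assume hclass: "k \<in> {1..n}" "l \<in> {1..n}" "l \<le> k"
      have "\<rho>' l * emb P' Q' N * \<kappa> k = (\<rho>' l * pQ) * emb P Q M * (tP * \<kappa> k)"
        by (simp add: N mult.assoc)
      also have "\<dots> = \<pi>' l * emb P Q M * \<iota> k"
        using hclass tP pQ by simp
      finally show "\<rho>' l * emb P' Q' N * \<kappa> k = (if k = l then emb (S1 k) (S0 k) (s k) else 0)"
        using hclass m by simp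
    qed
  qed (rule P' Q')+
  then have Z: "cone A P' Q' N \<in> \<E>"
    by (rule Suc.IH)
  have sn: "(S1 (Suc n), S0 (Suc n), s (Suc n)) \<in> S"
    using s by simp
  then have sh: "s (Suc n) \<in> Hom A (S1 (Suc n)) (S0 (Suc n))"
    using S by (auto simp: arrows_def)
  \<comment> \<open>Expanding the identity of \<open>Q\<close>: in the last column only the diagonal
    entry survives, so the last summands form a subcomplex.\<close>
  have "emb P Q M * \<iota> (Suc n) = (\<Sum>l\<in>{1..Suc n}. \<iota>' l * \<pi>' l) * (emb P Q M * \<iota> (Suc n))"
    using d(2) e_left[OF emb_hom_mult[OF emb_hom eM]] by (simp add: dsum_def)
  also have "\<dots> = (\<Sum>l\<in>{1..Suc n}. \<iota>' l * (\<pi>' l * emb P Q M * \<iota> (Suc n)))"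
    by (simp only: sum_distrib_right mult.assoc)
  also have "\<dots> = (\<Sum>l\<in>{1..Suc n}. if l = Suc n then \<iota>' (Suc n) * emb (S1 (Suc n)) (S0 (Suc n)) (s (Suc n)) else 0)"
    using m by (intro sum.cong[OF refl]) auto
  also have "\<dots> = \<iota>' (Suc n) * emb (S1 (Suc n)) (S0 (Suc n)) (s (Suc n))"
    by simp
  finally have Mi: "emb P Q M * \<iota> (Suc n) = \<iota>' (Suc n) * emb (S1 (Suc n)) (S0 (Suc n)) (s (Suc n))" .
  \<comment> \<open>Expanding the identity of \<open>P\<close>: the part on the last summand lands
    in the last summand of \<open>Q\<close>, which \<open>pQ\<close> kills.\<close>
  have "pQ * emb P Q M = pQ * emb P Q M * (\<iota> (Suc n) * \<pi> (Suc n) + tP * pP)"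
    using P e_right[OF emb_hom_mult[OF eM hm'(1)]] by (simp add: biproduct_def)
  also have "\<dots> = pQ * (emb P Q M * \<iota> (Suc n)) * \<pi> (Suc n) + emb P' Q' N * pP"
    by (simp add: N algebra_simps)
  also have "pQ * (emb P Q M * \<iota> (Suc n)) = 0"
    using Q unfolding Mi by (simp add: biproduct_def flip: mult.assoc)
  finally have pM: "pQ * emb P Q M = emb P' Q' N * pP"
    by simp
  from split_cone[OF P Q sh N(1) M Mi pM] show ?case
    using closed_split_ext[OF cl SE[OF sn] Z] by blast
qed

text \<open>The converse of cutting a matrix: every connecting morphism between two-term complexes
  is one block \<open>h\<close>, and it fits below the diagonal because the quotient
  \<open>P2\<close> is numbered first.\<close>

lemma triangular_twisted_sum:
  assumes "triangular S n P1 Q1 M1" "triangular S m P2 Q2 M2"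
    and g: "g \<in> graded_hom 1 (obj (cone A P2 Q2 M2)) (obj (cone A P1 Q1 M1))"
  obtains P Q M i t r p where "triangular S (m + n) P Q M"
    "split_ext A (cone A P1 Q1 M1) (cone A P2 Q2 M2) (cone A P Q M) i t r p g"
proof -
  have Ob: "P1 \<in> Ob A" "Q1 \<in> Ob A" "P2 \<in> Ob A" "Q2 \<in> Ob A" and M1: "M1 \<in> Hom A P1 Q1" and M2: "M2 \<in> Hom A P2 Q2"
    using assms triangular_Ob by blast+
  obtain h where h: "h \<in> emb_hom P2 Q1" "g = deg1 h"
    using degree1_cone[OF g] .
  obtain P iP tP rP pP where P: "P \<in> Ob A" "biproduct P1 P2 P iP tP rP pP"
    using ex_biproduct[OF Ob(1,3)] unfolding biproduct_def by metis
  obtain Q iQ tQ rQ pQ where Q: "Q \<in> Ob A" "biproduct Q1 Q2 Q iQ tQ rQ pQ"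
    using ex_biproduct[OF Ob(2,4)] unfolding biproduct_def by metis
  have p: "iP \<in> emb_hom P1 P" "tP \<in> emb_hom P2 P" "rP \<in> emb_hom P P1" "pP \<in> emb_hom P P2"
    "rP * iP = e P1" "pP * tP = e P2" "rP * tP = 0" "pP * iP = 0"
    and q: "iQ \<in> emb_hom Q1 Q" "tQ \<in> emb_hom Q2 Q" "rQ \<in> emb_hom Q Q1" "pQ \<in> emb_hom Q Q2"
    "rQ * iQ = e Q1" "pQ * tQ = e Q2" "rQ * tQ = 0" "pQ * iQ = 0"
    using P Q by (auto simp: biproduct_def)
  note e1 = emb_emb_hom[OF Ob(1,2) M1] and e2 = emb_emb_hom[OF Ob(3,4) M2]
  \<comment> \<open>The block matrix with \<open>M1\<close> and \<open>M2\<close> on the diagonal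
    and \<open>h\<close>, from \<open>P2\<close> to \<open>Q1\<close>, off it.\<close>
  define N where "N = iQ * emb P1 Q1 M1 * rP + tQ * emb P2 Q2 M2 * pP + iQ * h * pP"
  have N: "N \<in> emb_hom P Q"
    unfolding N_def
    by (intro emb_hom_add emb_hom_mult[OF p(3) emb_hom_mult[OF e1 q(1)]] emb_hom_mult[OF p(4) emb_hom_mult[OF e2 q(2)]]
        emb_hom_mult[OF p(4) emb_hom_mult[OF h(1) q(1)]])
  define M where "M = unemb P Q N"
  have M: "M \<in> Hom A P Q" "emb P Q M = N"
    unfolding M_def using unemb[OF N] by auto
  note rels = p(5-8) q(5-8) e_left[OF e1] e_right[OF e1] e_left[OF e2] e_right[OF e2] e_left[OF h(1)] e_right[OF h(1)]
    e_left[OF p(4)]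
  note simps = N_def algebra_simps rels rels[THEN mult_eq]
  have "triangular S (m + n) P Q M"
    by (rule triangular_append[OF assms(2,1) P(2) Q(2) M(1)]) (simp_all add: M(2) simps)
  moreover have "split_ext A (cone A P1 Q1 M1) (cone A P2 Q2 M2) (cone A P Q M)
    (deg0 iP iQ) (deg0 tP tQ) (deg0 rP rQ) (deg0 pP pQ) (deg1 (rQ * emb P Q M * tP))"
    by (rule split_cone[OF P(2) Q(2) M1 M2 M(1)]) (simp_all add: M(2) simps)
  moreover have "deg1 (rQ * emb P Q M * tP) = g"
    by (simp add: h(2) M(2) simps)
  ultimately show thesis
    using that by metis
qed

definition triangular_complexes :: "('o \<times> 'o \<times> 'm) set \<Rightarrow> ('o, 'm) cpx set" where
  "triangular_complexes S = {X. \<exists>n P Q M. triangular S n P Q M \<and> heqv X (cone A P Q M)}"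

lemma extension_closed_triangular_complexes: "extension_closed (Kb A) (triangular_complexes S)"
  unfolding extension_closed_def
proof (intro conjI allI impI)
  show "triangular_complexes S \<subseteq> Ob (Kb A)"
    using heqv_bc by (auto simp: triangular_complexes_def Ob_Kb)
  show "Z \<in> triangular_complexes S" if "is_zero_object (Kb A) Z" for Z
    unfolding triangular_complexes_def using zero_object_Kb_heqv[OF that zero_cone] triangular_zero by blast
next
  fix X Y Z u v w
  assume *: "(X, Y, Z, u, v, w) \<in> Distinguished (Kb A) \<and> X \<in> triangular_complexes S \<and> Z \<in> triangular_complexes S"
  obtain n P1 Q1 M1 where t1: "triangular S n P1 Q1 M1" and X: "heqv X (cone A P1 Q1 M1)"
    using * by (auto simp: triangular_complexes_def)
  obtain m P2 Q2 M2 where t2: "triangular S m P2 Q2 M2" and Z: "heqv Z (cone A P2 Q2 M2)"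
    using * by (auto simp: triangular_complexes_def)
  obtain X' Y' K f a b a' b' where c: "cone_ext A X' Y' K f a b a' b'"
    and eqv: "heqv X X'" "heqv Y Y'" "heqv Z K"
    using distinguishedE * by metis
  interpret C: cone_ext A X' Y' K f a b a' b' by fact
  \<comment> \<open>The condition under which \<open>a'\<close> is the connecting morphism of an
    extension \<open>W\<close> of \<open>K\<close> by \<open>X'\<close>.\<close>
  have "D X' * a' + a' * D K = 0"
    by (simp add: C.a'D)
  then obtain W i t r p where W: "split_ext A X' K W i t r p a'"
    using ex_split_ext[OF C.X C.K C.a'] by blast
  obtain \<alpha> \<alpha>' where al: "hinv X' (cone A P1 Q1 M1) \<alpha> \<alpha>'"
    using heqv_trans[OF heqv_sym[OF eqv(1)] X] by (auto simp: heqv_def)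
  obtain \<gamma> \<gamma>' where ga: "hinv K (cone A P2 Q2 M2) \<gamma> \<gamma>'"
    using heqv_trans[OF heqv_sym[OF eqv(3)] Z] by (auto simp: heqv_def)
  \<comment> \<open>The connecting morphism is transported to the two-term models of
    \<open>X'\<close> and \<open>K\<close>. The extension it defines there is again two-term, and
    equivalent to \<open>W\<close> by \<open>heqv_split_ext\<close>.\<close>
  have "\<alpha> * a' * \<gamma>' \<in> graded_hom 1 (obj (cone A P2 Q2 M2)) (obj (cone A P1 Q1 M1))"
    using al ga by (auto simp: hinv_def intro!: graded_hom_mult[OF chain_map_graded_hom graded_hom_mult[OF C.a' chain_map_graded_hom], where m=1])
  then obtain P Q M i' t' r' p' where T: "triangular S (m + n) P Q M"
    "split_ext A (cone A P1 Q1 M1) (cone A P2 Q2 M2) (cone A P Q M) i' t' r' p' (\<alpha> * a' * \<gamma>')"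
    using triangular_twisted_sum[OF t1 t2] by metis
  have "heqv Y (cone A P Q M)"
    using heqv_trans[OF eqv(2) heqv_trans[OF heqv_cocone[OF c W] heqv_split_ext[OF W T(2) al ga refl]]] .
  with T(1) show "Y \<in> triangular_complexes S"
    by (auto simp: triangular_complexes_def)
qed

theorem extension_closure_cones:
  assumes S: "S \<subseteq> arrows A"
  shows "extension_closure (Kb A) {cone A X Y s | X Y s. (X, Y, s) \<in> S} = triangular_complexes S"
proof
  have "cone A X Y s \<in> triangular_complexes S" if "(X, Y, s) \<in> S" for X Y s
  proof -
    have "X \<in> Ob A" "Y \<in> Ob A" "s \<in> Hom A X Y"
      using S that by (auto simp: arrows_def)
    then show ?thesis
      unfolding triangular_complexes_def using triangular_single[OF that] heqv_refl[OF cone_bc] by blast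
  qed
  then show "extension_closure (Kb A) {cone A X Y s | X Y s. (X, Y, s) \<in> S} \<subseteq> triangular_complexes S"
    unfolding extension_closure_def using extension_closed_triangular_complexes by blast
next
  show "triangular_complexes S \<subseteq> extension_closure (Kb A) {cone A X Y s | X Y s. (X, Y, s) \<in> S}"
    unfolding extension_closure_def
  proof (rule subsetI, rule InterI)
    fix X \<E> assume "X \<in> triangular_complexes S"
      and "\<E> \<in> {\<E>. extension_closed (Kb A) \<E> \<and> {cone A X Y s | X Y s. (X, Y, s) \<in> S} \<subseteq> \<E>}"
    then have cl: "extension_closed (Kb A) \<E>" "\<And>X Y s. (X, Y, s) \<in> S \<Longrightarrow> cone A X Y s \<in> \<E>"
      and "\<exists>n P Q M. triangular S n P Q M \<and> heqv X (cone A P Q M)"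
      by (auto simp: triangular_complexes_def)
    then obtain n P Q M where X: "triangular S n P Q M" "heqv X (cone A P Q M)"
      by blast
    show "X \<in> \<E>"
      using closed_heqv[OF cl(1) closed_triangular[OF cl(1) S cl(2) X(1)] heqv_sym[OF X(2)]] .
  qed
qed

end

theorem proposition3p1p4:
  fixes A :: "('o, 'm) precat"
    and S :: "('o \<times> 'o \<times> 'm) set"
  assumes "additive_category A"
    and "S \<subseteq> arrows A"
  shows "extension_closure (Kb A) {cone A X Y s | X Y s. (X, Y, s) \<in> S} =
    {X \<in> Ob (Kb A). \<exists>(n::nat) S1 S0 s f P \<iota>P \<pi>P Q \<iota>Q \<pi>Q M.
       (\<forall>j\<in>{1..n}. (S1 j, S0 j, s j) \<in> S) \<and>
       (\<forall>k\<in>{1..n}. \<forall>l\<in>{1..n}. k < l \<longrightarrow> f k l \<in> Hom A (S1 k) (S0 l)) \<and>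
       is_direct_sum A {1..n} S1 P \<iota>P \<pi>P \<and>
       is_direct_sum A {1..n} S0 Q \<iota>Q \<pi>Q \<and>
       given_by_matrix A {1..n} S1 P \<iota>P {1..n} S0 Q \<pi>Q
         (\<lambda>k l. if k = l then s k else if k < l then f k l else Zero A (S1 k) (S0 l)) M \<and>
       isomorphic (Kb A) X (cone A P Q M)}"
proof -
  interpret addit A
    using assms(1) by (simp add: addit_def)
  have "triangular_complexes S = {X \<in> Ob (Kb A). \<exists>n P Q M. triangular S n P Q M \<and> isomorphic (Kb A) X (cone A P Q M)}"
    using heqv_bc by (auto simp: triangular_complexes_def isomorphic_Kb_iff Ob_Kb)
  then have *: "X \<in> extension_closure (Kb A) {cone A X Y s | X Y s. (X, Y, s) \<in> S} \<longleftrightarrow>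
    X \<in> Ob (Kb A) \<and> (\<exists>n P Q M. triangular S n P Q M \<and> isomorphic (Kb A) X (cone A P Q M))" for X
    by (simp add: extension_closure_cones[OF assms(2)])
  \<comment> \<open>What remains is to regroup the existential quantifiers, which
    \<open>triangular_iff\<close> leaves nested below those for \<open>P\<close>, \<open>Q\<close>
    and \<open>M\<close>.\<close>
  show ?thesis
    unfolding set_eq_iff mem_Collect_eq * triangular_iff[OF assms(2)]
    by (intro allI iffI; elim conjE exE; intro conjI exI; assumption)
qed
end
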